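(* Let $T$ be a complete first-order theory with monster model $\mathbb{M}$. For every sufficiently large cardinal $\kappa$ (i.e. there is a cardinal $\kappa_0$ such that for every cardinal $\kappa\ge\kappa_0$) the following holds. Let $\{X_0,\ldots,X_n\}$ be a collapsible family in $\omega^{<\kappa}$. Then for any $\nu,\xi\in\omega^{<\kappa}$ with $\nu\perp\xi$ and $\nu<_{lex}\xi$, the family $$\{X_i^\nu\cup X_j^\xi: i,j\le n\}$$ is a collapsible family, where $X_i^\nu=\nu^\frown X_i$ and $X_j^\xi=\xi^\frown X_j$ for $i,j\le n$.
   Context: $\omega^{<\kappa}=\bigcup_{\alpha<\kappa}\omega^\alpha$. $\eta\trianglelefteq\nu$ means $\eta\subseteq\nu$; $\eta\perp\nu$ means incomparable; $\eta\wedge\nu$ is the largest common initial segment; $\eta<_{lex}\nu$ means $\eta\trianglelefteq\nu$, or $\eta\perp\nu$ and $\eta(l)<\nu(l)$ with $l$ the domain of $\eta\wedge\nu$; $\eta^\frown X=\{\eta^\frown x:x\in X\}$ (concatenation). Trees are structures in $\mathcal{L}_0=\{\trianglelefteq,<_{lex},\wedge\}$; $\bar\eta\sim_0\bar\nu$ means that the tuples have the same quantifier-free $\mathcal{L}_0$-type. Sets of indices written with $\sim_0$ are treated as tuples via fixed corresponding enumerations (for unions, concatenated enumerations). An antichain is a set of pairwise incomparable elements. An antichain $X\subseteq\omega^{<\kappa}$ is universal if for each finite antichain $Y\subseteq\omega^{<\kappa}$ there is $X_0\subseteq X$ with $Y\sim_0X_0$. On an antichain $X$ consider the language $\mathcal{L}_\delta=\{\Delta,<_{lex}\}$,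 with $\Delta(\eta_0,\eta_1,\eta_2,\eta_3)$ iff $\eta_0\wedge\eta_1\trianglelefteq\eta_2\wedge\eta_3$; $\bar\eta\sim_\delta\bar\nu$ means equal quantifier-free $\mathcal{L}_\delta$-types. A family $(a_\eta)_{\eta\in X}$ is $\delta$-indiscernible over $B$ if $\bar\eta\sim_\delta\bar\nu$ implies $\mathrm{tp}(a_{\bar\eta}/B)=\mathrm{tp}(a_{\bar\nu}/B)$. A tree $(a_\eta)$ is strongly indiscernible over $C$ if $\bar\eta\sim_0\bar\nu$ implies $\mathrm{tp}(a_{\bar\eta}/C)=\mathrm{tp}(a_{\bar\nu}/C)$. A formula $\varphi(y,z)$ witnesses ATP if there is $(c_\eta)_{\eta\in 2^{<\omega}}$ in $\mathbb{M}$ with $\{\varphi(y,c_\eta):\eta\in X\}$ consistent for every antichain $X\subseteq 2^{<\omega}$ and $\{\varphi(y,c_\eta),\varphi(y,c_\nu)\}$ inconsistent whenever $\eta\trianglelefteq\nu$, $\eta\ne\nu$. Let $X_0,\ldots,X_n\subseteq\omega^{<\kappa}$ be universal antichains with $|X_0|=\dots=|X_n|$ and $X_0\sim_0\dots\sim_0X_n$. They are collapsible (form a collapsible family) if: for any set $C\subseteq\mathbb{M}$, any $b\in\mathbb{M}$, any tree $(a_\eta)_{\eta\in\omega^{<\kappa}}$ strongly indiscernible over $C$, and any $i\le n$, if $(a_\eta)_{\eta\in X_i}$ is $\delta$-indiscernible over $bC$, then either $\bigcup_{j\le n}p(y,(a_\eta)_{\eta\in X_j})$ is consistent, where $p(y,\bar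 z)=\mathrm{tp}(b,(a_\eta)_{\eta\in X_i}/C)$, or there is a formula with free (object) variable $y$ which witnesses ATP. *)

theory Defs
  imports Main "HOL-Library.Sublist"
begin

unbundle cardinal_syntax

section \<open>First-order logic\<close>

text \<open>A language assigns arities to its symbols; \<open>None\<close> means that the symbol does not belong
  to the language. Equality is logical.\<close>

record ('f, 'p) lang =
  farity :: "'f \<Rightarrow> nat option"
  parity :: "'p \<Rightarrow> nat option"

datatype 'f tm = Var nat | Fn 'f "'f tm list"

datatype ('f, 'p) fm =
    Eq "'f tm" "'f tm"
  | Rel 'p "'f tm list"
  | Neg "('f, 'p) fm"
  | Conj "('f, 'p) fm" "('f, 'p) fm"
  | Ex nat "('f, 'p) fm"

fun wf_tm :: "('f, 'p) lang \<Rightarrow> 'f tm \<Rightarrow> bool" where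
  "wf_tm L (Var v) \<longleftrightarrow> True"
| "wf_tm L (Fn f ts) \<longleftrightarrow> farity L f = Some (length ts) \<and> (\<forall>t\<in>set ts. wf_tm L t)"

primrec wf_fm :: "('f, 'p) lang \<Rightarrow> ('f, 'p) fm \<Rightarrow> bool" where
  "wf_fm L (Eq s t) \<longleftrightarrow> wf_tm L s \<and> wf_tm L t"
| "wf_fm L (Rel p ts) \<longleftrightarrow> parity L p = Some (length ts) \<and> (\<forall>t\<in>set ts. wf_tm L t)"
| "wf_fm L (Neg \<phi>) \<longleftrightarrow> wf_fm L \<phi>"
| "wf_fm L (Conj \<phi> \<psi>) \<longleftrightarrow> wf_fm L \<phi> \<and> wf_fm L \<psi>"
| "wf_fm L (Ex v \<phi>) \<longleftrightarrow> wf_fm L \<phi>"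

fun vars_tm :: "'f tm \<Rightarrow> nat set" where
  "vars_tm (Var v) = {v}"
| "vars_tm (Fn f ts) = (\<Union>t\<in>set ts. vars_tm t)"

primrec FV :: "('f, 'p) fm \<Rightarrow> nat set" where
  "FV (Eq s t) = vars_tm s \<union> vars_tm t"
| "FV (Rel p ts) = (\<Union>t\<in>set ts. vars_tm t)"
| "FV (Neg \<phi>) = FV \<phi>"
| "FV (Conj \<phi> \<psi>) = FV \<phi> \<union> FV \<psi>"
| "FV (Ex v \<phi>) = FV \<phi> - {v}"

primrec qfree :: "('f, 'p) fm \<Rightarrow> bool" where
  "qfree (Eq s t) \<longleftrightarrow> True"
| "qfree (Rel p ts) \<longleftrightarrow> True"
| "qfree (Neg \<phi>) \<longleftrightarrow> qfree \<phi>"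
| "qfree (Conj \<phi> \<psi>) \<longleftrightarrow> qfree \<phi> \<and> qfree \<psi>"
| "qfree (Ex v \<phi>) \<longleftrightarrow> False"

record ('f, 'p, 'm) struct =
  carrier :: "'m set"
  fint :: "'f \<Rightarrow> 'm list \<Rightarrow> 'm"
  pint :: "'p \<Rightarrow> 'm list \<Rightarrow> bool"

definition is_struct :: "('f, 'p) lang \<Rightarrow> ('f, 'p, 'm) struct \<Rightarrow> bool" where
  "is_struct L M \<longleftrightarrow> carrier M \<noteq> {} \<and>
     (\<forall>f xs. farity L f = Some (length xs) \<and> set xs \<subseteq> carrier M \<longrightarrow> fint M f xs \<in> carrier M)"

fun val :: "('f, 'p, 'm) struct \<Rightarrow> (nat \<Rightarrow> 'm) \<Rightarrow> 'f tm \<Rightarrow> 'm" where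
  "val M e (Var v) = e v"
| "val M e (Fn f ts) = fint M f (map (val M e) ts)"

primrec sat :: "('f, 'p, 'm) struct \<Rightarrow> (nat \<Rightarrow> 'm) \<Rightarrow> ('f, 'p) fm \<Rightarrow> bool" where
  "sat M e (Eq s t) \<longleftrightarrow> val M e s = val M e t"
| "sat M e (Rel p ts) \<longleftrightarrow> pint M p (map (val M e) ts)"
| "sat M e (Neg \<phi>) \<longleftrightarrow> \<not> sat M e \<phi>"
| "sat M e (Conj \<phi> \<psi>) \<longleftrightarrow> sat M e \<phi> \<and> sat M e \<psi>"
| "sat M e (Ex v \<phi>) \<longleftrightarrow> (\<exists>a\<in>carrier M. sat M (e(v := a)) \<phi>)"

definition sentences :: "('f, 'p) lang \<Rightarrow> ('f, 'p) fm set" where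
  "sentences L = {\<phi>. wf_fm L \<phi> \<and> FV \<phi> = {}}"

definition models :: "('f, 'p) lang \<Rightarrow> ('f, 'p, 'm) struct \<Rightarrow> ('f, 'p) fm set \<Rightarrow> bool" where
  "models L M T \<longleftrightarrow> is_struct L M \<and> (\<forall>\<phi>\<in>T. \<forall>e. sat M e \<phi>)"

text \<open>Consequence and satisfiability are tested on structures whose carrier is a subset of the
  type of formulas. That type has cardinality at least \<open>|L| + \<aleph>\<^sub>0\<close>, so by the downward
  Loewenheim-Skolem theorem this is the same as testing on all structures.\<close>

definition entails :: "('f, 'p) lang \<Rightarrow> ('f, 'p) fm set \<Rightarrow> ('f, 'p) fm \<Rightarrow> bool" where
  "entails L T \<phi> \<longleftrightarrow>
     (\<forall>N :: ('f, 'p, ('f, 'p) fm) struct. models L N T \<longrightarrow> models L N {\<phi>})"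

definition complete_theory :: "('f, 'p) lang \<Rightarrow> ('f, 'p) fm set \<Rightarrow> bool" where
  "complete_theory L T \<longleftrightarrow> T \<subseteq> sentences L \<and>
     (\<exists>N :: ('f, 'p, ('f, 'p) fm) struct. models L N T) \<and>
     (\<forall>\<phi>\<in>sentences L. entails L T \<phi> \<or> entails L T (Neg \<phi>))"


section \<open>Types of tuples\<close>

text \<open>Tuples are families \<open>x :: 'i \<Rightarrow> 'm\<close> restricted to an index set \<open>I\<close>, possibly infinite.
  A formula in variables \<open>(z\<^sub>i)\<close>, \<open>i \<in> I\<close>, with parameters from \<open>B\<close> is a pair \<open>(\<phi>, \<sigma>)\<close>, where
  \<open>\<sigma>\<close> says for each free variable of \<open>\<phi>\<close> which \<open>z\<^sub>i\<close> (\<open>Inl i\<close>) or which parameter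
  (\<open>Inr c\<close>) is put in its place.\<close>

type_synonym ('f, 'p, 'i, 'm) pfm = "('f, 'p) fm \<times> (nat \<Rightarrow> 'i + 'm)"

definition pfms :: "('f, 'p) lang \<Rightarrow> 'i set \<Rightarrow> 'm set \<Rightarrow> ('f, 'p, 'i, 'm) pfm set" where
  "pfms L I B = {(\<phi>, \<sigma>). wf_fm L \<phi> \<and> \<sigma> ` FV \<phi> \<subseteq> I <+> B}"

definition holds :: "('f, 'p, 'm) struct \<Rightarrow> ('i \<Rightarrow> 'm) \<Rightarrow> ('f, 'p, 'i, 'm) pfm \<Rightarrow> bool" where
  "holds M x = (\<lambda>(\<phi>, \<sigma>). sat M (\<lambda>v. case_sum x id (\<sigma> v)) \<phi>)"

definition tp ::
  "('f, 'p) lang \<Rightarrow> ('f, 'p, 'm) struct \<Rightarrow> 'i set \<Rightarrow> ('i \<Rightarrow> 'm) \<Rightarrow> 'm set \<Rightarrow>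
   ('f, 'p, 'i, 'm) pfm set" where
  "tp L M I x B = {g \<in> pfms L I B. holds M x g}"

definition qftp ::
  "('f, 'p) lang \<Rightarrow> ('f, 'p, 'm) struct \<Rightarrow> 'i set \<Rightarrow> ('i \<Rightarrow> 'm) \<Rightarrow> ('f, 'p, 'i, 'm) pfm set" where
  "qftp L M I x = {(\<phi>, \<sigma>) \<in> tp L M I x {}. qfree \<phi>}"

text \<open>Consistency with the elementary diagram of \<open>M\<close>, that is, finite satisfiability in \<open>M\<close>,
  of a set of formulas in one object variable \<open>y\<close> with parameters in \<open>M\<close>.\<close>

definition consistent ::
  "('f, 'p, 'm) struct \<Rightarrow> ('f, 'p, unit, 'm) pfm set \<Rightarrow> bool" where
  "consistent M \<Gamma> \<longleftrightarrow>
     (\<forall>\<Gamma>\<^sub>0. finite \<Gamma>\<^sub>0 \<and> \<Gamma>\<^sub>0 \<subseteq> \<Gamma> \<longrightarrow> (\<exists>d\<in>carrier M. \<forall>g\<in>\<Gamma>\<^sub>0. holds M (\<lambda>_. d) g))"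


section \<open>Monster models\<close>

definition saturated :: "('f, 'p) lang \<Rightarrow> 'l rel \<Rightarrow> ('f, 'p, 'm) struct \<Rightarrow> bool" where
  "saturated L lam M \<longleftrightarrow>
     (\<forall>B \<Gamma>. B \<subseteq> carrier M \<and> |B| <o lam \<and> \<Gamma> \<subseteq> pfms L UNIV B \<and> consistent M \<Gamma> \<longrightarrow>
        (\<exists>d\<in>carrier M. \<forall>g\<in>\<Gamma>. holds M (\<lambda>_. d) g))"

definition automorphism :: "('f, 'p) lang \<Rightarrow> ('f, 'p, 'm) struct \<Rightarrow> ('m \<Rightarrow> 'm) \<Rightarrow> bool" where
  "automorphism L M h \<longleftrightarrow> bij_betw h (carrier M) (carrier M) \<and>
     (\<forall>f xs. farity L f = Some (length xs) \<and> set xs \<subseteq> carrier M \<longrightarrow>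
        h (fint M f xs) = fint M f (map h xs)) \<and>
     (\<forall>p xs. parity L p = Some (length xs) \<and> set xs \<subseteq> carrier M \<longrightarrow>
        pint M p (map h xs) = pint M p xs)"

definition strongly_homogeneous ::
  "('f, 'p) lang \<Rightarrow> 'l rel \<Rightarrow> ('f, 'p, 'm) struct \<Rightarrow> bool" where
  "strongly_homogeneous L lam M \<longleftrightarrow>
     (\<forall>A h. A \<subseteq> carrier M \<and> |A| <o lam \<and> h ` A \<subseteq> carrier M \<and>
        tp L M A h {} = tp L M A id {} \<longrightarrow>
        (\<exists>g. automorphism L M g \<and> (\<forall>a\<in>A. g a = h a)))"

text \<open>A set is small if its cardinality is less than \<open>lam\<close>.\<close>

definition monster_model ::
  "('f, 'p) lang \<Rightarrow> ('f, 'p) fm set \<Rightarrow> 'l rel \<Rightarrow> ('f, 'p, 'm) struct \<Rightarrow> bool" where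
  "monster_model L T lam M \<longleftrightarrow> models L M T \<and> Card_order lam \<and> \<not> finite (Field lam) \<and>
     saturated L lam M \<and> strongly_homogeneous L lam M"


section \<open>The tree\<close>

text \<open>A cardinal \<open>\<kappa>\<close> is a relation satisfying \<open>Card_order\<close>; the ordinals below \<open>\<kappa>\<close> are the
  elements of \<open>Field \<kappa>\<close>, and as a set of ordinals such an \<open>\<alpha>\<close> is \<open>underS \<kappa> \<alpha>\<close>. An element of
  \<open>\<omega>\<^sup>\<alpha>\<close> is a partial function with this domain, and inclusion of functions is
  \<open>(\<subseteq>\<^sub>m)\<close>.\<close>

type_synonym 'k node = "'k \<Rightarrow> nat option"

definition tree :: "'k rel \<Rightarrow> 'k node set" where
  "tree \<kappa> = {\<eta>. \<exists>\<alpha>\<in>Field \<kappa>. dom \<eta> = underS \<kappa> \<alpha>}"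

definition perp :: "'k node \<Rightarrow> 'k node \<Rightarrow> bool" where
  "perp \<eta> \<nu> \<longleftrightarrow> \<not> \<eta> \<subseteq>\<^sub>m \<nu> \<and> \<not> \<nu> \<subseteq>\<^sub>m \<eta>"

definition meet :: "'k rel \<Rightarrow> 'k node \<Rightarrow> 'k node \<Rightarrow> 'k node" where
  "meet \<kappa> \<eta> \<nu> = \<eta> |` {\<alpha>. \<forall>\<beta>. (\<beta>, \<alpha>) \<in> \<kappa> \<longrightarrow> \<eta> \<beta> = \<nu> \<beta>}"

lemma meet_greatest_common_initial_segment:
  assumes "Well_order \<kappa>" "\<eta> \<in> tree \<kappa>" "\<nu> \<in> tree \<kappa>"
  shows "meet \<kappa> \<eta> \<nu> \<in> tree \<kappa>" "meet \<kappa> \<eta> \<nu> \<subseteq>\<^sub>m \<eta>" "meet \<kappa> \<eta> \<nu> \<subseteq>\<^sub>m \<nu>"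
    "\<And>\<rho>. \<rho> \<in> tree \<kappa> \<Longrightarrow> \<rho> \<subseteq>\<^sub>m \<eta> \<Longrightarrow> \<rho> \<subseteq>\<^sub>m \<nu> \<Longrightarrow> \<rho> \<subseteq>\<^sub>m meet \<kappa> \<eta> \<nu>"
proof -
  interpret w: wo_rel \<kappa> using assms(1) by (simp add: wo_rel_def)
  obtain \<alpha> where \<alpha>: "\<alpha> \<in> Field \<kappa>" "dom \<eta> = underS \<kappa> \<alpha>"
    using assms(2) by (auto simp: tree_def)
  define D where "D = dom (meet \<kappa> \<eta> \<nu>)"
  have D: "D = {\<gamma> \<in> underS \<kappa> \<alpha>. \<forall>\<beta>. (\<beta>, \<gamma>) \<in> \<kappa> \<longrightarrow> \<eta> \<beta> = \<nu> \<beta>}"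
    using \<alpha>(2) by (auto simp: D_def meet_def)
  have "w.ofilter D"
    unfolding w.ofilter_def
  proof (intro conjI ballI subsetI)
    fix \<gamma> assume "\<gamma> \<in> D"
    then show "\<gamma> \<in> Field \<kappa>" unfolding D by (auto simp: underS_def Field_def)
  next
    fix \<gamma> \<beta> assume g: "\<gamma> \<in> D" and b: "\<beta> \<in> under \<kappa> \<gamma>"
    have bg: "(\<beta>, \<gamma>) \<in> \<kappa>" using b by (simp add: under_def)
    have "\<beta> \<in> underS \<kappa> \<alpha>"
      using g bg unfolding D underS_def
      by simp (metis w.ANTISYM w.TRANS antisymD transD)
    moreover have "(\<delta>, \<gamma>) \<in> \<kappa>" if "(\<delta>, \<beta>) \<in> \<kappa>" for \<delta>
      using that bg w.TRANS by (meson transD)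
    ultimately show "\<beta> \<in> D" using g unfolding D by blast
  qed
  moreover have "D \<noteq> Field \<kappa>"
    using \<alpha>(1) unfolding D by (auto simp: underS_def)
  ultimately obtain \<delta> where "\<delta> \<in> Field \<kappa>" "D = underS \<kappa> \<delta>"
    using w.ofilter_underS_Field[of D] by blast
  then show "meet \<kappa> \<eta> \<nu> \<in> tree \<kappa>" unfolding tree_def D_def by blast
  show "meet \<kappa> \<eta> \<nu> \<subseteq>\<^sub>m \<eta>" by (auto simp: meet_def map_le_def)
  have refl: "(\<gamma>, \<gamma>) \<in> \<kappa>" if "\<gamma> \<in> dom \<eta>" for \<gamma>
    using that \<alpha>(2) w.REFL by (auto simp: underS_def refl_on_def Field_def)
  show "meet \<kappa> \<eta> \<nu> \<subseteq>\<^sub>m \<nu>"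
    unfolding map_le_def
  proof
    fix \<gamma> assume "\<gamma> \<in> dom (meet \<kappa> \<eta> \<nu>)"
    then have "\<gamma> \<in> dom \<eta>" "\<forall>\<beta>. (\<beta>, \<gamma>) \<in> \<kappa> \<longrightarrow> \<eta> \<beta> = \<nu> \<beta>"
      unfolding meet_def dom_restrict by blast+
    then show "meet \<kappa> \<eta> \<nu> \<gamma> = \<nu> \<gamma>"
      using refl by (simp add: meet_def)
  qed
  fix \<rho> assume r: "\<rho> \<in> tree \<kappa>" "\<rho> \<subseteq>\<^sub>m \<eta>" "\<rho> \<subseteq>\<^sub>m \<nu>"
  obtain \<beta> where \<beta>: "dom \<rho> = underS \<kappa> \<beta>" using r(1) by (auto simp: tree_def)
  show "\<rho> \<subseteq>\<^sub>m meet \<kappa> \<eta> \<nu>"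
    unfolding map_le_def
  proof
    fix \<gamma> assume g: "\<gamma> \<in> dom \<rho>"
    have "\<delta> \<in> dom \<rho>" if "(\<delta>, \<gamma>) \<in> \<kappa>" for \<delta>
      using that g unfolding \<beta> underS_def
      by simp (metis w.ANTISYM w.TRANS antisymD transD)
    then have "\<eta> \<delta> = \<nu> \<delta>" if "(\<delta>, \<gamma>) \<in> \<kappa>" for \<delta>
      using that r(2,3) unfolding map_le_def by metis
    then show "\<rho> \<gamma> = meet \<kappa> \<eta> \<nu> \<gamma>"
      using g r(2) by (simp add: meet_def map_le_def)
  qed
qed

definition lex_le :: "'k rel \<Rightarrow> 'k node \<Rightarrow> 'k node \<Rightarrow> bool" where
  "lex_le \<kappa> \<eta> \<nu> \<longleftrightarrow> \<eta> \<subseteq>\<^sub>m \<nu> \<or>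
     perp \<eta> \<nu> \<and>
       (\<exists>l\<in>Field \<kappa>. dom (meet \<kappa> \<eta> \<nu>) = underS \<kappa> l \<and> the (\<eta> l) < the (\<nu> l))"

text \<open>Concatenation: if \<open>\<nu>\<close> has length \<open>\<alpha>\<close>, then an ordinal \<open>\<gamma> \<ge> \<alpha>\<close> is \<open>\<alpha> + \<delta>\<close> for exactly one
  \<open>\<delta>\<close>, namely the order type of \<open>\<gamma> - \<alpha>\<close>.\<close>

definition shift :: "'k rel \<Rightarrow> 'k node \<Rightarrow> 'k \<Rightarrow> 'k" where
  "shift \<kappa> \<nu> \<gamma> = (THE \<delta>. \<delta> \<in> Field \<kappa> \<and>
     (Restr \<kappa> (underS \<kappa> \<delta>), Restr \<kappa> (underS \<kappa> \<gamma> - dom \<nu>)) \<in> ordIso)"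

definition conc :: "'k rel \<Rightarrow> 'k node \<Rightarrow> 'k node \<Rightarrow> 'k node" where
  "conc \<kappa> \<nu> \<eta> = (\<lambda>\<gamma>. if \<gamma> \<in> dom \<nu> then \<nu> \<gamma>
                     else if \<gamma> \<in> Field \<kappa> then \<eta> (shift \<kappa> \<nu> \<gamma>) else None)"

datatype L0_fun = Meet
datatype L0_rel = Init | Lex

definition L0 :: "(L0_fun, L0_rel) lang" where
  "L0 = \<lparr>farity = (\<lambda>_. Some 2), parity = (\<lambda>_. Some 2)\<rparr>"

definition tree_struct :: "'k rel \<Rightarrow> (L0_fun, L0_rel, 'k node) struct" where
  "tree_struct \<kappa> = \<lparr>carrier = tree \<kappa>,
     fint = (\<lambda>_ xs. meet \<kappa> (xs ! 0) (xs ! 1)),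
     pint = (\<lambda>p xs. case p of Init \<Rightarrow> xs ! 0 \<subseteq>\<^sub>m xs ! 1 | Lex \<Rightarrow> lex_le \<kappa> (xs ! 0) (xs ! 1))\<rparr>"

definition sim0 :: "'k rel \<Rightarrow> 'i set \<Rightarrow> ('i \<Rightarrow> 'k node) \<Rightarrow> ('i \<Rightarrow> 'k node) \<Rightarrow> bool" where
  "sim0 \<kappa> I \<eta> \<nu> \<longleftrightarrow> qftp L0 (tree_struct \<kappa>) I \<eta> = qftp L0 (tree_struct \<kappa>) I \<nu>"

definition antichain :: "'k rel \<Rightarrow> 'k node set \<Rightarrow> bool" where
  "antichain \<kappa> X \<longleftrightarrow> X \<subseteq> tree \<kappa> \<and> (\<forall>\<eta>\<in>X. \<forall>\<nu>\<in>X. \<eta> \<noteq> \<nu> \<longrightarrow> perp \<eta> \<nu>)"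

definition universal_antichain :: "'k rel \<Rightarrow> 'k node set \<Rightarrow> bool" where
  "universal_antichain \<kappa> X \<longleftrightarrow> antichain \<kappa> X \<and>
     (\<forall>Y. antichain \<kappa> Y \<and> finite Y \<longrightarrow>
        (\<exists>X\<^sub>0\<subseteq>X. \<exists>f. bij_betw f Y X\<^sub>0 \<and> sim0 \<kappa> Y id f))"

datatype Ldelta_rel = Delta | LexD

definition Ldelta :: "(unit, Ldelta_rel) lang" where
  "Ldelta = \<lparr>farity = (\<lambda>_. None), parity = (\<lambda>p. case p of Delta \<Rightarrow> Some 4 | LexD \<Rightarrow> Some 2)\<rparr>"

text \<open>The language has no function symbols, so \<open>fint\<close> is irrelevant.\<close>

definition antichain_struct :: "'k rel \<Rightarrow> 'k node set \<Rightarrow> (unit, Ldelta_rel, 'k node) struct" where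
  "antichain_struct \<kappa> X = \<lparr>carrier = X,
     fint = (\<lambda>_ xs. xs ! 0),
     pint = (\<lambda>p xs. case p of
         Delta \<Rightarrow> meet \<kappa> (xs ! 0) (xs ! 1) \<subseteq>\<^sub>m meet \<kappa> (xs ! 2) (xs ! 3)
       | LexD \<Rightarrow> lex_le \<kappa> (xs ! 0) (xs ! 1))\<rparr>"

definition sim_delta ::
  "'k rel \<Rightarrow> 'k node set \<Rightarrow> 'i set \<Rightarrow> ('i \<Rightarrow> 'k node) \<Rightarrow> ('i \<Rightarrow> 'k node) \<Rightarrow> bool" where
  "sim_delta \<kappa> X I \<eta> \<nu> \<longleftrightarrow>
     qftp Ldelta (antichain_struct \<kappa> X) I \<eta> = qftp Ldelta (antichain_struct \<kappa> X) I \<nu>"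


section \<open>Indiscernibility\<close>

text \<open>The members of a family \<open>a\<close> are \<open>m\<close>-tuples: \<open>a \<eta> k\<close>, \<open>k < m\<close>, is the \<open>k\<close>-th
  coordinate of \<open>a\<^sub>\<eta>\<close>.\<close>

definition strongly_indiscernible ::
  "('f, 'p) lang \<Rightarrow> ('f, 'p, 'm) struct \<Rightarrow> 'k rel \<Rightarrow> nat \<Rightarrow> ('k node \<Rightarrow> nat \<Rightarrow> 'm) \<Rightarrow> 'm set \<Rightarrow>
   bool" where
  "strongly_indiscernible L M \<kappa> m a C \<longleftrightarrow>
     (\<forall>(n::nat) \<eta> \<nu>. \<eta> ` {..<n} \<subseteq> tree \<kappa> \<and> \<nu> ` {..<n} \<subseteq> tree \<kappa> \<and> sim0 \<kappa> {..<n} \<eta> \<nu> \<longrightarrow>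
        tp L M ({..<n} \<times> {..<m}) (\<lambda>(i, k). a (\<eta> i) k) C =
        tp L M ({..<n} \<times> {..<m}) (\<lambda>(i, k). a (\<nu> i) k) C)"

definition delta_indiscernible ::
  "('f, 'p) lang \<Rightarrow> ('f, 'p, 'm) struct \<Rightarrow> 'k rel \<Rightarrow> 'k node set \<Rightarrow> nat \<Rightarrow>
   ('k node \<Rightarrow> nat \<Rightarrow> 'm) \<Rightarrow> 'm set \<Rightarrow> bool" where
  "delta_indiscernible L M \<kappa> X m a B \<longleftrightarrow>
     (\<forall>(n::nat) \<eta> \<nu>. \<eta> ` {..<n} \<subseteq> X \<and> \<nu> ` {..<n} \<subseteq> X \<and> sim_delta \<kappa> X {..<n} \<eta> \<nu> \<longrightarrow>
        tp L M ({..<n} \<times> {..<m}) (\<lambda>(i, k). a (\<eta> i) k) B =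
        tp L M ({..<n} \<times> {..<m}) (\<lambda>(i, k). a (\<nu> i) k) B)"


section \<open>The antichain tree property\<close>

text \<open>The finite binary sequences are \<open>bool list\<close> with \<open>prefix\<close>. The object variable \<open>y\<close> is a single
  variable and \<open>z\<close> consists of the other free variables of \<open>\<phi>\<close>; accordingly \<open>c \<eta> v\<close> is the
  coordinate of \<open>c\<^sub>\<eta>\<close> substituted for the variable \<open>v\<close>.\<close>

definition plug :: "('f, 'p) fm \<Rightarrow> nat \<Rightarrow> (nat \<Rightarrow> 'm) \<Rightarrow> ('f, 'p, unit, 'm) pfm" where
  "plug \<phi> y d = (\<phi>, \<lambda>v. if v = y then Inl () else Inr (d v))"

definition witnesses_ATP ::
  "('f, 'p) lang \<Rightarrow> ('f, 'p, 'm) struct \<Rightarrow> ('f, 'p) fm \<Rightarrow> nat \<Rightarrow> bool" where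
  "witnesses_ATP L M \<phi> y \<longleftrightarrow> wf_fm L \<phi> \<and>
     (\<exists>c :: bool list \<Rightarrow> nat \<Rightarrow> 'm.
        (\<forall>\<eta>. \<forall>v\<in>FV \<phi> - {y}. c \<eta> v \<in> carrier M) \<and>
        (\<forall>X. (\<forall>\<eta>\<in>X. \<forall>\<nu>\<in>X. \<eta> \<noteq> \<nu> \<longrightarrow> \<not> prefix \<eta> \<nu>) \<longrightarrow>
           consistent M ((\<lambda>\<eta>. plug \<phi> y (c \<eta>)) ` X)) \<and>
        (\<forall>\<eta> \<nu>. prefix \<eta> \<nu> \<and> \<eta> \<noteq> \<nu> \<longrightarrow>
           \<not> consistent M {plug \<phi> y (c \<eta>), plug \<phi> y (c \<nu>)}))"


section \<open>Collapsible families\<close>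

text \<open>The type \<open>p(y, z)\<close> of \<open>b\<close> together with \<open>(a\<^sub>\<eta>)\<close>, \<open>\<eta>\<close> ranging over the antichain
  enumerated by \<open>e :: 'j \<Rightarrow> 'k node\<close> on \<open>J\<close>. The variable \<open>y\<close> is \<open>None\<close>, and \<open>Some (x, k)\<close> is the
  variable for the \<open>k\<close>-th coordinate of \<open>a\<close> at the node \<open>e x\<close>.\<close>

definition joint_type ::
  "('f, 'p) lang \<Rightarrow> ('f, 'p, 'm) struct \<Rightarrow> nat \<Rightarrow> ('k node \<Rightarrow> nat \<Rightarrow> 'm) \<Rightarrow> 'm set \<Rightarrow>
   'j set \<Rightarrow> ('j \<Rightarrow> 'k node) \<Rightarrow> 'm \<Rightarrow> ('f, 'p, ('j \<times> nat) option, 'm) pfm set" where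
  "joint_type L M m a C J e b =
     tp L M (insert None (Some ` (J \<times> {..<m}))) (case_option b (\<lambda>(x, k). a (e x) k)) C"

text \<open>Substitution of parameters \<open>d\<close> for \<open>z\<close> in \<open>p(y, z)\<close>.\<close>

definition subst_z ::
  "('z \<Rightarrow> 'm) \<Rightarrow> ('f, 'p, 'z option, 'm) pfm \<Rightarrow> ('f, 'p, unit, 'm) pfm" where
  "subst_z d = (\<lambda>(\<phi>, \<sigma>). (\<phi>, \<lambda>v. case \<sigma> v of
      Inl None \<Rightarrow> Inl () | Inl (Some z) \<Rightarrow> Inr (d z) | Inr c \<Rightarrow> Inr c))"

text \<open>The family consists of the antichains \<open>X i ` J\<close>, \<open>i \<in> A\<close>, each given with an injective
  enumeration \<open>X i\<close> by the common index set \<open>J\<close>; these are the fixed corresponding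
  enumerations, and their existence includes that the antichains have the same cardinality.
  As usual in a monster model, the parameter set \<open>C\<close> is small.\<close>

definition collapsible ::
  "('f, 'p) lang \<Rightarrow> ('f, 'p, 'm) struct \<Rightarrow> 'l rel \<Rightarrow> 'k rel \<Rightarrow> 'i set \<Rightarrow> 'j set \<Rightarrow>
   ('i \<Rightarrow> 'j \<Rightarrow> 'k node) \<Rightarrow> bool" where
  "collapsible L M lam \<kappa> A J X \<longleftrightarrow>
     finite A \<and> A \<noteq> {} \<and>
     (\<forall>i\<in>A. inj_on (X i) J \<and> universal_antichain \<kappa> (X i ` J)) \<and>
     (\<forall>i\<in>A. \<forall>j\<in>A. sim0 \<kappa> J (X i) (X j)) \<and>
     (\<forall>C b m a.
        C \<subseteq> carrier M \<and> |C| <o lam \<and> b \<in> carrier M \<and>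
        (\<forall>\<eta>\<in>tree \<kappa>. \<forall>k<m. a \<eta> k \<in> carrier M) \<and>
        strongly_indiscernible L M \<kappa> m a C \<longrightarrow>
        (\<forall>i\<in>A. delta_indiscernible L M \<kappa> (X i ` J) m a (insert b C) \<longrightarrow>
           consistent M
             (\<Union>j\<in>A. subst_z (\<lambda>(x, k). a (X j x) k) ` joint_type L M m a C J (X i) b) \<or>
           (\<exists>\<phi> y. witnesses_ATP L M \<phi> y)))"

end

theory Submission
  imports Defs "HOL-Library.Ramsey"
begin

text \<open>
  Types are compared through partial elementary relations: two tuples have the same type over \<open>B\<close>
  iff the relation pairing their entries and fixing \<open>B\<close> pointwise preserves all formulas, and such
  relations compose. On tuples of nodes, \<open>\<sim>\<^sub>0\<close> and \<open>\<sim>\<^sub>\<delta>\<close> both amount to agreement of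
  \<open>\<eta>\<^sub>0 \<and> \<eta>\<^sub>1 \<unlhd> \<eta>\<^sub>2\<close> and \<open>\<eta>\<^sub>0 <\<^sub>l\<^sub>e\<^sub>x \<eta>\<^sub>1\<close>; as \<open>\<nu> \<bottom> \<xi>\<close>, a similarity above \<open>\<nu>\<close> and one above \<open>\<xi>\<close>
  together form a similarity.

  Let \<open>(a\<^sub>\<eta>)\<close> be \<open>\<delta>\<close>-indiscernible over \<open>bC\<close> on \<open>X\<^sub>i\<^sup>\<nu> \<union> X\<^sub>j\<^sup>\<xi>\<close>, and suppose that no formula witnesses ATP.
  Collapsing the \<open>X\<^sub>k\<close> above \<open>\<nu>\<close>, with the \<open>a\<^sub>\<eta>\<close>, \<open>\<eta> \<in> X\<^sub>j\<^sup>\<xi>\<close>, among the parameters, gives one \<open>b'\<close> that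
  has the type of \<open>b\<close> on every \<open>X\<^sub>k\<^sup>\<nu> \<union> X\<^sub>j\<^sup>\<xi>\<close>. In order to collapse above \<open>\<xi>\<close> as well, \<open>b'\<close> is replaced by
  a realisation over which \<open>X\<^sub>j\<^sup>\<xi>\<close> is \<open>\<delta>\<close>-indiscernible together with all \<open>X\<^sub>k\<^sup>\<nu>\<close>. It exists by
  compactness and a Ramsey theorem for finite antichains: a universal antichain contains a copy of
  every finite antichain on which a given finite colouring is determined by the \<open>\<delta>\<close>-type, and an
  automorphism moves this copy to the original.
\<close>

section \<open>Partial elementary relations\<close>

text \<open>Collapsing above \<nu> gives \<open>b'\<close> the type of \<open>b\<close> over each
  \<open>X k\<close> above \<nu> separately, together with \<open>X j\<close> above \<xi>. The
  second collapse needs all the \<open>X k\<close> above \<nu> as parameters at once, since a single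
  realisation has to serve every pair \<open>(k, l)\<close>; and nothing makes \<open>X j\<close>
  above \<xi> indiscernible over \<open>b'\<close> and this larger set. The replacement of
  \<open>b'\<close> must keep the types already obtained. It does, because each of them involves one
  \<open>X k\<close> and corresponds to the type of \<open>b\<close> over the original
  \<open>X i\<close>; over \<open>b\<close> and \<open>X i\<close> the antichain above \<xi> is
  indiscernible, so that passing to a copy inside it changes nothing. The Ramsey theorem has to
  control two things in a finite family of branches: the entries, and the levels at which neighbours
  split. Making the entries homogeneous leaves a colour that depends on the levels; making the
  levels homogeneous leaves one that depends on their relative order. The \<delta>-type determines
  this order, as the levels follow the lexicographic order of the meets.\<close>

definition elem :: "('f, 'p) lang \<Rightarrow> ('f, 'p, 'm) struct \<Rightarrow> ('m \<times> 'm) set \<Rightarrow> bool" where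
  "elem L M R \<longleftrightarrow> (\<forall>\<phi> e e'. wf_fm L \<phi> \<longrightarrow> (\<forall>v\<in>FV \<phi>. (e v, e' v) \<in> R) \<longrightarrow>
     sat M e \<phi> \<longrightarrow> sat M e' \<phi>)"

text \<open>Similarities live on nodes, elementary relations on elements. The passage from the
  former to the latter is made without enumerating the nodes, so infinite sets of nodes cause no
  difficulty.\<close>

definition pull :: "nat \<Rightarrow> ('u \<Rightarrow> nat \<Rightarrow> 'm) \<Rightarrow> ('u \<times> 'u) set \<Rightarrow> ('m \<times> 'm) set" where
  "pull m a S = {(a u q, a u' q) | u u' q. (u, u') \<in> S \<and> q < m}"

lemma pull_Un: "pull m a (S \<union> S') = pull m a S \<union> pull m a S'"
  unfolding pull_def by blast

lemma pull_mono: "S \<subseteq> S' \<Longrightarrow> pull m a S \<subseteq> pull m a S'"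
  unfolding pull_def by blast

lemma finite_vars_tm: "finite (vars_tm t)"
  by (induction t) auto

lemma finite_FV: "finite (FV \<phi>)"
  by (induction \<phi>) (auto simp: finite_vars_tm)

lemma val_cong:
  assumes "\<And>v. v \<in> vars_tm t \<Longrightarrow> e v = e' v"
  shows "val M e t = val M e' t"
  using assms
proof (induction t)
  case (Fn f ts)
  then have "map (val M e) ts = map (val M e') ts" by auto
  then show ?case by (metis val.simps(2))
qed auto

lemma sat_cong:
  assumes "\<And>v. v \<in> FV \<phi> \<Longrightarrow> e v = e' v"
  shows "sat M e \<phi> \<longleftrightarrow> sat M e' \<phi>"
  using assms
proof (induction \<phi> arbitrary: e e')
  case (Eq s t)
  then show ?case using val_cong[of s e e' M] val_cong[of t e e' M] by auto
next
  case (Rel p ts)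
  then have "map (val M e) ts = map (val M e') ts" by (auto intro!: val_cong)
  then show ?case by (metis sat.simps(2))
next
  case (Conj \<phi> \<psi>)
  then show ?case by (metis FV.simps(4) UnCI sat.simps(4))
next
  case (Ex v \<phi>)
  have "sat M (e(v := a)) \<phi> \<longleftrightarrow> sat M (e'(v := a)) \<phi>" for a
    by (rule Ex.IH) (use Ex.prems in auto)
  then show ?case by simp
next
  case (Neg \<phi>)
  have "sat M e \<phi> \<longleftrightarrow> sat M e' \<phi>" by (rule Neg.IH) (use Neg.prems in auto)
  then show ?case by simp
qed

text \<open>The one-sided definition of \<open>elem\<close> gives both directions because it also
  applies to \<open>Neg \<phi>\<close>.\<close>

lemma elem_sat_iff:
  assumes "elem L M R" "wf_fm L \<phi>" "\<And>v. v \<in> FV \<phi> \<Longrightarrow> (e v, e' v) \<in> R"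
  shows "sat M e \<phi> \<longleftrightarrow> sat M e' \<phi>"
  using assms(1)[unfolded elem_def, rule_format, of \<phi> e e']
    assms(1)[unfolded elem_def, rule_format, of "Neg \<phi>" e e'] assms(2,3) by auto

lemma elem_mono: "elem L M R \<Longrightarrow> R' \<subseteq> R \<Longrightarrow> elem L M R'"
  unfolding elem_def by blast

lemma elem_relcomp:
  assumes "elem L M R" "elem L M R'"
  shows "elem L M (R O R')"
  unfolding elem_def
proof (intro allI impI)
  fix \<phi> e e' assume w: "wf_fm L \<phi>" and "\<forall>v\<in>FV \<phi>. (e v, e' v) \<in> R O R'" and s: "sat M e \<phi>"
  then have "\<forall>v\<in>FV \<phi>. \<exists>x. (e v, x) \<in> R \<and> (x, e' v) \<in> R'" by blast
  then obtain e0 where e0: "\<forall>v\<in>FV \<phi>. (e v, e0 v) \<in> R \<and> (e0 v, e' v) \<in> R'" by metis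
  show "sat M e' \<phi>"
    using elem_sat_iff[OF assms(1) w, of e e0] elem_sat_iff[OF assms(2) w, of e0 e'] e0 s by blast
qed

lemma elem_converse: "elem L M R \<Longrightarrow> elem L M (R\<inverse>)"
  unfolding elem_def
  by (metis (no_types, lifting) FV.simps(3) converse_iff sat.simps(3) wf_fm.simps(3))

text \<open>Equality atoms are among the formulas preserved. So an elementary relation is the graph
  of a function, and by \<open>elem_converse\<close> of an injective one.\<close>

lemma elem_single_valued:
  assumes "elem L M R" "(s, t) \<in> R" "(s, t') \<in> R"
  shows "t = t'"
  using elem_sat_iff[OF assms(1), of "Eq (Var 0) (Var 1)" "\<lambda>_. s" "\<lambda>v. if v = 0 then t else t'"]
    assms(2,3) by (auto split: if_splits)

text \<open>A formula has finitely many free variables, and each uses at most one pair of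
  \<open>S\<close>. This carries indiscernibility, which is defined with finite tuples, over to
  arbitrary relations.\<close>

lemma elem_pull_finitary:
  assumes "\<And>S0. finite S0 \<Longrightarrow> S0 \<subseteq> S \<Longrightarrow> elem L M (pull m a S0 \<union> Q)"
  shows "elem L M (pull m a S \<union> Q)"
  unfolding elem_def
proof (intro allI impI)
  fix \<phi> e e' assume w: "wf_fm L \<phi>" and e: "\<forall>v\<in>FV \<phi>. (e v, e' v) \<in> pull m a S \<union> Q" and s: "sat M e \<phi>"
  have "\<exists>S0. finite S0 \<and> S0 \<subseteq> S \<and> (e v, e' v) \<in> pull m a S0 \<union> Q" if v: "v \<in> FV \<phi>" for v
  proof (cases "(e v, e' v) \<in> Q")
    case False
    then obtain u u' q where "(u, u') \<in> S" "q < m" "e v = a u q" "e' v = a u' q"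
      using e v unfolding pull_def by blast
    then have "finite {(u, u')}" "{(u, u')} \<subseteq> S" "(e v, e' v) \<in> pull m a {(u, u')}"
      unfolding pull_def by auto
    then show ?thesis by blast
  qed blast
  then obtain F where F: "\<And>v. v \<in> FV \<phi> \<Longrightarrow> finite (F v) \<and> F v \<subseteq> S \<and> (e v, e' v) \<in> pull m a (F v) \<union> Q"
    by metis
  have "elem L M (pull m a (\<Union>v\<in>FV \<phi>. F v) \<union> Q)"
    using F finite_FV by (intro assms) blast+
  moreover have "\<forall>v\<in>FV \<phi>. (e v, e' v) \<in> pull m a (\<Union>v\<in>FV \<phi>. F v) \<union> Q"
  proof
    fix v assume v: "v \<in> FV \<phi>"
    have "pull m a (F v) \<subseteq> pull m a (\<Union>v\<in>FV \<phi>. F v)" using v by (intro pull_mono) blast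
    then show "(e v, e' v) \<in> pull m a (\<Union>v\<in>FV \<phi>. F v) \<union> Q" using F[OF v] by blast
  qed
  ultimately show "sat M e' \<phi>" using w s unfolding elem_def by blast
qed

text \<open>Only the pairs of values matter: from two assignments inside the relation a suitable
  \<open>\<sigma>\<close> is recovered by choosing an index or a parameter for each free
  variable.\<close>

lemma tp_eq_iff_elem:
  "tp L M I x B = tp L M I x' B \<longleftrightarrow> elem L M ({(x i, x' i) | i. i \<in> I} \<union> Id_on B)"
proof
  assume eq: "tp L M I x B = tp L M I x' B"
  show "elem L M ({(x i, x' i) | i. i \<in> I} \<union> Id_on B)"
    unfolding elem_def
  proof (intro allI impI)
    fix \<phi> e e' assume w: "wf_fm L \<phi>"
      and e: "\<forall>v\<in>FV \<phi>. (e v, e' v) \<in> {(x i, x' i) | i. i \<in> I} \<union> Id_on B" and s: "sat M e \<phi>"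
    have "\<forall>v\<in>FV \<phi>. \<exists>z \<in> I <+> B. e v = case_sum x id z \<and> e' v = case_sum x' id z"
    proof
      fix v assume "v \<in> FV \<phi>"
      then consider i where "i \<in> I" "e v = x i" "e' v = x' i" | "e v \<in> B" "e' v = e v"
        using e by auto
      then show "\<exists>z \<in> I <+> B. e v = case_sum x id z \<and> e' v = case_sum x' id z"
      proof cases
        case 1
        then show ?thesis by (intro bexI[of _ "Inl i"]) auto
      next
        case 2
        then show ?thesis by (intro bexI[of _ "Inr (e v)"]) auto
      qed
    qed
    then obtain \<sigma> where \<sigma>: "\<forall>v\<in>FV \<phi>. \<sigma> v \<in> I <+> B \<and> e v = case_sum x id (\<sigma> v) \<and>
      e' v = case_sum x' id (\<sigma> v)"
      by metis
    have "(\<phi>, \<sigma>) \<in> pfms L I B" using w \<sigma> unfolding pfms_def by auto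
    moreover have "holds M x (\<phi>, \<sigma>)"
      using s sat_cong[of \<phi> e "\<lambda>v. case_sum x id (\<sigma> v)"] \<sigma> unfolding holds_def by auto
    ultimately have "(\<phi>, \<sigma>) \<in> tp L M I x' B" using eq unfolding tp_def by blast
    then show "sat M e' \<phi>"
      using sat_cong[of \<phi> e' "\<lambda>v. case_sum x' id (\<sigma> v)"] \<sigma> unfolding holds_def tp_def by auto
  qed
next
  assume el: "elem L M ({(x i, x' i) | i. i \<in> I} \<union> Id_on B)"
  have "holds M x g \<longleftrightarrow> holds M x' g" if "g \<in> pfms L I B" for g
  proof -
    obtain \<phi> \<sigma> where g: "g = (\<phi>, \<sigma>)" by fastforce
    have w: "wf_fm L \<phi>" and \<sigma>: "\<sigma> ` FV \<phi> \<subseteq> I <+> B" using that g unfolding pfms_def by auto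
    have "(case_sum x id (\<sigma> v), case_sum x' id (\<sigma> v)) \<in> {(x i, x' i) | i. i \<in> I} \<union> Id_on B"
      if "v \<in> FV \<phi>" for v
    proof -
      have "\<sigma> v \<in> I <+> B" using \<sigma> that by blast
      then show ?thesis by (cases "\<sigma> v") auto
    qed
    then show ?thesis using elem_sat_iff[OF el w] unfolding g holds_def by simp
  qed
  then show "tp L M I x B = tp L M I x' B" unfolding tp_def by blast
qed

lemma tuple_tp_eq_iff_elem:
  fixes a :: "'u \<Rightarrow> nat \<Rightarrow> 'm"
  shows "tp L M ({..<n} \<times> {..<m}) (\<lambda>(i, k). a (\<eta> i) k) B = tp L M ({..<n} \<times> {..<m})
    (\<lambda>(i, k). a (\<nu> i) k) B
    \<longleftrightarrow> elem L M (pull m a {(\<eta> i, \<nu> i) | i. i < n} \<union> Id_on B)"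
proof -
  have "{((\<lambda>(i, k). a (\<eta> i) k) z, (\<lambda>(i, k). a (\<nu> i) k) z) | z. z \<in> {..<n} \<times> {..<m}}
      = pull m a {(\<eta> i, \<nu> i) | i. i < n}" unfolding pull_def by auto
  then show ?thesis unfolding tp_eq_iff_elem by simp
qed

lemma elem_automorphism:
  assumes M: "is_struct L M" and h: "automorphism L M h"
  shows "elem L M {(s, h s) | s. s \<in> carrier M}"
proof -
  have bij: "bij_betw h (carrier M) (carrier M)" using h unfolding automorphism_def by blast
  have val: "val M e t \<in> carrier M \<and> val M e' t = h (val M e t)"
    if "wf_tm L t" "\<forall>v\<in>vars_tm t. e v \<in> carrier M \<and> e' v = h (e v)" for e e' t
    using that
  proof (induction t)
    case (Fn f ts)
    then have *: "\<forall>t\<in>set ts. val M e t \<in> carrier M \<and> val M e' t = h (val M e t)" by auto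
    have ar: "farity L f = Some (length (map (val M e) ts))" using Fn by simp
    have sub: "set (map (val M e) ts) \<subseteq> carrier M" using * by auto
    have "map (val M e') ts = map h (map (val M e) ts)" using * by auto
    moreover have "fint M f (map (val M e) ts) \<in> carrier M"
      using M ar sub unfolding is_struct_def by blast
    moreover have "h (fint M f (map (val M e) ts)) = fint M f (map h (map (val M e) ts))"
      using h ar sub unfolding automorphism_def by blast
    ultimately show ?case by (metis val.simps(2))
  qed auto
  have "sat M e \<phi> \<longleftrightarrow> sat M e' \<phi>"
    if "wf_fm L \<phi>" "\<forall>v\<in>FV \<phi>. e v \<in> carrier M \<and> e' v = h (e v)" for \<phi> e e'
    using that
  proof (induction \<phi> arbitrary: e e')
    case (Eq s t)
    then have "val M e s \<in> carrier M \<and> val M e' s = h (val M e s)"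
      "val M e t \<in> carrier M \<and> val M e' t = h (val M e t)" by (auto intro!: val)
    then show ?case using bij by (auto simp: bij_betw_def inj_on_def)
  next
    case (Rel p ts)
    then have *: "\<forall>t\<in>set ts. val M e t \<in> carrier M \<and> val M e' t = h (val M e t)"
      by (auto intro!: val)
    have "parity L p = Some (length (map (val M e) ts))" using Rel by simp
    moreover have "set (map (val M e) ts) \<subseteq> carrier M" using * by auto
    moreover have "map (val M e') ts = map h (map (val M e) ts)" using * by auto
    ultimately show ?case using h unfolding automorphism_def by (metis sat.simps(2))
  next
    case (Conj \<phi> \<psi>)
    then show ?case by (metis FV.simps(4) UnCI sat.simps(4) wf_fm.simps(4))
  next
    case (Ex v \<phi>)
    have *: "sat M (e(v := s)) \<phi> \<longleftrightarrow> sat M (e'(v := h s)) \<phi>" if "s \<in> carrier M" for s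
      using Ex.prems that by (intro Ex.IH) auto
    have "(\<exists>s\<in>carrier M. sat M (e'(v := h s)) \<phi>) \<longleftrightarrow> (\<exists>s\<in>carrier M. sat M (e'(v := s)) \<phi>)"
      using bij unfolding bij_betw_def by (metis image_iff)
    then show ?case using * by auto
  qed auto
  then show ?thesis unfolding elem_def by blast
qed

text \<open>Being single-valued, the relation is a map to which strong homogeneity applies. The
  converse relation enters because \<open>strongly_homogeneous\<close> compares the image tuple with
  the identity tuple, in this order.\<close>

lemma elem_extends_to_automorphism:
  assumes hom: "strongly_homogeneous L lam M" and R: "elem L M R" "R \<subseteq> carrier M \<times> carrier M"
    and small: "|Domain R| <o lam"
  obtains h where "automorphism L M h" "\<And>s t. (s, t) \<in> R \<Longrightarrow> h s = t"
proof -
  define f where "f s = (SOME t. (s, t) \<in> R)" for s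
  have f: "(s, f s) \<in> R" if "s \<in> Domain R" for s using that unfolding f_def by (meson DomainE someI)
  have uniq: "f s = t" if "(s, t) \<in> R" for s t using elem_single_valued[OF R(1)] f that by blast
  have "elem L M (R\<inverse>)" using elem_converse R(1) by blast
  then have "elem L M ({(f i, id i) | i. i \<in> Domain R} \<union> Id_on {})"
    by (rule elem_mono) (use f in auto)
  then have "tp L M (Domain R) f {} = tp L M (Domain R) id {}" unfolding tp_eq_iff_elem .
  moreover have "Domain R \<subseteq> carrier M" "f ` Domain R \<subseteq> carrier M" using R(2) f by auto
  ultimately have "\<exists>h. automorphism L M h \<and> (\<forall>s\<in>Domain R. h s = f s)"
    by (intro hom[unfolded strongly_homogeneous_def, rule_format] conjI small)
  then obtain h where "automorphism L M h" "\<forall>s\<in>Domain R. h s = f s" by blast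
  then show ?thesis using that uniq by blast
qed

section \<open>Renaming variables\<close>

primrec rename_tm :: "(nat \<Rightarrow> nat) \<Rightarrow> 'f tm \<Rightarrow> 'f tm" where
  "rename_tm r (Var v) = Var (r v)"
| "rename_tm r (Fn f ts) = Fn f (map (rename_tm r) ts)"

text \<open>Bound variables are renamed as well, so an injective \<open>r\<close> causes no
  capture.\<close>

primrec rename :: "(nat \<Rightarrow> nat) \<Rightarrow> ('f, 'p) fm \<Rightarrow> ('f, 'p) fm" where
  "rename r (Eq s t) = Eq (rename_tm r s) (rename_tm r t)"
| "rename r (Rel p ts) = Rel p (map (rename_tm r) ts)"
| "rename r (Neg \<phi>) = Neg (rename r \<phi>)"
| "rename r (Conj \<phi> \<psi>) = Conj (rename r \<phi>) (rename r \<psi>)"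
| "rename r (Ex v \<phi>) = Ex (r v) (rename r \<phi>)"

lemma wf_rename_tm: "wf_tm L (rename_tm r t) = wf_tm L t"
  by (induction t) auto

lemma wf_rename: "wf_fm L (rename r \<phi>) = wf_fm L \<phi>"
  by (induction \<phi>) (auto simp: wf_rename_tm)

lemma vars_rename_tm: "vars_tm (rename_tm r t) = r ` vars_tm t"
  by (induction t) auto

lemma FV_rename: "inj r \<Longrightarrow> FV (rename r \<phi>) = r ` FV \<phi>"
  by (induction \<phi>) (auto simp: vars_rename_tm image_Un image_UN inj_def)

lemma val_rename: "val M e (rename_tm r t) = val M (\<lambda>v. e (r v)) t"
proof (induction t)
  case (Fn f ts)
  then have "map (\<lambda>t. val M e (rename_tm r t)) ts = map (val M (\<lambda>v. e (r v))) ts" by simp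
  then show ?case by (simp add: o_def del: map_eq_conv)
qed simp

lemma sat_rename:
  assumes "inj r"
  shows "sat M e (rename r \<phi>) = sat M (\<lambda>v. e (r v)) \<phi>"
proof (induction \<phi> arbitrary: e)
  case (Rel p ts)
  have "map (\<lambda>t. val M e (rename_tm r t)) ts = map (val M (\<lambda>v. e (r v))) ts"
    by (simp add: val_rename)
  then show ?case by (simp add: o_def del: map_eq_conv)
next
  case (Ex v \<phi>)
  have "(\<lambda>w. (e(r v := s)) (r w)) = (\<lambda>w. e (r w))(v := s)" for s using assms by (auto simp: inj_def)
  then show ?case using Ex by simp
qed (auto simp: val_rename)

text \<open>The two formulas are renamed apart, so that each keeps its own assignment of parameters.\<close>

definition pfm_iff :: "('f, 'p, 'i, 'm) pfm \<Rightarrow> ('f, 'p, 'i, 'm) pfm \<Rightarrow> ('f, 'p, 'i, 'm) pfm" where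
  "pfm_iff g g' = (case (g, g') of ((\<phi>, \<sigma>), (\<psi>, \<tau>)) \<Rightarrow>
     let \<phi>' = rename (\<lambda>v. 2 * v) \<phi>; \<psi>' = rename (\<lambda>v. 2 * v + 1) \<psi> in
     (Conj (Neg (Conj \<phi>' (Neg \<psi>'))) (Neg (Conj \<psi>' (Neg \<phi>'))),
      \<lambda>v. if even v then \<sigma> (v div 2) else \<tau> (v div 2)))"

lemma inj_even_odd: "inj (\<lambda>v::nat. 2 * v)" "inj (\<lambda>v::nat. 2 * v + 1)"
  by (auto simp: inj_def)

lemma holds_pfm_iff: "holds M x (pfm_iff g g') \<longleftrightarrow> (holds M x g \<longleftrightarrow> holds M x g')"
proof -
  obtain \<phi> \<sigma> \<psi> \<tau> where g: "g = (\<phi>, \<sigma>)" "g' = (\<psi>, \<tau>)" by fastforce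
  show ?thesis
    unfolding g pfm_iff_def holds_def
    by (auto simp: Let_def sat_rename[OF inj_even_odd(1)] sat_rename[OF inj_even_odd(2), simplified]
      o_def)
qed

lemma pfm_iff_pfms:
  assumes "g \<in> pfms L I B" "g' \<in> pfms L I B"
  shows "pfm_iff g g' \<in> pfms L I B"
proof -
  obtain \<phi> \<sigma> \<psi> \<tau> where g: "g = (\<phi>, \<sigma>)" "g' = (\<psi>, \<tau>)" by fastforce
  have FV: "FV (fst (pfm_iff g g')) = (\<lambda>v. 2 * v) ` FV \<phi> \<union> (\<lambda>v. 2 * v + 1) ` FV \<psi>"
    unfolding g pfm_iff_def Let_def
    by (auto simp: FV_rename[OF inj_even_odd(1)] FV_rename[OF inj_even_odd(2), simplified])
  have "snd (pfm_iff g g') v \<in> I <+> B" if "v \<in> FV (fst (pfm_iff g g'))" for v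
    using that assms unfolding FV unfolding g pfm_iff_def Let_def pfms_def by fastforce
  moreover have "wf_fm L (fst (pfm_iff g g'))"
    using assms unfolding g pfm_iff_def Let_def pfms_def by (simp add: wf_rename)
  ultimately show ?thesis unfolding pfms_def by (simp add: case_prod_beta image_subset_iff)
qed

section \<open>Realisations of joint types\<close>

lemma holds_subst_z: "holds M (\<lambda>_. d) (subst_z z g) = holds M (case_option d z) g"
proof -
  obtain \<phi> \<sigma> where g: "g = (\<phi>, \<sigma>)" by fastforce
  have "(\<lambda>v. case_sum (\<lambda>_. d) id (case \<sigma> v of Inl None \<Rightarrow> Inl () | Inl (Some y) \<Rightarrow> Inr (z y)
    | Inr c \<Rightarrow> Inr c))
    = (\<lambda>v. case_sum (case_option d z) id (\<sigma> v))"
    by (auto split: sum.splits option.splits)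
  then show ?thesis unfolding g subst_z_def holds_def by simp
qed

text \<open>Equivalently, \<open>d\<close> realises \<open>\<Union>\<^sub>j p(y, (a\<^sub>\<eta>)\<^sub>\<eta>\<^sub>\<in>\<^sub>X\<^sub>j)\<close> for the type \<open>p\<close> of \<open>b, (a\<^sub>\<eta>)\<^sub>\<eta>\<^sub>\<in>\<^sub>X\<^sub>i\<close> over \<open>C\<close>.\<close>

definition realises ::
  "('f, 'p) lang \<Rightarrow> ('f, 'p, 'm) struct \<Rightarrow> nat \<Rightarrow> ('u \<Rightarrow> nat \<Rightarrow> 'm) \<Rightarrow> 'm set \<Rightarrow>
   'i set \<Rightarrow> 'j set \<Rightarrow> ('i \<Rightarrow> 'j \<Rightarrow> 'u) \<Rightarrow> 'i \<Rightarrow> 'm \<Rightarrow> 'm \<Rightarrow> bool" where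
  "realises L M m a C A J X i b d \<longleftrightarrow>
     (\<forall>j\<in>A. elem L M (insert (b, d) (pull m a {(X i x, X j x) | x. x \<in> J} \<union> Id_on C)))"

lemma joint_rel:
  "{(case_option b (\<lambda>(x, k). a (e x) k) z, case_option d (\<lambda>(x, k). a (e' x) k) z) | z.
      z \<in> insert None (Some ` (J \<times> {..<m}))} \<union> Id_on C
   = insert (b, d) (pull m a {(e x, e' x) | x. x \<in> J} \<union> Id_on C)" (is "?l = ?r")
proof
  have "(a (e x) q, a (e' x) q) \<in> pull m a {(e x, e' x) | x. x \<in> J}" if "x \<in> J" "q < m" for x q
    using that unfolding pull_def by blast
  then show "?l \<subseteq> ?r" by (auto split: option.splits)
  show "?r \<subseteq> ?l"
  proof
    fix z assume "z \<in> ?r"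
    then consider "z = (b, d)" | x q where "x \<in> J" "q < m"
      "z = (a (e x) q, a (e' x) q)" | "z \<in> Id_on C"
      unfolding pull_def by blast
    then show "z \<in> ?l"
    proof cases
      case 1
      then show ?thesis by (auto intro!: exI[of _ None])
    next
      case 2
      then show ?thesis by (auto intro!: exI[of _ "Some (x, q)"])
    qed blast
  qed
qed

text \<open>The left side is one inclusion between two complete types. Closure under negation makes
  it an equality, to which \<open>tp_eq_iff_elem\<close> applies.\<close>

lemma joint_type_realised_iff:
  "(\<forall>g\<in>joint_type L M m a C J e b. holds M (case_option d (\<lambda>(x, k). a (e' x) k)) g) \<longleftrightarrow>
   elem L M (insert (b, d) (pull m a {(e x, e' x) | x. x \<in> J} \<union> Id_on C))" (is "?l \<longleftrightarrow> ?r")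
proof -
  let ?I = "insert None (Some ` (J \<times> {..<m}))"
  let ?x = "case_option b (\<lambda>(x, k). a (e x) k)" and ?x' = "case_option d (\<lambda>(x, k). a (e' x) k)"
  have "tp L M ?I ?x C \<subseteq> tp L M ?I ?x' C \<Longrightarrow> tp L M ?I ?x' C \<subseteq> tp L M ?I ?x C"
  proof
    fix g assume sub: "tp L M ?I ?x C \<subseteq> tp L M ?I ?x' C" and g: "g \<in> tp L M ?I ?x' C"
    obtain \<phi> \<sigma> where g': "g = (\<phi>, \<sigma>)" by fastforce
    show "g \<in> tp L M ?I ?x C"
    proof (rule ccontr)
      assume "g \<notin> tp L M ?I ?x C"
      then have "(Neg \<phi>, \<sigma>) \<in> tp L M ?I ?x C"
        using g unfolding g' tp_def pfms_def holds_def by auto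
      then have "(Neg \<phi>, \<sigma>) \<in> tp L M ?I ?x' C" using sub by blast
      then show False using g unfolding g' tp_def holds_def by auto
    qed
  qed
  then have "?l \<longleftrightarrow> tp L M ?I ?x C = tp L M ?I ?x' C" unfolding joint_type_def tp_def by blast
  then show ?thesis unfolding tp_eq_iff_elem joint_rel .
qed

lemma consistent_if_realised:
  assumes "d \<in> carrier M" "realises L M m a C A J X i b d"
  shows "consistent M (\<Union>j\<in>A. subst_z (\<lambda>(x, k). a (X j x) k) ` joint_type L M m a C J (X i) b)"
proof -
  have "holds M (\<lambda>_. d) (subst_z (\<lambda>(x, k). a (X j x) k) g)"
    if "j \<in> A" "g \<in> joint_type L M m a C J (X i) b" for j g
    using assms(2) that unfolding realises_def holds_subst_z
    by (subst (asm) joint_type_realised_iff[symmetric]) blast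
  then show ?thesis using assms(1) unfolding consistent_def by blast
qed

lemma saturatedD:
  assumes "saturated L lam M" "B \<subseteq> carrier M" "|B| <o lam" "\<Gamma> \<subseteq> pfms L UNIV B" "consistent M \<Gamma>"
  shows "\<exists>d\<in>carrier M. \<forall>g\<in>\<Gamma>. holds M (\<lambda>_. d) g"
  by (intro assms(1)[unfolded saturated_def, rule_format]) (use assms in simp)

lemma pfms_mono:
  assumes "B \<subseteq> B'"
  shows "pfms L I B \<subseteq> pfms L I B'"
proof -
  have "I <+> B \<subseteq> I <+> B'" using assms by auto
  then show ?thesis unfolding pfms_def by auto
qed

lemma subst_z_joint_type_pfms:
  assumes "g \<in> joint_type L M m a C J e b"
  shows "subst_z (\<lambda>(x, k). a (e' x) k) g \<in> pfms L UNIV (C \<union> {a (e' x) q | x q. x \<in> J \<and> q < m})"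
proof -
  obtain \<phi> \<sigma> where g: "g = (\<phi>, \<sigma>)" by fastforce
  have w: "wf_fm L \<phi>" and \<sigma>: "\<sigma> ` FV \<phi> \<subseteq> insert None (Some ` (J \<times> {..<m})) <+> C"
    using assms unfolding g joint_type_def tp_def pfms_def by auto
  have "(case \<sigma> v of Inl None \<Rightarrow> Inl () | Inl (Some y) \<Rightarrow> Inr ((\<lambda>(x, k). a (e' x) k) y)
    | Inr c \<Rightarrow> Inr c)
      \<in> UNIV <+> (C \<union> {a (e' x) q | x q. x \<in> J \<and> q < m})" if "v \<in> FV \<phi>" for v
  proof -
    have "\<sigma> v \<in> insert None (Some ` (J \<times> {..<m})) <+> C" using \<sigma> that by blast
    then show ?thesis by (auto split: sum.splits option.splits) blast
  qed
  then show ?thesis using w unfolding g subst_z_def pfms_def by auto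
qed

text \<open>Saturation upgrades finite satisfiability to a realisation. After substitution the
  parameters are those of \<open>C\<close> and the coordinates of the family on all the antichains,
  hence the bound on this set.\<close>

lemma realised_if_consistent:
  assumes sat: "saturated L lam M"
    and small: "|C \<union> {a (X j x) q | j x q. j \<in> A \<and> x \<in> J \<and> q < m}| <o lam"
    and carr: "C \<union> {a (X j x) q | j x q. j \<in> A \<and> x \<in> J \<and> q < m} \<subseteq> carrier M"
    and cons: "consistent M (\<Union>j\<in>A. subst_z (\<lambda>(x, k). a (X j x) k) ` joint_type L M m a C J (X i) b)"
  obtains d where "d \<in> carrier M" "realises L M m a C A J X i b d"
proof -
  have "subst_z (\<lambda>(x, k). a (X j x) k) g \<in> pfms L UNIV (C \<union> {a (X j x) q | j x q. j \<in> A \<and> x \<in> J \<and>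
    q < m})"
    if "j \<in> A" "g \<in> joint_type L M m a C J (X i) b" for j g
  proof -
    have "C \<union> {a (X j x) q | x q. x \<in> J \<and> q < m} \<subseteq> C \<union> {a (X j x) q | j x q. j \<in> A \<and> x \<in> J \<and> q < m}"
      using that(1) by blast
    from pfms_mono[OF this] show ?thesis
      using subst_z_joint_type_pfms[OF that(2), of "X j"] by (rule subsetD)
  qed
  then have "(\<Union>j\<in>A. subst_z (\<lambda>(x, k). a (X j x) k) ` joint_type L M m a C J (X i) b)
      \<subseteq> pfms L UNIV (C \<union> {a (X j x) q | j x q. j \<in> A \<and> x \<in> J \<and> q < m})" by blast
  from saturatedD[OF sat carr small this cons] obtain d where d: "d \<in> carrier M"
    "\<forall>g\<in>\<Union>j\<in>A. subst_z (\<lambda>(x, k). a (X j x) k) ` joint_type L M m a C J (X i) b. holds M (\<lambda>_. d) g"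
    by blast
  have "realises L M m a C A J X i b d"
    unfolding realises_def joint_type_realised_iff[symmetric]
    using d(2) by (auto simp: holds_subst_z[symmetric])
  then show ?thesis using that d(1) by blast
qed

section \<open>The geometry of the tree\<close>

locale node_tree =
  fixes \<kappa> :: "'k rel"
  assumes wo: "Well_order \<kappa>"
begin

lemma wo_rel: "wo_rel \<kappa>"
  using wo by (simp add: wo_rel_def)

lemmas TOTALS = wo_rel.TOTALS[OF wo_rel] and ANTISYM = wo_rel.ANTISYM[OF wo_rel]
  and TRANS = wo_rel.TRANS[OF wo_rel] and REFL = wo_rel.REFL[OF wo_rel]
    and WF = wo_rel.WF[OF wo_rel]

abbreviation T where "T \<equiv> tree \<kappa>"

definition lt_at :: "'k \<Rightarrow> 'k node \<Rightarrow> 'k node \<Rightarrow> bool" where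
  "lt_at l u v \<longleftrightarrow> l \<in> Field \<kappa> \<and> (\<forall>\<beta>\<in>underS \<kappa> l. u \<beta> = v \<beta>) \<and>
     (\<exists>x y. u l = Some x \<and> v l = Some y \<and> x < y)"

text \<open>On \<open>T\<close> this is the part of \<open>lex_le\<close> between incomparable nodes
  (\<open>lex_le_iff\<close>). Unlike \<open>lex_le\<close> it survives passing to extensions of
  both nodes (\<open>lt_mono\<close>).\<close>

definition lt :: "'k node \<Rightarrow> 'k node \<Rightarrow> bool" where
  "lt u v \<longleftrightarrow> (\<exists>l. lt_at l u v)"

lemma le_refl: "\<gamma> \<in> Field \<kappa> \<Longrightarrow> (\<gamma>, \<gamma>) \<in> \<kappa>"
  using REFL by (auto simp: refl_on_def)

lemma le_total: "\<beta> \<in> Field \<kappa> \<Longrightarrow> \<gamma> \<in> Field \<kappa> \<Longrightarrow> (\<beta>, \<gamma>) \<in> \<kappa> \<or> \<gamma> \<in> underS \<kappa> \<beta>"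
  using TOTALS le_refl by (fastforce simp: underS_def)

lemma le_underS: "(\<beta>, \<gamma>) \<in> \<kappa> \<Longrightarrow> \<gamma> \<in> underS \<kappa> \<alpha> \<Longrightarrow> \<beta> \<in> underS \<kappa> \<alpha>"
  using ANTISYM TRANS unfolding underS_def by simp (metis antisymD transD)

lemma underS_le: "\<beta> \<in> underS \<kappa> \<gamma> \<Longrightarrow> (\<gamma>, \<alpha>) \<in> \<kappa> \<Longrightarrow> \<beta> \<in> underS \<kappa> \<alpha>"
  using ANTISYM TRANS unfolding underS_def by simp (metis antisymD transD)

lemma underS_irrefl: "\<beta> \<in> underS \<kappa> \<gamma> \<Longrightarrow> (\<gamma>, \<beta>) \<notin> \<kappa>"
  using ANTISYM unfolding underS_def by simp (metis antisymD)

lemma underS_Field: "\<beta> \<in> underS \<kappa> \<gamma> \<Longrightarrow> \<beta> \<in> Field \<kappa>"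
  by (auto simp: underS_def Field_def)

lemma tree_down: "u \<in> T \<Longrightarrow> \<gamma> \<in> dom u \<Longrightarrow> (\<beta>, \<gamma>) \<in> \<kappa> \<Longrightarrow> \<beta> \<in> dom u"
  unfolding tree_def using le_underS by blast

lemma tree_Field: "u \<in> T \<Longrightarrow> \<gamma> \<in> dom u \<Longrightarrow> \<gamma> \<in> Field \<kappa>"
  unfolding tree_def using underS_Field by blast

section \<open>Meets\<close>

lemma meet_apply: "meet \<kappa> u v \<gamma> = (if \<forall>\<beta>. (\<beta>, \<gamma>) \<in> \<kappa> \<longrightarrow> u \<beta> = v \<beta> then u \<gamma> else None)"
  by (simp add: meet_def restrict_map_def)

lemmas meet_tree = meet_greatest_common_initial_segment(1)[OF wo]
  and meet_le1 = meet_greatest_common_initial_segment(2)[OF wo]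
  and meet_le2 = meet_greatest_common_initial_segment(3)[OF wo]
  and meet_greatest = meet_greatest_common_initial_segment(4)[OF wo]

lemma meet_commute: "u \<in> T \<Longrightarrow> v \<in> T \<Longrightarrow> meet \<kappa> u v = meet \<kappa> v u"
  by (intro map_le_antisym meet_greatest meet_tree meet_le1 meet_le2)

lemma meet_absorb: "u \<in> T \<Longrightarrow> v \<in> T \<Longrightarrow> u \<subseteq>\<^sub>m v \<Longrightarrow> meet \<kappa> u v = u"
  by (intro map_le_antisym meet_greatest meet_le1 map_le_refl)

lemma meet_idem: "u \<in> T \<Longrightarrow> meet \<kappa> u u = u"
  by (intro meet_absorb map_le_refl)

lemma le_meet_iff:
  "u \<in> T \<Longrightarrow> v \<in> T \<Longrightarrow> w \<in> T \<Longrightarrow> w \<subseteq>\<^sub>m meet \<kappa> u v \<longleftrightarrow> w \<subseteq>\<^sub>m u \<and> w \<subseteq>\<^sub>m v"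
  using meet_greatest meet_le1 meet_le2 map_le_trans by blast

lemma comparable:
  assumes "u \<in> T" "v \<in> T" "u \<subseteq>\<^sub>m w" "v \<subseteq>\<^sub>m w"
  shows "u \<subseteq>\<^sub>m v \<or> v \<subseteq>\<^sub>m u"
proof -
  obtain \<alpha> \<beta> where d: "\<alpha> \<in> Field \<kappa>" "dom u = underS \<kappa> \<alpha>" "\<beta> \<in> Field \<kappa>" "dom v = underS \<kappa> \<beta>"
    using assms unfolding tree_def by blast
  have "dom u \<subseteq> dom v \<or> dom v \<subseteq> dom u"
    using le_total[OF d(1,3)] unfolding d(2,4) underS_def using ANTISYM TRANS
    by simp (smt (verit, best) Collect_mono_iff antisymD transD)
  then show ?thesis using assms(3,4) unfolding map_le_def by (metis subsetD)
qed

section \<open>The lexicographic order\<close>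

lemma lt_at_perp:
  assumes "lt_at l u v"
  shows "perp u v"
  using assms unfolding lt_at_def perp_def map_le_def by force

lemma lt_perp: "lt u v \<Longrightarrow> perp u v"
  unfolding lt_def using lt_at_perp by blast

lemma perp_commute: "perp u v \<longleftrightarrow> perp v u"
  unfolding perp_def by blast

lemma lt_at_meet:
  assumes "lt_at l u v" "u \<in> T" "v \<in> T"
  shows "meet \<kappa> u v = u |` underS \<kappa> l" "meet \<kappa> v u = u |` underS \<kappa> l"
    "dom (meet \<kappa> u v) = underS \<kappa> l" "dom (meet \<kappa> v u) = underS \<kappa> l"
proof -
  obtain x y where l: "l \<in> Field \<kappa>" "\<And>\<beta>. \<beta> \<in> underS \<kappa> l \<Longrightarrow>
    u \<beta> = v \<beta>" "u l = Some x" "v l = Some y" "x < y"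
    using assms(1) unfolding lt_at_def by blast
  show 1: "meet \<kappa> u v = u |` underS \<kappa> l"
  proof
    fix \<gamma>
    show "meet \<kappa> u v \<gamma> = (u |` underS \<kappa> l) \<gamma>"
    proof (cases "\<gamma> \<in> underS \<kappa> l")
      case True
      then have "\<forall>\<beta>. (\<beta>, \<gamma>) \<in> \<kappa> \<longrightarrow> u \<beta> = v \<beta>" using l(2) le_underS by blast
      then show ?thesis using True by (simp add: meet_apply)
    next
      case False
      have "meet \<kappa> u v \<gamma> = None"
      proof (cases "\<gamma> \<in> Field \<kappa>")
        case True
        then have "(l, \<gamma>) \<in> \<kappa>" using le_total[OF l(1), of \<gamma>] False by blast
        then show ?thesis using l(3-5) unfolding meet_apply by fastforce
      next
        case False
        then have "u \<gamma> = None" using tree_Field[OF assms(2)] by blast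
        then show ?thesis unfolding meet_apply by simp
      qed
      then show ?thesis using False by simp
    qed
  qed
  have "underS \<kappa> l \<subseteq> dom u"
    using tree_down[OF assms(2), of l] l(3) unfolding underS_def by blast
  then show 2: "dom (meet \<kappa> u v) = underS \<kappa> l" unfolding 1 by auto
  show "meet \<kappa> v u = u |` underS \<kappa> l" "dom (meet \<kappa> v u) = underS \<kappa> l"
    using 1 2 meet_commute[OF assms(2,3)] by auto
qed

text \<open>Take the least position \<open>l\<close> where the nodes differ. Both are defined there:
  otherwise one of them would end at or before \<open>l\<close> and be an initial segment of the
  other.\<close>

lemma perp_lt_cases:
  assumes "u \<in> T" "v \<in> T" "perp u v"
  shows "lt u v \<or> lt v u"
proof -
  have "{\<gamma> \<in> Field \<kappa>. u \<gamma> \<noteq> v \<gamma>} \<noteq> {}"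
  proof
    assume e: "{\<gamma> \<in> Field \<kappa>. u \<gamma> \<noteq> v \<gamma>} = {}"
    have "u \<gamma> = v \<gamma>" for \<gamma>
    proof (cases "\<gamma> \<in> Field \<kappa>")
      case False
      then have "u \<gamma> = None" "v \<gamma> = None" using tree_Field assms(1,2) by blast+
      then show ?thesis by simp
    qed (use e in blast)
    then have "u = v" by blast
    then show False using assms(3) unfolding perp_def by simp
  qed
  then obtain l where l: "l \<in> Field \<kappa>" "u l \<noteq> v l"
    "\<And>\<beta>. (\<beta>, l) \<in> \<kappa> - Id \<Longrightarrow> \<beta> \<notin> {\<gamma> \<in> Field \<kappa>. u \<gamma> \<noteq> v \<gamma>}"
    using wfE_min[OF WF, of _ "{\<gamma> \<in> Field \<kappa>. u \<gamma> \<noteq> v \<gamma>}"] by blast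
  have eq: "u \<beta> = v \<beta>" if "\<beta> \<in> underS \<kappa> l" for \<beta>
    using l(3)[of \<beta>] that underS_Field unfolding underS_def by blast
  have in_dom: "l \<in> dom w" if "w \<in> T" "\<not> w \<subseteq>\<^sub>m w'" "\<And>\<beta>. \<beta> \<in> underS \<kappa> l \<Longrightarrow> w \<beta> = w' \<beta>" for w w'
  proof (rule ccontr)
    assume n: "l \<notin> dom w"
    have "\<gamma> \<in> underS \<kappa> l" if \<gamma>: "\<gamma> \<in> dom w" for \<gamma>
    proof -
      have "(l, \<gamma>) \<notin> \<kappa>" using n tree_down[OF \<open>w \<in> T\<close> \<gamma>] by blast
      then show ?thesis using le_total[OF l(1) tree_Field[OF \<open>w \<in> T\<close> \<gamma>]] by blast
    qed
    then have "w \<subseteq>\<^sub>m w'" using that(3) unfolding map_le_def by blast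
    then show False using that(2) by blast
  qed
  have "l \<in> dom u" "l \<in> dom v"
    using in_dom[of u v] in_dom[of v u] eq assms unfolding perp_def by force+
  then obtain x y where "u l = Some x" "v l = Some y" "x \<noteq> y" using l(2) by auto
  then have "lt_at l u v \<or> lt_at l v u" using l(1) eq unfolding lt_at_def by (simp add: neq_iff)
  then show ?thesis unfolding lt_def by blast
qed

lemma lt_at_trans:
  assumes "lt_at l u v" "lt_at l' v w"
  shows "lt_at (if (l, l') \<in> \<kappa> then l else l') u w"
proof (cases "(l, l') \<in> \<kappa>")
  case True
  have "u \<beta> = w \<beta>" if "\<beta> \<in> underS \<kappa> l" for \<beta>
    using assms that underS_le[OF that True] unfolding lt_at_def by metis
  moreover have "\<exists>x y. u l = Some x \<and> w l = Some y \<and> x < y"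
  proof (cases "l = l'")
    case True
    then show ?thesis using assms unfolding lt_at_def by fastforce
  next
    case False
    then have "l \<in> underS \<kappa> l'" using True unfolding underS_def by blast
    then show ?thesis using assms unfolding lt_at_def by metis
  qed
  ultimately show ?thesis using True assms(1) unfolding lt_at_def by simp
next
  case False
  then have l: "l' \<in> underS \<kappa> l" using le_total[of l l'] assms unfolding lt_at_def by blast
  then have "(l', l) \<in> \<kappa>" unfolding underS_def by blast
  then have "u \<beta> = w \<beta>" if "\<beta> \<in> underS \<kappa> l'" for \<beta>
    using assms that underS_le[OF that] unfolding lt_at_def by metis
  moreover have "\<exists>x y. u l' = Some x \<and> w l' = Some y \<and> x < y"
    using assms l unfolding lt_at_def by metis
  ultimately show ?thesis using False assms(2) unfolding lt_at_def by simp
qed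

lemma lt_trans: "lt u v \<Longrightarrow> lt v w \<Longrightarrow> lt u w"
  unfolding lt_def using lt_at_trans by blast

lemma lt_irrefl: "\<not> lt u u"
  unfolding lt_def lt_at_def by auto

lemma lt_mono:
  assumes "lt u v" "u \<subseteq>\<^sub>m u'" "v \<subseteq>\<^sub>m v'" "u \<in> T" "v \<in> T"
  shows "lt u' v'"
proof -
  obtain l x y where l: "l \<in> Field \<kappa>" "\<forall>\<beta>\<in>underS \<kappa> l. u \<beta> = v \<beta>" "u l = Some x" "v l = Some y"
    "x < y"
    using assms unfolding lt_def lt_at_def by blast
  have "\<beta> \<in> dom u \<and> \<beta> \<in> dom v" if "(\<beta>, l) \<in> \<kappa>" for \<beta>
    using tree_down[OF assms(4) _ that] tree_down[OF assms(5) _ that] l by blast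
  then have e: "u' \<beta> = u \<beta>" "v' \<beta> = v \<beta>" if "(\<beta>, l) \<in> \<kappa>" for \<beta>
    using assms(2,3) that unfolding map_le_def by force+
  have "\<forall>\<beta>\<in>underS \<kappa> l. u' \<beta> = v' \<beta>" using e l(2) unfolding underS_def by simp
  moreover have "u' l = Some x" "v' l = Some y" using e le_refl[OF l(1)] l(3,4) by auto
  ultimately show ?thesis using l(1,5) unfolding lt_def lt_at_def by blast
qed

lemma lex_le_iff:
  assumes "u \<in> T" "v \<in> T"
  shows "lex_le \<kappa> u v \<longleftrightarrow> u \<subseteq>\<^sub>m v \<or> lt u v"
proof
  assume "lex_le \<kappa> u v"
  then consider "u \<subseteq>\<^sub>m v" | l where "perp u v" "l \<in> Field \<kappa>" "dom (meet \<kappa> u v) = underS \<kappa> l"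
    "the (u l) < the (v l)"
    unfolding lex_le_def by blast
  then show "u \<subseteq>\<^sub>m v \<or> lt u v"
  proof cases
    case 2
    show ?thesis
    proof (rule ccontr)
      assume "\<not> ?thesis"
      then obtain l' where l': "lt_at l' v u"
        using perp_lt_cases[OF assms 2(1)] unfolding lt_def by blast
      \<comment> \<open>The length of the meet determines the splitting position, so the position
        witnessing \<open>lt v u\<close> is the \<open>l\<close> of \<open>lex_le\<close>, where the
        values are ordered the other way.\<close>
      then have "underS \<kappa> l' = underS \<kappa> l" using lt_at_meet(4)[OF l' assms(2,1)] 2(3) by simp
      moreover have "l' \<in> Field \<kappa>" using l' unfolding lt_at_def by blast
      ultimately have "l' = l" using le_total[of l l'] le_total[of l' l] 2(2) underS_irrefl le_refl
        unfolding underS_def by blast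
      then show False using l' 2(4) unfolding lt_at_def by auto
    qed
  qed simp
next
  assume "u \<subseteq>\<^sub>m v \<or> lt u v"
  then show "lex_le \<kappa> u v"
  proof
    assume "lt u v"
    then obtain l where l: "lt_at l u v" unfolding lt_def by blast
    then have "l \<in> Field \<kappa>" "the (u l) < the (v l)" unfolding lt_at_def by auto
    then show ?thesis using lt_at_perp[OF l] lt_at_meet(3)[OF l assms] unfolding lex_le_def by blast
  qed (simp add: lex_le_def)
qed

lemma lex_le_refl: "lex_le \<kappa> u u"
  unfolding lex_le_def by simp

lemma lex_le_total:
  assumes "u \<in> T" "v \<in> T"
  shows "lex_le \<kappa> u v \<or> lex_le \<kappa> v u"
  using perp_lt_cases[OF assms] lex_le_iff[OF assms] lex_le_iff[OF assms(2,1)]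
  unfolding perp_def by blast

lemma lex_le_antisym:
  assumes "u \<in> T" "v \<in> T" "lex_le \<kappa> u v" "lex_le \<kappa> v u"
  shows "u = v"
proof -
  have "\<not> (lt u v \<and> lt v u)" using lt_trans lt_irrefl by blast
  then show ?thesis
    using assms lex_le_iff[OF assms(1,2)] lex_le_iff[OF assms(2,1)] lt_perp[of u v] lt_perp[of v u]
      map_le_antisym
    unfolding perp_def by blast
qed

text \<open>The delicate combination is an initial segment followed by a strict inequality:
  \<open>u\<close> may stop before \<open>v\<close> and \<open>w\<close> split, or reach beyond that
  position and then split from \<open>w\<close> itself.\<close>

lemma lex_le_trans:
  assumes "u \<in> T" "v \<in> T" "w \<in> T" "lex_le \<kappa> u v" "lex_le \<kappa> v w"
  shows "lex_le \<kappa> u w"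
proof -
  consider "u \<subseteq>\<^sub>m v" "v \<subseteq>\<^sub>m w" | "u \<subseteq>\<^sub>m v" "lt v w" | "lt u v" "v \<subseteq>\<^sub>m w" | "lt u v" "lt v w"
    using assms lex_le_iff by blast
  then have "u \<subseteq>\<^sub>m w \<or> lt u w"
  proof cases
    case 1
    then show ?thesis using map_le_trans by blast
  next
    case 2
    show ?thesis
    proof (cases "u \<subseteq>\<^sub>m w \<or> w \<subseteq>\<^sub>m u")
      case True
      then show ?thesis using 2 lt_perp[OF 2(2)] map_le_trans[of w u v] unfolding perp_def by blast
    next
      case False
      then have "lt u w \<or> lt w u" using perp_lt_cases assms(1,3) unfolding perp_def by blast
      moreover have "\<not> lt w u"
        using lt_mono[of w u w v] 2 lt_trans[of w v w] lt_irrefl assms(1,3) map_le_refl by blast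
      ultimately show ?thesis by blast
    qed
  next
    case 3
    then show ?thesis using lt_mono[of u v u w] assms(1,2) map_le_refl by blast
  next
    case 4
    then show ?thesis using lt_trans by blast
  qed
  then show ?thesis using lex_le_iff assms(1,3) by blast
qed

text \<open>Both neighbouring meets are initial segments of \<open>v\<close>, hence comparable, and
  \<open>u\<close> follows \<open>w\<close> exactly up to the shorter one. So in a lexicographically
  sorted antichain the meets of neighbours determine all meets.\<close>

lemma meet_between:
  assumes "lt u v" "lt v w" "u \<in> T" "v \<in> T" "w \<in> T"
  shows "meet \<kappa> u w = (if meet \<kappa> u v \<subseteq>\<^sub>m meet \<kappa> v w then meet \<kappa> u v else meet \<kappa> v w)"
proof -
  obtain l l' where l: "lt_at l u v" "lt_at l' v w" using assms(1,2) unfolding lt_def by blast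
  have F: "l \<in> Field \<kappa>" "l' \<in> Field \<kappa>" using l unfolding lt_at_def by blast+
  note uv = lt_at_meet[OF l(1) assms(3,4)] and vw = lt_at_meet[OF l(2) assms(4,5)]
    and uw = lt_at_meet[OF lt_at_trans[OF l] assms(3,5)]
  have eq: "u \<beta> = v \<beta>" if "\<beta> \<in> underS \<kappa> l" for \<beta> using l(1) that unfolding lt_at_def by blast
  have "(l, l') \<in> \<kappa> \<longleftrightarrow> meet \<kappa> u v \<subseteq>\<^sub>m meet \<kappa> v w"
  proof
    assume "(l, l') \<in> \<kappa>"
    then have "meet \<kappa> u v \<beta> = meet \<kappa> v w \<beta>" if "\<beta> \<in> underS \<kappa> l" for \<beta>
      using that eq underS_le unfolding uv(1) vw(1) by (auto simp: restrict_map_def)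
    then show "meet \<kappa> u v \<subseteq>\<^sub>m meet \<kappa> v w" unfolding map_le_def uv(3) by blast
  next
    assume "meet \<kappa> u v \<subseteq>\<^sub>m meet \<kappa> v w"
    then have "underS \<kappa> l \<subseteq> underS \<kappa> l'" using uv(3) vw(3) map_le_implies_dom_le by fastforce
    then show "(l, l') \<in> \<kappa>" using le_total[OF F] unfolding underS_def by blast
  qed
  moreover have "meet \<kappa> u w = meet \<kappa> v w" if "(l, l') \<notin> \<kappa>"
  proof -
    have "l' \<in> underS \<kappa> l" using le_total[OF F] that by blast
    then have "u |` underS \<kappa> l' = v |` underS \<kappa> l'"
      using eq underS_le[of _ l' l] unfolding underS_def by (force simp: restrict_map_def)
    then show ?thesis using that uw(1) vw(1) by simp
  qed
  ultimately show ?thesis using uv(1) uw(1) by auto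
qed

text \<open>Incomparable meets are ordered like the nodes above them; between comparable ones
  inclusion decides. This expresses the order between meets by data that \<open>psim\<close>
  preserves.\<close>

lemma lex_le_meet_iff:
  assumes "u1 \<in> T" "u2 \<in> T" "u3 \<in> T" "u4 \<in> T"
  shows "lex_le \<kappa> (meet \<kappa> u1 u2) (meet \<kappa> u3 u4) \<longleftrightarrow>
    meet \<kappa> u1 u2 \<subseteq>\<^sub>m meet \<kappa> u3 u4 \<or> \<not> meet \<kappa> u3 u4 \<subseteq>\<^sub>m meet \<kappa> u1 u2 \<and> lex_le \<kappa> u1 u3"
    (is "lex_le \<kappa> ?m ?m' \<longleftrightarrow> _")
proof -
  have T: "?m \<in> T" "?m' \<in> T" using assms meet_tree by auto
  have le: "?m \<subseteq>\<^sub>m u1" "?m' \<subseteq>\<^sub>m u3" using assms meet_le1 by auto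
  show ?thesis
  proof (cases "perp ?m ?m'")
    case True
    then have "lt ?m ?m' \<or> lt ?m' ?m" using perp_lt_cases T by blast
    moreover have "lt ?m ?m' \<Longrightarrow> lt u1 u3" "lt ?m' ?m \<Longrightarrow> lt u3 u1"
      using lt_mono[of ?m ?m' u1 u3] lt_mono[of ?m' ?m u3 u1] le T by blast+
    moreover have "\<not> (lt u1 u3 \<and> lt u3 u1)" using lt_trans lt_irrefl by blast
    moreover have "lt u1 u3 \<or> lt u3 u1 \<Longrightarrow> \<not> u1 \<subseteq>\<^sub>m u3" using lt_perp unfolding perp_def by blast
    ultimately have "lt ?m ?m' \<longleftrightarrow> lex_le \<kappa> u1 u3" using lex_le_iff[OF assms(1,3)] by blast
    then show ?thesis using True lex_le_iff[OF T] unfolding perp_def by blast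
  next
    case False
    then show ?thesis
      using lex_le_iff[OF T] lex_le_iff[OF T(2,1)] lt_perp unfolding perp_def by blast
  qed
qed

lemma meet_le_meet_iff:
  assumes "u1 \<in> T" "u2 \<in> T" "u3 \<in> T" "u4 \<in> T"
  shows "meet \<kappa> u1 u2 \<subseteq>\<^sub>m meet \<kappa> u3 u4 \<longleftrightarrow> meet \<kappa> u1 u2 \<subseteq>\<^sub>m u3 \<and> meet \<kappa> u1 u2 \<subseteq>\<^sub>m u4"
  using le_meet_iff assms meet_tree by blast

text \<open>If neither meet extends the other, they split where \<open>u1\<close> and
  \<open>u3\<close> do. In every case the result is a meet of two of the given nodes, so terms with
  nested meets produce nothing new.\<close>

lemma meet_meet:
  assumes "u1 \<in> T" "u2 \<in> T" "u3 \<in> T" "u4 \<in> T"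
  shows "meet \<kappa> (meet \<kappa> u1 u2) (meet \<kappa> u3 u4) =
    (if meet \<kappa> u1 u2 \<subseteq>\<^sub>m meet \<kappa> u3 u4 then meet \<kappa> u1 u2
     else if meet \<kappa> u3 u4 \<subseteq>\<^sub>m meet \<kappa> u1 u2 then meet \<kappa> u3 u4 else meet \<kappa> u1 u3)"
    (is "meet \<kappa> ?m ?m' = _")
proof -
  have T: "?m \<in> T" "?m' \<in> T" "meet \<kappa> u1 u3 \<in> T" using assms meet_tree by auto
  have le: "?m \<subseteq>\<^sub>m u1" "?m' \<subseteq>\<^sub>m u3" using assms meet_le1 by auto
  have c: "meet \<kappa> ?m ?m' = meet \<kappa> u1 u3" if n: "\<not> ?m \<subseteq>\<^sub>m ?m'" "\<not> ?m' \<subseteq>\<^sub>m ?m"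
  proof (rule map_le_antisym)
    show "meet \<kappa> ?m ?m' \<subseteq>\<^sub>m meet \<kappa> u1 u3"
      by (rule meet_greatest[OF assms(1,3) meet_tree[OF T(1,2)]
            map_le_trans[OF meet_le1[OF T(1,2)] le(1)] map_le_trans[OF meet_le2[OF T(1,2)] le(2)]])
    have "meet \<kappa> u1 u3 \<subseteq>\<^sub>m ?m"
    proof (rule ccontr)
      assume "\<not> ?thesis"
      then have 1: "?m \<subseteq>\<^sub>m meet \<kappa> u1 u3"
        using comparable[OF T(1,3) le(1) meet_le1[OF assms(1,3)]] by blast
      then have "?m \<subseteq>\<^sub>m u3" using map_le_trans[OF _ meet_le2[OF assms(1,3)]] by blast
      then show False using comparable[OF T(1,2) _ le(2)] n by blast
    qed
    moreover have "meet \<kappa> u1 u3 \<subseteq>\<^sub>m ?m'"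
    proof (rule ccontr)
      assume "\<not> ?thesis"
      then have 1: "?m' \<subseteq>\<^sub>m meet \<kappa> u1 u3"
        using comparable[OF T(2,3) le(2) meet_le2[OF assms(1,3)]] by blast
      then have "?m' \<subseteq>\<^sub>m u1" using map_le_trans[OF _ meet_le1[OF assms(1,3)]] by blast
      then show False using comparable[OF T(1,2) le(1)] n by blast
    qed
    ultimately show "meet \<kappa> u1 u3 \<subseteq>\<^sub>m meet \<kappa> ?m ?m'"
      by (intro meet_greatest[OF T])
  qed
  show ?thesis
    using c meet_absorb[OF T(1,2)] meet_absorb[OF T(2,1)] meet_commute[OF T(1,2)] by auto
qed

section \<open>Similarity\<close>

definition psim :: "('k node \<times> 'k node) set \<Rightarrow> bool" where
  "psim S \<longleftrightarrow> S \<subseteq> T \<times> T \<and>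
     (\<forall>(u, u')\<in>S. \<forall>(v, v')\<in>S. \<forall>(w, w')\<in>S. meet \<kappa> u v \<subseteq>\<^sub>m w \<longleftrightarrow> meet \<kappa> u' v' \<subseteq>\<^sub>m w') \<and>
     (\<forall>(u, u')\<in>S. \<forall>(v, v')\<in>S. lex_le \<kappa> u v \<longleftrightarrow> lex_le \<kappa> u' v')"

lemma psimI:
  assumes "\<And>u u'. (u, u') \<in> S \<Longrightarrow> u \<in> T \<and> u' \<in> T"
    "\<And>u u' v v' w w'. (u, u') \<in> S \<Longrightarrow> (v, v') \<in> S \<Longrightarrow> (w, w') \<in> S \<Longrightarrow>
      meet \<kappa> u v \<subseteq>\<^sub>m w \<longleftrightarrow> meet \<kappa> u' v' \<subseteq>\<^sub>m w'"
    "\<And>u u' v v'. (u, u') \<in> S \<Longrightarrow> (v, v') \<in> S \<Longrightarrow> lex_le \<kappa> u v \<longleftrightarrow> lex_le \<kappa> u' v'"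
  shows "psim S"
proof -
  have "S \<subseteq> T \<times> T" using assms(1) by auto
  moreover have "meet \<kappa> (fst x) (fst y) \<subseteq>\<^sub>m fst z \<longleftrightarrow> meet \<kappa> (snd x) (snd y) \<subseteq>\<^sub>m snd z"
    if "x \<in> S" "y \<in> S" "z \<in> S" for x y z
    by (rule assms(2)) (use that in simp_all)
  moreover have "lex_le \<kappa> (fst x) (fst y) \<longleftrightarrow> lex_le \<kappa> (snd x) (snd y)" if "x \<in> S" "y \<in> S" for x y
    by (rule assms(3)) (use that in simp_all)
  ultimately show ?thesis unfolding psim_def case_prod_beta by blast
qed

lemma psimD:
  assumes "psim S" "(u, u') \<in> S"
  shows "u \<in> T" "u' \<in> T"
    "(v, v') \<in> S \<Longrightarrow> (w, w') \<in> S \<Longrightarrow> meet \<kappa> u v \<subseteq>\<^sub>m w \<longleftrightarrow> meet \<kappa> u' v' \<subseteq>\<^sub>m w'"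
    "(v, v') \<in> S \<Longrightarrow> lex_le \<kappa> u v \<longleftrightarrow> lex_le \<kappa> u' v'"
  using assms unfolding psim_def by (blast, blast, force, force)

lemma psim_mono: "psim S \<Longrightarrow> S' \<subseteq> S \<Longrightarrow> psim S'"
  unfolding psim_def by blast

text \<open>An initial segment of a meet is a common initial segment of its two arguments, so the
  ternary clause of \<open>psim\<close> controls four nodes as well.\<close>

lemma psim_meet_le_meet:
  assumes "psim S" "(u1, v1) \<in> S" "(u2, v2) \<in> S" "(u3, v3) \<in> S" "(u4, v4) \<in> S"
  shows "meet \<kappa> u1 u2 \<subseteq>\<^sub>m meet \<kappa> u3 u4 \<longleftrightarrow> meet \<kappa> v1 v2 \<subseteq>\<^sub>m meet \<kappa> v3 v4"
proof -
  note D = psimD[OF assms(1)]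
  have T: "u1 \<in> T" "u2 \<in> T" "u3 \<in> T" "u4 \<in> T" "v1 \<in> T" "v2 \<in> T" "v3 \<in> T" "v4 \<in> T"
    using assms D(1,2) by blast+
  show ?thesis unfolding meet_le_meet_iff[OF T(1-4)] meet_le_meet_iff[OF T(5-8)]
    using D(3) assms(2-5) by blast
qed

lemma psim_functional:
  assumes "psim S" "(u, u') \<in> S" "(v, v') \<in> S"
  shows "u = v \<longleftrightarrow> u' = v'"
  using assms psimD[OF assms(1)] lex_le_antisym lex_le_refl by metis

lemma psim_relcomp:
  assumes "psim S" "psim S'"
  shows "psim (S O S')"
proof (rule psimI; elim relcompEpair)
  fix u u' x assume 1: "(u, x) \<in> S" "(x, u') \<in> S'"
  then show "u \<in> T \<and> u' \<in> T" using psimD(1,2) assms by blast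
  fix v v' y assume 2: "(v, y) \<in> S" "(y, v') \<in> S'"
  then show "lex_le \<kappa> u v \<longleftrightarrow> lex_le \<kappa> u' v'"
    using psimD(4)[OF assms(1) 1(1) 2(1)] psimD(4)[OF assms(2) 1(2) 2(2)] by blast
  fix w w' z assume 3: "(w, z) \<in> S" "(z, w') \<in> S'"
  then show "meet \<kappa> u v \<subseteq>\<^sub>m w \<longleftrightarrow> meet \<kappa> u' v' \<subseteq>\<^sub>m w'"
    using psimD(3)[OF assms(1) 1(1) 2(1)] psimD(3)[OF assms(2) 1(2) 2(2)] by blast
qed

lemma psim_converse:
  assumes "psim S"
  shows "psim (S\<inverse>)"
  by (rule psimI) (use psimD[OF assms] in blast)+

lemma psim_Id_on: "X \<subseteq> T \<Longrightarrow> psim (Id_on X)"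
  unfolding psim_def by auto

text \<open>By \<open>meet_meet\<close> every term takes a binary meet of nodes from
  \<open>S\<close> as its value. The reduction makes the same choice on both sides, since its case
  distinction is preserved by \<open>S\<close>.\<close>

lemma psim_term:
  assumes S: "psim S" and "wf_tm L0 t" "\<forall>v\<in>vars_tm t. (e v, e' v) \<in> S"
  shows "\<exists>u u' v v'. (u, u') \<in> S \<and> (v, v') \<in> S \<and>
    val (tree_struct \<kappa>) e t = meet \<kappa> u v \<and> val (tree_struct \<kappa>) e' t = meet \<kappa> u' v'"
  using assms(2,3)
proof (induction t)
  case (Var x)
  then have "e x \<in> T" "e' x \<in> T" using psimD[OF S] by auto
  then show ?case using Var meet_idem by (metis insertI1 val.simps(1) vars_tm.simps(1))
next
  case (Fn f ts)
  have "length ts = 2" using Fn.prems(1) unfolding L0_def by simp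
  then obtain s t where ts: "ts = [s, t]"
    by (metis (no_types, opaque_lifting) One_nat_def Suc_1 length_0_conv length_Suc_conv)
  have "\<exists>u u' v v'. (u, u') \<in> S \<and> (v, v') \<in> S \<and> val (tree_struct \<kappa>) e s = meet \<kappa> u v \<and>
    val (tree_struct \<kappa>) e' s = meet \<kappa> u' v'"
    using Fn by (intro Fn.IH) (auto simp: ts)
  moreover have "\<exists>u u' v v'. (u, u') \<in> S \<and> (v, v') \<in> S \<and> val (tree_struct \<kappa>) e t = meet \<kappa> u v \<and>
    val (tree_struct \<kappa>) e' t = meet \<kappa> u' v'"
    using Fn by (intro Fn.IH) (auto simp: ts)
  ultimately obtain u1 v1 u2 v2 u3 v3 u4 v4 where
    in_S: "(u1, v1) \<in> S" "(u2, v2) \<in> S" "(u3, v3) \<in> S" "(u4, v4) \<in> S" and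
    eqs: "val (tree_struct \<kappa>) e s = meet \<kappa> u1 u2" "val (tree_struct \<kappa>) e' s = meet \<kappa> v1 v2"
    "val (tree_struct \<kappa>) e t = meet \<kappa> u3 u4" "val (tree_struct \<kappa>) e' t = meet \<kappa> v3 v4" by metis
  have T: "u1 \<in> T" "u2 \<in> T" "u3 \<in> T" "u4 \<in> T" "v1 \<in> T" "v2 \<in> T" "v3 \<in> T" "v4 \<in> T"
    using in_S psimD(1,2)[OF S] by blast+
  have "val (tree_struct \<kappa>) e (Fn f ts) = meet \<kappa> (meet \<kappa> u1 u2) (meet \<kappa> u3 u4)"
    "val (tree_struct \<kappa>) e' (Fn f ts) = meet \<kappa> (meet \<kappa> v1 v2) (meet \<kappa> v3 v4)"
    using eqs unfolding ts tree_struct_def by auto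
  then show ?case
    unfolding meet_meet[OF T(1-4)] meet_meet[OF T(5-8)]
      psim_meet_le_meet[OF S in_S(1-4)] psim_meet_le_meet[OF S in_S(3,4,1,2)]
    using in_S by (metis (full_types))
qed

lemma psim_qfree:
  assumes S: "psim S" and "qfree \<phi>" "wf_fm L0 \<phi>" "\<forall>v\<in>FV \<phi>. (e v, e' v) \<in> S"
  shows "sat (tree_struct \<kappa>) e \<phi> \<longleftrightarrow> sat (tree_struct \<kappa>) e' \<phi>"
proof -
  have atoms: "(val (tree_struct \<kappa>) e s \<subseteq>\<^sub>m val (tree_struct \<kappa>) e t \<longleftrightarrow>
    val (tree_struct \<kappa>) e' s \<subseteq>\<^sub>m val (tree_struct \<kappa>) e' t) \<and>
     (val (tree_struct \<kappa>) e t \<subseteq>\<^sub>m val (tree_struct \<kappa>) e s \<longleftrightarrow>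
       val (tree_struct \<kappa>) e' t \<subseteq>\<^sub>m val (tree_struct \<kappa>) e' s) \<and>
     (lex_le \<kappa> (val (tree_struct \<kappa>) e s) (val (tree_struct \<kappa>) e t) \<longleftrightarrow>
      lex_le \<kappa> (val (tree_struct \<kappa>) e' s) (val (tree_struct \<kappa>) e' t))"
    if s: "wf_tm L0 s" "\<forall>v\<in>vars_tm s. (e v, e' v) \<in> S" and t: "wf_tm L0 t"
      "\<forall>v\<in>vars_tm t. (e v, e' v) \<in> S" for s t
  proof -
    obtain u1 v1 u2 v2 u3 v3 u4 v4 where
      in_S: "(u1, v1) \<in> S" "(u2, v2) \<in> S" "(u3, v3) \<in> S" "(u4, v4) \<in> S" and
      eqs: "val (tree_struct \<kappa>) e s = meet \<kappa> u1 u2" "val (tree_struct \<kappa>) e' s = meet \<kappa> v1 v2"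
      "val (tree_struct \<kappa>) e t = meet \<kappa> u3 u4" "val (tree_struct \<kappa>) e' t = meet \<kappa> v3 v4"
      using psim_term[OF S s] psim_term[OF S t] by metis
    have T: "u1 \<in> T" "u2 \<in> T" "u3 \<in> T" "u4 \<in> T" "v1 \<in> T" "v2 \<in> T" "v3 \<in> T" "v4 \<in> T"
      using in_S psimD(1,2)[OF S] by blast+
    show ?thesis
      unfolding eqs lex_le_meet_iff[OF T(1-4)] lex_le_meet_iff[OF T(5-8)]
        psim_meet_le_meet[OF S in_S(1-4)] psim_meet_le_meet[OF S in_S(3,4,1,2)]
        psimD(4)[OF S in_S(1,3)] by blast
  qed
  show ?thesis
    using assms(2-)
  proof (induction \<phi>)
    case (Eq s t)
    then show ?case using atoms[of s t] map_le_antisym map_le_refl by (auto 4 3)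
  next
    case (Rel p ts)
    have "length ts = 2" using Rel.prems unfolding L0_def by simp
    then obtain s t where ts: "ts = [s, t]"
      by (metis (no_types, opaque_lifting) One_nat_def Suc_1 length_0_conv length_Suc_conv)
    show ?case
      using atoms[of s t] Rel.prems unfolding ts tree_struct_def by (auto split: L0_rel.splits)
  qed auto
qed

section \<open>Quantifier-free types as similarities\<close>

lemma qftp_eq_iff:
  fixes x x' :: "'i \<Rightarrow> 'm"
  shows "qftp L M I x = qftp L M I x' \<longleftrightarrow>
   (\<forall>\<phi> e e'. qfree \<phi> \<longrightarrow> wf_fm L \<phi> \<longrightarrow> (\<forall>v\<in>FV \<phi>. \<exists>i\<in>I. e v = x i \<and> e' v = x' i) \<longrightarrow>
     (sat M e \<phi> \<longleftrightarrow> sat M e' \<phi>))" (is "?l \<longleftrightarrow> ?r")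
proof
  assume eq: ?l
  show ?r
  proof (intro allI impI)
    fix \<phi> e e' assume \<phi>: "qfree \<phi>" "wf_fm L \<phi>" and "\<forall>v\<in>FV \<phi>. \<exists>i\<in>I. e v = x i \<and> e' v = x' i"
    then obtain i where i: "\<forall>v\<in>FV \<phi>. i v \<in> I \<and> e v = x (i v) \<and> e' v = x' (i v)" by metis
    define \<sigma> :: "nat \<Rightarrow> 'i + 'm" where "\<sigma> v = Inl (i v)" for v
    have "(\<phi>, \<sigma>) \<in> pfms L I {}" using i \<phi> unfolding pfms_def \<sigma>_def by auto
    then have "holds M x (\<phi>, \<sigma>) \<longleftrightarrow> holds M x' (\<phi>, \<sigma>)" using eq \<phi> unfolding qftp_def tp_def by auto
    moreover have "holds M x (\<phi>, \<sigma>) \<longleftrightarrow> sat M e \<phi>" "holds M x' (\<phi>, \<sigma>) \<longleftrightarrow> sat M e' \<phi>"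
      unfolding holds_def \<sigma>_def using i by (auto intro!: sat_cong)
    ultimately show "sat M e \<phi> \<longleftrightarrow> sat M e' \<phi>" by blast
  qed
next
  assume r: ?r
  have "holds M x (\<phi>, \<sigma>) \<longleftrightarrow> holds M x' (\<phi>, \<sigma>)" if "(\<phi>, \<sigma>) \<in> pfms L I {}" "qfree \<phi>" for \<phi> \<sigma>
    unfolding holds_def prod.case
  proof (rule r[rule_format])
    show "qfree \<phi>" "wf_fm L \<phi>" using that unfolding pfms_def by auto
    fix v assume "v \<in> FV \<phi>"
    then have "\<sigma> v \<in> I <+> {}" using that unfolding pfms_def by blast
    then show "\<exists>i\<in>I. case_sum x id (\<sigma> v) = x i \<and> case_sum x' id (\<sigma> v) = x' i" by auto
  qed
  then show ?l unfolding qftp_def tp_def by auto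
qed

lemma sim0_iff_psim:
  assumes "\<eta> ` I \<subseteq> T" "\<nu> ` I \<subseteq> T"
  shows "sim0 \<kappa> I \<eta> \<nu> \<longleftrightarrow> psim {(\<eta> i, \<nu> i) | i. i \<in> I}" (is "_ \<longleftrightarrow> psim ?S")
proof
  assume "sim0 \<kappa> I \<eta> \<nu>"
  then have D: "sat (tree_struct \<kappa>) e \<phi> \<longleftrightarrow> sat (tree_struct \<kappa>) e' \<phi>"
    if "qfree \<phi>" "wf_fm L0 \<phi>" "\<forall>v\<in>FV \<phi>. \<exists>i\<in>I. e v = \<eta> i \<and> e' v = \<nu> i" for \<phi> e e'
    using that unfolding sim0_def qftp_eq_iff by blast
  have init: "meet \<kappa> (\<eta> i) (\<eta> j) \<subseteq>\<^sub>m \<eta> k \<longleftrightarrow> meet \<kappa> (\<nu> i) (\<nu> j) \<subseteq>\<^sub>m \<nu> k"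
    if "i \<in> I" "j \<in> I" "k \<in> I" for i j k
    using D[of "Rel Init [Fn Meet [Var 0, Var 1], Var 2]" "\<lambda>v. \<eta> ([i, j, k] ! v)"
      "\<lambda>v. \<nu> ([i, j, k] ! v)"] that
    by (simp add: L0_def tree_struct_def numeral_eq_Suc) blast
  have lex: "lex_le \<kappa> (\<eta> i) (\<eta> j) \<longleftrightarrow> lex_le \<kappa> (\<nu> i) (\<nu> j)" if "i \<in> I" "j \<in> I" for i j
    using D[of "Rel Lex [Var 0, Var 1]" "\<lambda>v. \<eta> ([i, j] ! v)" "\<lambda>v. \<nu> ([i, j] ! v)"] that
    by (simp add: L0_def tree_struct_def numeral_eq_Suc) blast
  show "psim ?S" unfolding psim_def using init lex assms by auto
next
  assume S: "psim ?S"
  show "sim0 \<kappa> I \<eta> \<nu>"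
    unfolding sim0_def qftp_eq_iff
  proof (intro allI impI)
    fix \<phi> e e' assume "qfree \<phi>" "wf_fm L0 \<phi>" "\<forall>v\<in>FV \<phi>. \<exists>i\<in>I. e v = \<eta> i \<and> e' v = \<nu> i"
    then show "sat (tree_struct \<kappa>) e \<phi> \<longleftrightarrow> sat (tree_struct \<kappa>) e' \<phi>"
      by (intro psim_qfree[OF S]) auto
  qed
qed

lemma sim_delta_iff_psim:
  assumes "\<eta> ` I \<subseteq> T" "\<nu> ` I \<subseteq> T"
  shows "sim_delta \<kappa> X I \<eta> \<nu> \<longleftrightarrow> psim {(\<eta> i, \<nu> i) | i. i \<in> I}" (is "_ \<longleftrightarrow> psim ?S")
proof
  assume "sim_delta \<kappa> X I \<eta> \<nu>"
  then have D: "sat (antichain_struct \<kappa> X) e \<phi> \<longleftrightarrow> sat (antichain_struct \<kappa> X) e' \<phi>"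
    if "qfree \<phi>" "wf_fm Ldelta \<phi>" "\<forall>v\<in>FV \<phi>. \<exists>i\<in>I. e v = \<eta> i \<and> e' v = \<nu> i" for \<phi> e e'
    using that unfolding sim_delta_def qftp_eq_iff by blast
  \<comment> \<open>The last argument of \<open>Delta\<close> is repeated: as a node is its own
    meet, this expresses the ternary condition of \<open>psim\<close>.\<close>
  have "meet \<kappa> (\<eta> i) (\<eta> j) \<subseteq>\<^sub>m meet \<kappa> (\<eta> k) (\<eta> k) \<longleftrightarrow> meet \<kappa> (\<nu> i) (\<nu> j) \<subseteq>\<^sub>m meet \<kappa> (\<nu> k) (\<nu> k)"
    if "i \<in> I" "j \<in> I" "k \<in> I" for i j k
    using D[of "Rel Delta [Var 0, Var 1, Var 2, Var 2]" "\<lambda>v. \<eta> ([i, j, k] ! v)"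
      "\<lambda>v. \<nu> ([i, j, k] ! v)"] that
    by (simp add: Ldelta_def antichain_struct_def numeral_eq_Suc) blast
  then have init: "meet \<kappa> (\<eta> i) (\<eta> j) \<subseteq>\<^sub>m \<eta> k \<longleftrightarrow> meet \<kappa> (\<nu> i) (\<nu> j) \<subseteq>\<^sub>m \<nu> k"
    if "i \<in> I" "j \<in> I" "k \<in> I" for i j k
    using that assms by (metis image_subset_iff meet_idem)
  have lex: "lex_le \<kappa> (\<eta> i) (\<eta> j) \<longleftrightarrow> lex_le \<kappa> (\<nu> i) (\<nu> j)" if "i \<in> I" "j \<in> I" for i j
    using D[of "Rel LexD [Var 0, Var 1]" "\<lambda>v. \<eta> ([i, j] ! v)" "\<lambda>v. \<nu> ([i, j] ! v)"] that
    by (simp add: Ldelta_def antichain_struct_def numeral_eq_Suc) blast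
  show "psim ?S" unfolding psim_def using init lex assms by auto
next
  assume S: "psim ?S"
  have tm: "(val (antichain_struct \<kappa> X) e t, val (antichain_struct \<kappa> X) e' t) \<in> ?S"
    if "wf_tm Ldelta t" "\<forall>v\<in>vars_tm t. (e v, e' v) \<in> ?S" for e e' t
    using that by (cases t) (auto simp: Ldelta_def)
  have fm: "sat (antichain_struct \<kappa> X) e \<phi> \<longleftrightarrow> sat (antichain_struct \<kappa> X) e' \<phi>"
    if "qfree \<phi>" "wf_fm Ldelta \<phi>" "\<forall>v\<in>FV \<phi>. (e v, e' v) \<in> ?S" for \<phi> e e'
    using that
  proof (induction \<phi>)
    case (Eq s t)
    then show ?case using psim_functional[OF S tm[of s e e'] tm[of t e e']] by simp
  next
    case (Rel p ts)
    then have in_S: "(val (antichain_struct \<kappa> X) e (ts ! i), val (antichain_struct \<kappa> X) e' (ts ! i))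
      \<in> ?S"
      if "i < length ts" for i
      using that by (intro tm) auto
    show ?case
    proof (cases p)
      case Delta
      then have "length ts = 4" using Rel.prems by (simp add: Ldelta_def)
      then show ?thesis
        using psim_meet_le_meet[OF S in_S[of 0] in_S[of 1] in_S[of 2] in_S[of 3]] Delta
        by (simp add: antichain_struct_def)
    next
      case LexD
      then have "length ts = 2" using Rel.prems by (simp add: Ldelta_def)
      then show ?thesis
        using psimD(4)[OF S in_S[of 0] in_S[of 1]] LexD by (simp add: antichain_struct_def)
    qed
  qed auto
  show "sim_delta \<kappa> X I \<eta> \<nu>"
    unfolding sim_delta_def qftp_eq_iff
  proof (intro allI impI)
    fix \<phi> e e' assume "qfree \<phi>" "wf_fm Ldelta \<phi>" "\<forall>v\<in>FV \<phi>. \<exists>i\<in>I. e v = \<eta> i \<and> e' v = \<nu> i"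
    then show "sat (antichain_struct \<kappa> X) e \<phi> \<longleftrightarrow> sat (antichain_struct \<kappa> X) e' \<phi>"
      by (intro fm) auto
  qed
qed

text \<open>Finite relations are those enumerated by finite tuples; arbitrary ones follow through
  \<open>elem_pull_finitary\<close>. \<open>Q\<close> stands for either notion of
  similarity.\<close>

lemma indexed_iff_relational:
  assumes Q: "\<And>n \<eta> \<nu>. \<eta> ` {..<n} \<subseteq> X \<Longrightarrow> \<nu> ` {..<n} \<subseteq> X \<Longrightarrow> Q n \<eta> \<nu> \<longleftrightarrow> psim {(\<eta> i, \<nu> i) | i. i < n}"
  shows "(\<forall>(n::nat) \<eta> \<nu>. \<eta> ` {..<n} \<subseteq> X \<and> \<nu> ` {..<n} \<subseteq> X \<and> Q n \<eta> \<nu> \<longrightarrow>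
      elem L M (pull m a {(\<eta> i, \<nu> i) | i. i < n} \<union> Id_on B)) \<longleftrightarrow>
    (\<forall>S. S \<subseteq> X \<times> X \<longrightarrow> psim S \<longrightarrow> elem L M (pull m a S \<union> Id_on B))" (is "?l \<longleftrightarrow> ?r")
proof
  assume l: ?l
  show ?r
  proof (intro allI impI)
    fix S assume S: "S \<subseteq> X \<times> X" "psim S"
    show "elem L M (pull m a S \<union> Id_on B)"
    proof (rule elem_pull_finitary)
      fix S0 assume S0: "finite S0" "S0 \<subseteq> S"
      then obtain ps where ps: "set ps = S0" using finite_list by blast
      define \<eta> \<nu> where "\<eta> i = fst (ps ! i)" and "\<nu> i = snd (ps ! i)" for i
      have S0': "S0 = {(\<eta> i, \<nu> i) | i. i < length ps}"
        unfolding ps[symmetric] set_conv_nth \<eta>_def \<nu>_def by simp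
      have "\<eta> ` {..<length ps} \<subseteq> X" "\<nu> ` {..<length ps} \<subseteq> X" using S(1) S0(2) S0' by auto
      moreover have "Q (length ps) \<eta> \<nu>"
        using Q[OF calculation] psim_mono[OF S(2) S0(2)] S0' by simp
      ultimately show "elem L M (pull m a S0 \<union> Id_on B)" using l unfolding S0' by blast
    qed
  qed
next
  assume r: ?r
  show ?l
  proof (intro allI impI)
    fix n :: nat and \<eta> \<nu> assume a: "\<eta> ` {..<n} \<subseteq> X \<and> \<nu> ` {..<n} \<subseteq> X \<and> Q n \<eta> \<nu>"
    then have "psim {(\<eta> i, \<nu> i) | i. i < n}" using Q by blast
    moreover have "{(\<eta> i, \<nu> i) | i. i < n} \<subseteq> X \<times> X" using a by auto
    ultimately show "elem L M (pull m a {(\<eta> i, \<nu> i) | i. i < n} \<union> Id_on B)" using r by blast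
  qed
qed

lemma strongly_indiscernible_iff:
  "strongly_indiscernible L M \<kappa> m a C \<longleftrightarrow> (\<forall>S. psim S \<longrightarrow> elem L M (pull m a S \<union> Id_on C))"
proof -
  have "strongly_indiscernible L M \<kappa> m a C \<longleftrightarrow>
    (\<forall>S. S \<subseteq> T \<times> T \<longrightarrow> psim S \<longrightarrow> elem L M (pull m a S \<union> Id_on C))"
    unfolding strongly_indiscernible_def tuple_tp_eq_iff_elem
    by (rule indexed_iff_relational) (auto simp: sim0_iff_psim)
  then show ?thesis unfolding psim_def by blast
qed

lemma delta_indiscernible_iff:
  assumes "X \<subseteq> T"
  shows "delta_indiscernible L M \<kappa> X m a B \<longleftrightarrow>
    (\<forall>S. S \<subseteq> X \<times> X \<longrightarrow> psim S \<longrightarrow> elem L M (pull m a S \<union> Id_on B))"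
  unfolding delta_indiscernible_def tuple_tp_eq_iff_elem
  using assms
  by (intro indexed_iff_relational) (auto simp: sim_delta_iff_psim image_subset_iff subset_iff)

end

section \<open>A Ramsey theorem for finite antichains\<close>

lemma subseq_set_subset: "subseq xs ys \<Longrightarrow> set xs \<subseteq> set ys"
  by (auto simp: subseq_conv_nths dest: in_set_nthsD)

lemma sorted_wrt_subseq:
  assumes "subseq xs ys" "sorted_wrt P ys"
  shows "sorted_wrt P xs"
  using assms
proof (induction rule: list_emb.induct)
  case (list_emb_Cons2 x y xs ys)
  then show ?case using subseq_set_subset[of xs ys] by auto
qed auto

text \<open>The homogeneous set gets \<open>K\<close> elements too many. Its \<open>K\<close>
  largest elements are reserved for completing shorter increasing lists to length \<open>K\<close>,
  so that one colouring of lists of length \<open>K\<close> governs all shorter ones too.\<close>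

lemma ramsey_sorted_lists:
  fixes Cs :: "'c set"
  assumes fin: "finite Cs"
  obtains N where "\<And>\<chi> :: nat list \<Rightarrow> 'c.
    (\<And>xs. length xs = K \<Longrightarrow> set xs \<subseteq> {..<N} \<Longrightarrow> \<chi> xs \<in> Cs) \<Longrightarrow>
    \<exists>zs k. sorted_wrt (<) zs \<and> length zs = m \<and> set zs \<subseteq> {..<N} \<and> k \<in> Cs \<and>
      (\<forall>xs. sorted_wrt (<) xs \<and> set xs \<subseteq> set zs \<and> length xs \<le> K \<longrightarrow> (\<exists>ys. \<chi> (xs @ ys) = k))"
proof -
  obtain g where g: "bij_betw g Cs {..<card Cs}"
    using ex_bij_betw_finite_nat[OF fin] by (auto simp: lessThan_atLeast0)
  obtain N :: nat where N: "partn_lst {..<N} (replicate (card Cs) (m + K)) K"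
    using ramsey_full by blast
  show ?thesis
  proof (rule that[of N])
    fix \<chi> :: "nat list \<Rightarrow> 'c"
    assume \<chi>: "\<And>xs. length xs = K \<Longrightarrow> set xs \<subseteq> {..<N} \<Longrightarrow> \<chi> xs \<in> Cs"
    define f where "f A = g (\<chi> (sorted_list_of_set A))" for A
    have f: "f \<in> nsets {..<N} K \<rightarrow> {..<card Cs}"
    proof
      fix A assume A: "A \<in> nsets {..<N} K"
      then have "\<chi> (sorted_list_of_set A) \<in> Cs" by (intro \<chi>) (auto simp: nsets_def)
      then show "f A \<in> {..<card Cs}" using g unfolding f_def bij_betw_def by blast
    qed
    obtain i H where i: "i < card Cs" and "H \<in> nsets {..<N} (replicate (card Cs) (m + K) ! i)"
      and hom: "f ` nsets H K \<subseteq> {i}"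
      using partn_lstE[OF N f] by auto
    then have H: "H \<subseteq> {..<N}" "finite H" "card H = m + K" by (auto simp: nsets_def)
    define zs where "zs = sorted_list_of_set H"
    have zs: "sorted_wrt (<) zs" "set zs = H" "length zs = m + K"
      unfolding zs_def using H by auto
    have split: "sorted_wrt (<) (take m zs @ drop m zs)" using zs(1) by simp
    obtain k where k: "k \<in> Cs" "g k = i"
      using g i unfolding bij_betw_def by (metis imageE lessThan_iff)
    have "\<exists>ys. \<chi> (xs @ ys) = k" if xs: "sorted_wrt (<) xs" "set xs \<subseteq> set (take m zs)"
      "length xs \<le> K" for xs
    proof -
      define ys where "ys = take (K - length xs) (drop m zs)"
      have sub: "set ys \<subseteq> set (drop m zs)" unfolding ys_def by (rule set_take_subset)
      have len: "length (xs @ ys) = K" unfolding ys_def using zs(3) xs(3) by simp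
      have "sorted_wrt (<) ys" unfolding ys_def using zs(1) sorted_wrt_drop sorted_wrt_take by blast
      then have sorted: "sorted_wrt (<) (xs @ ys)"
        using split xs(1,2) sub unfolding sorted_wrt_append by blast
      have H': "set (xs @ ys) \<subseteq> H"
        using xs(2) sub set_take_subset[of m zs] set_drop_subset[of m zs] zs(2) by auto
      have dist: "distinct (xs @ ys)" using sorted strict_sorted_iff by blast
      then have "set (xs @ ys) \<in> nsets H K"
        using H' distinct_card[OF dist] len by (simp add: nsets_def)
      then have "f (set (xs @ ys)) = i" using hom by blast
      moreover have "sorted_list_of_set (set (xs @ ys)) = xs @ ys"
        using sorted_list_of_set.idem_if_sorted_distinct sorted strict_sorted_iff by blast
      ultimately have "g (\<chi> (xs @ ys)) = g k" unfolding f_def using k(2) by simp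
      moreover have "\<chi> (xs @ ys) \<in> Cs" using \<chi>[OF len] H' H(1) by blast
      ultimately show ?thesis using g k(1) unfolding bij_betw_def inj_on_def by blast
    qed
    moreover have "set (take m zs) \<subseteq> {..<N}" using zs(2) H(1) set_take_subset[of m zs] by blast
    moreover have "sorted_wrt (<) (take m zs)" using zs(1) sorted_wrt_take by blast
    ultimately show "\<exists>zs k. sorted_wrt (<) zs \<and> length zs = m \<and> set zs \<subseteq> {..<N} \<and> k \<in> Cs \<and>
      (\<forall>xs. sorted_wrt (<) xs \<and> set xs \<subseteq> set zs \<and> length xs \<le> K \<longrightarrow> (\<exists>ys. \<chi> (xs @ ys) = k))"
      using zs(3) k(1) by (intro exI[of _ "take m zs"] exI[of _ k]) simp
  qed
qed

text \<open>Branches of length \<open>h\<close> are produced in lexicographic order: the next branch leaves its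
  predecessor at the prescribed level and takes all its later entries from the supply \<open>xs\<close>. For an
  increasing supply, a sublist of branches is produced in the same way from a part of it, which
  reduces Ramsey statements about branches to Ramsey's theorem for finite sets of numbers.\<close>

fun gen :: "nat \<Rightarrow> 'a list \<Rightarrow> nat list \<Rightarrow> 'a list \<Rightarrow> 'a list list" where
  "gen h y [] xs = []"
| "gen h y (l # ls) xs = (take l y @ take (h - l) xs) # gen h (take l y @ take (h - l) xs)
  ls (drop (h - l) xs)"

definition need :: "nat \<Rightarrow> nat list \<Rightarrow> nat" where
  "need h ls = sum_list (map (\<lambda>l. h - l) ls)"

lemma need_simps [simp]: "need h [] = 0" "need h (l # ls) = (h - l) + need h ls"
  by (simp_all add: need_def)

lemma need_le: "need h ls \<le> h * length ls"
  by (induction ls) auto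

lemma length_gen [simp]: "length (gen h y ls xs) = length ls"
  by (induction ls arbitrary: y xs) auto

lemma gen_append: "need h ls \<le> length xs \<Longrightarrow> gen h y ls (xs @ ys) = gen h y ls xs"
proof (induction ls arbitrary: y xs)
  case (Cons l ls)
  then have "h - l \<le> length xs" "need h ls \<le> length (drop (h - l) xs)" by simp_all
  then show ?case using Cons.IH[of "drop (h - l) xs"] by simp
qed simp

text \<open>Deleting a branch keeps the form: what the next branch shared with it was either shared
  with the predecessor already, or consists of supply entries that can be credited to the next
  branch. The other entries of the deleted branch are dropped from the supply.\<close>

lemma gen_subseq:
  assumes "subseq zs (gen h y ls xs)" "need h ls \<le> length xs" "set ls \<subseteq> {..<h}"
    "ls \<noteq> [] \<Longrightarrow> hd ls \<le> length y"
  obtains ls' xs' where "zs = gen h y ls' xs'" "subseq xs' xs" "length xs' = need h ls'"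
    "set ls' \<subseteq> set ls" "ls' \<noteq> [] \<Longrightarrow> hd ls' \<le> hd ls"
proof -
  have "\<exists>ls' xs'. zs = gen h y ls' xs' \<and> subseq xs' xs \<and> length xs' = need h ls' \<and>
      set ls' \<subseteq> set ls \<and> (ls' \<noteq> [] \<longrightarrow> hd ls' \<le> hd ls)"
    using assms
  proof (induction ls arbitrary: y xs zs)
    case Nil
    then have "zs = gen h y [] [] \<and> subseq [] xs \<and> length [] = need h []" by simp
    then show ?case by fastforce
  next
    case (Cons l ls)
    define z where "z = take l y @ take (h - l) xs"
    have l: "l < h" "l \<le> length y" "h - l \<le> length xs" using Cons.prems by auto
    then have len_z: "length z = h" unfolding z_def by simp
    have xs: "xs = take (h - l) xs @ drop (h - l) xs" by simp
    have gen: "gen h y (l # ls) xs = z # gen h z ls (drop (h - l) xs)" by (simp add: z_def)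
    have IH: "\<exists>ls' xs'. zs' = gen h z ls' xs' \<and> subseq xs' (drop (h - l) xs) \<and>
      length xs' = need h ls' \<and>
      set ls' \<subseteq> set ls \<and> (ls' \<noteq> [] \<longrightarrow> hd ls' \<le> hd ls)"
      if "subseq zs' (gen h z ls (drop (h - l) xs))" for zs'
    proof (rule Cons.IH[OF that])
      show "need h ls \<le> length (drop (h - l) xs)" using Cons.prems by simp
      show "set ls \<subseteq> {..<h}" using Cons.prems by simp
      show "hd ls \<le> length z" if "ls \<noteq> []"
      proof -
        have "hd ls \<in> {..<h}" using Cons.prems(3) hd_in_set[OF that] by auto
        then show ?thesis using len_z by simp
      qed
    qed
    show ?case
    proof (cases "subseq zs (gen h z ls (drop (h - l) xs))")
      case False
      then obtain zs' where zs': "zs = z # zs'" "subseq zs' (gen h z ls (drop (h - l) xs))"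
        using Cons.prems(1) unfolding gen by (cases zs) (auto split: if_splits)
      obtain ls' xs' where IH': "zs' = gen h z ls' xs'" "subseq xs' (drop (h - l) xs)"
        "length xs' = need h ls'" "set ls' \<subseteq> set ls" using IH[OF zs'(2)] by blast
      have "subseq (take (h - l) xs @ xs') xs"
        by (subst (2) xs) (rule list_emb_append_mono[OF subseq_order.order_refl IH'(2)])
      moreover have "zs = gen h y (l # ls') (take (h - l) xs @ xs')"
        using l(3) unfolding zs'(1) IH'(1) by (simp add: z_def)
      ultimately show ?thesis using l(3) IH'(3,4)
        by (intro exI[of _ "l # ls'"] exI[of _ "take (h - l) xs @ xs'"]) auto
    next
      case True
      then obtain ls' xs' where IH': "zs = gen h z ls' xs'" "subseq xs' (drop (h - l) xs)"
        "length xs' = need h ls'" "set ls' \<subseteq> set ls" using IH by blast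
      have sub: "subseq xs' xs"
        using IH'(2) subseq_order.order_trans[OF _ suffix_imp_subseq[OF suffix_drop]] by blast
      show ?thesis
      proof (cases ls')
        case Nil
        then show ?thesis using IH' sub by (intro exI[of _ "[]"] exI[of _ xs']) simp
      next
        case (Cons l2 ls2)
        have l2: "l2 < h" using Cons.prems(3) IH'(4) Cons by (auto simp: subset_iff)
        show ?thesis
        proof (cases "l2 \<le> l")
          \<comment> \<open>The next branch leaves the deleted one no later than that one leaves
            \<open>y\<close>, so it can start from \<open>y\<close> directly, at its own
            level.\<close>
          case True
          then have "take l2 z = take l2 y" using l(2) unfolding z_def by simp
          then show ?thesis using IH' sub Cons True by (intro exI[of _ ls'] exI[of _ xs']) auto
        next
          case False
          \<comment> \<open>Here the deleted branch lends its entries at positions \<open>l\<close>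
            to \<open>l2 - 1\<close>. They are put in front of the supply, and the next branch
            leaves \<open>y\<close> at \<open>l\<close> instead of \<open>l2\<close>.\<close>
          define xs2 where "xs2 = take (l2 - l) xs @ xs'"
          have "take l2 z = take l y @ take (l2 - l) xs"
            using False l l2 unfolding z_def by (simp add: min_def)
          moreover have "take (h - l) xs2 = take (l2 - l) xs @ take (h - l2) xs'"
            "drop (h - l) xs2 = drop (h - l2) xs'"
            using False l l2 unfolding xs2_def by (simp_all add: min_def)
          ultimately have "zs = gen h y (l # ls2) xs2" unfolding IH'(1) Cons by simp
          moreover have "subseq xs2 xs"
          proof -
            have "subseq (take (l2 - l) xs) (take (h - l) xs)"
              using l2 by (intro prefix_imp_subseq)
                (metis diff_le_mono less_imp_le take_is_prefix min.absorb1 take_take)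
            then show ?thesis
              unfolding xs2_def by (subst (2) xs) (rule list_emb_append_mono[OF _ IH'(2)])
          qed
          moreover have "length xs2 = need h (l # ls2)"
            using IH'(3) False l l2 unfolding xs2_def Cons by simp
          ultimately show ?thesis using IH'(4) Cons
            by (intro exI[of _ "l # ls2"] exI[of _ xs2]) auto
        qed
      qed
    qed
  qed
  then show ?thesis using that by blast
qed

section \<open>Levels at which branches split\<close>

definition lvl :: "nat \<Rightarrow> nat list \<Rightarrow> nat list \<Rightarrow> bool" where
  "lvl p u v \<longleftrightarrow> p < length u \<and> p < length v \<and> take p u = take p v \<and> u ! p < v ! p"

lemma take_eq_take: "take p u = take p v \<Longrightarrow> q \<le> p \<Longrightarrow> take q u = take q v"
  by (metis min.absorb1 take_take)

lemma take_eq_nth: "take p u = take p v \<Longrightarrow> q < p \<Longrightarrow> u ! q = v ! q"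
  by (metis nth_take)

lemma lvl_trans:
  assumes "lvl p u v" "lvl q v w"
  shows "lvl (min p q) u w"
proof -
  consider "p < q" | "p = q" | "q < p" by linarith
  then show ?thesis
  proof cases
    case 1
    then show ?thesis
      using assms take_eq_take[of q v w p] take_eq_nth[of q v w p] unfolding lvl_def by simp
  next
    case 2
    then show ?thesis using assms unfolding lvl_def by simp
  next
    case 3
    then show ?thesis
      using assms take_eq_take[of p u v q] take_eq_nth[of p u v q] unfolding lvl_def by simp
  qed
qed

lemma lvl_unique:
  assumes "lvl p u v" "lvl q u v"
  shows "p = q"
proof (rule ccontr)
  assume "p \<noteq> q"
  then show False
    using assms take_eq_nth[of p u v q] take_eq_nth[of q u v p] unfolding lvl_def by force
qed

text \<open>The supply is increasing and lies above \<open>y\<close>, so each new entry exceeds all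
  entries used before. Hence at its prescribed level a branch has a larger entry than its
  predecessor: it splits exactly there, to the right.\<close>

lemma gen_levels:
  assumes "sorted_wrt (<) xs" "need h ls \<le> length xs" "set ls \<subseteq> {..<h}" "ls \<noteq> [] \<Longrightarrow> hd ls \<le> length y"
    "\<And>a b. a \<in> set y \<Longrightarrow> b \<in> set xs \<Longrightarrow> a < b"
  shows "Suc t < length ls \<Longrightarrow> lvl (ls ! Suc t) (gen h y ls xs ! t) (gen h y ls xs ! Suc t)"
    and "z \<in> set (gen h y ls xs) \<Longrightarrow> length z = h \<and> set z \<subseteq> set y \<union> set xs"
proof -
  have "(\<forall>t. Suc t < length ls \<longrightarrow> lvl (ls ! Suc t) (gen h y ls xs ! t) (gen h y ls xs ! Suc t)) \<and>
    (\<forall>z\<in>set (gen h y ls xs). length z = h \<and> set z \<subseteq> set y \<union> set xs)"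
    using assms
  proof (induction ls arbitrary: y xs)
    case (Cons l ls)
    define z where "z = take l y @ take (h - l) xs"
    have l: "l < h" "l \<le> length y" "h - l \<le> length xs" using Cons.prems by auto
    then have len_z: "length z = h" unfolding z_def by simp
    have gen: "gen h y (l # ls) xs = z # gen h z ls (drop (h - l) xs)" by (simp add: z_def)
    have set_z: "set z \<subseteq> set y \<union> set (take (h - l) xs)"
      unfolding z_def using set_take_subset[of l y] by auto
    have "sorted_wrt (<) (take (h - l) xs @ drop (h - l) xs)" using Cons.prems(1) by simp
    then have fresh: "a < b" if "a \<in> set z" "b \<in> set (drop (h - l) xs)" for a b
      using set_z that Cons.prems(5) set_drop_subset[of "h - l" xs]
      unfolding sorted_wrt_append by blast
    have IH: "(\<forall>t. Suc t < length ls \<longrightarrow> lvl (ls ! Suc t) (gen h z ls (drop (h - l) xs) ! t)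
      (gen h z ls (drop (h - l) xs) ! Suc t)) \<and>
      (\<forall>w\<in>set (gen h z ls (drop (h - l) xs)). length w = h \<and> set w \<subseteq> set z \<union> set (drop (h - l) xs))"
    proof (rule Cons.IH)
      show "sorted_wrt (<) (drop (h - l) xs)" using Cons.prems(1) sorted_wrt_drop by blast
      show "need h ls \<le> length (drop (h - l) xs)" using Cons.prems by simp
      show "set ls \<subseteq> {..<h}" using Cons.prems by simp
      show "hd ls \<le> length z" if "ls \<noteq> []"
      proof -
        have "hd ls \<in> {..<h}" using Cons.prems(3) hd_in_set[OF that] by auto
        then show ?thesis using len_z by simp
      qed
    qed (use fresh in blast)
    have head: "lvl (ls ! 0) z (gen h z ls (drop (h - l) xs) ! 0)" if ne: "ls \<noteq> []"
    proof -
      obtain l2 ls2 where ls: "ls = l2 # ls2" using ne by (cases ls) auto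
      have l2: "l2 < h" "h - l2 \<le> length (drop (h - l) xs)" using Cons.prems(2,3) ls by auto
      have "z ! l2 < drop (h - l) xs ! 0"
        by (rule fresh[OF nth_mem nth_mem]) (use l2 len_z in simp_all)
      then show ?thesis using l2 len_z unfolding ls lvl_def by (simp add: nth_append)
    qed
    have "lvl ((l # ls) ! Suc t) (gen h y (l # ls) xs ! t) (gen h y (l # ls) xs ! Suc t)"
      if "Suc t < length (l # ls)" for t
      using that head IH unfolding gen by (cases t) auto
    moreover have "length w = h \<and> set w \<subseteq> set y \<union> set xs" if "w \<in> set (gen h y (l # ls) xs)" for w
    proof -
      have z: "set z \<subseteq> set y \<union> set xs" using set_z set_take_subset[of "h - l" xs] by blast
      have "w = z \<or> length w = h \<and> set w \<subseteq> set z \<union> set (drop (h - l) xs)"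
        using that IH unfolding gen by auto
      then show ?thesis using z len_z set_drop_subset[of "h - l" xs] by blast
    qed
    ultimately show ?case by blast
  qed simp
  then show "Suc t < length ls \<Longrightarrow> lvl (ls ! Suc t) (gen h y ls xs ! t) (gen h y ls xs ! Suc t)"
    and "z \<in> set (gen h y ls xs) \<Longrightarrow> length z = h \<and> set z \<subseteq> set y \<union> set xs" by blast+
qed

section \<open>Homogeneous families of branches\<close>

definition same_order :: "nat list \<Rightarrow> nat list \<Rightarrow> bool" where
  "same_order r r' \<longleftrightarrow> length r = length r' \<and>
     (\<forall>i<length r. \<forall>j<length r. r ! i < r ! j \<longleftrightarrow> r' ! i < r' ! j)"

text \<open>The pattern \<open>k\<close> is \<open>r\<close> with each value replaced by its
  position in the sorted list of values. It depends on the comparisons between the entries alone, so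
  \<open>r'\<close> has the same pattern.\<close>

lemma same_order_common_pattern:
  assumes "same_order r r'"
  obtains k S S' where "r = map ((!) S) k" "r' = map ((!) S') k" "length S = length S'"
    "set k \<subseteq> {..<length S}" "sorted_wrt (<) S" "sorted_wrt (<) S'" "set S = set r" "set S' = set r'"
proof -
  define S where "S = sorted_list_of_set (set r)"
  have S: "sorted_wrt (<) S" "set S = set r" unfolding S_def by auto
  have len: "length r = length r'" using assms unfolding same_order_def by blast
  have ord: "r ! i < r ! j \<longleftrightarrow> r' ! i < r' ! j" if "i < length r" "j < length r" for i j
    using assms that unfolding same_order_def by blast
  define g where "g x = r' ! (SOME i. i < length r \<and> r ! i = x)" for x
  have g: "g (r ! i) = r' ! i" if "i < length r" for i
  proof -
    define j where "j = (SOME j. j < length r \<and> r ! j = r ! i)"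
    have j: "j < length r \<and> r ! j = r ! i"
      unfolding j_def by (rule someI[of _ i]) (use that in simp)
    then have "\<not> r' ! j < r' ! i" "\<not> r' ! i < r' ! j" using ord[of i j] ord[of j i] that by simp_all
    then show ?thesis unfolding g_def j_def[symmetric] by simp
  qed
  have "\<forall>i<length r. \<exists>k<length S. S ! k = r ! i" using S(2) by (metis in_set_conv_nth nth_mem)
  then obtain k where k: "\<And>i. i < length r \<Longrightarrow> k i < length S \<and> S ! k i = r ! i" by metis
  have "sorted_wrt (\<lambda>x y. g x < g y) S"
  proof (rule sorted_wrt_mono_rel[OF _ S(1)])
    fix x y assume "x \<in> set S" "y \<in> set S" "x < y"
    then show "g x < g y" using ord g unfolding S(2) in_set_conv_nth by auto
  qed
  then have "sorted_wrt (<) (map g S)" by (simp add: sorted_wrt_map)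
  moreover have "r = map ((!) S) (map k [0..<length r])" by (rule nth_equalityI) (use k in auto)
  moreover have "r' = map ((!) (map g S)) (map k [0..<length r])"
    by (rule nth_equalityI) (use k g len in auto)
  moreover have "set (map g S) = set r'"
  proof -
    have "set (map g S) = g ` set r" using S(2) by simp
    also have "\<dots> = (\<lambda>i. g (r ! i)) ` {..<length r}" by (force simp: in_set_conv_nth image_iff)
    also have "\<dots> = (\<lambda>i. r' ! i) ` {..<length r}" using g by (intro image_cong) auto
    also have "\<dots> = set r'" unfolding len by (auto simp: in_set_conv_nth image_iff)
    finally show ?thesis .
  qed
  moreover have "set (map k [0..<length r]) \<subseteq> {..<length S}" using k by auto
  ultimately show ?thesis using that[of S "map k [0..<length r]" "map g S"] S by simp
qed

text \<open>\<open>\<rho>\<close> prescribes the splitting levels of neighbours as ranks below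
  \<open>R\<close>, and \<open>\<Lambda>\<close> turns ranks into actual levels. The last clause
  says that the colour of a subfamily depends only on how the ranks of its own splitting levels are
  ordered.\<close>

definition homogeneous_branches ::
  "nat \<Rightarrow> nat \<Rightarrow> nat \<Rightarrow> (nat list list \<Rightarrow> 'c) \<Rightarrow> nat list \<Rightarrow> nat list list \<Rightarrow> (nat \<Rightarrow> nat) \<Rightarrow> bool" where
  "homogeneous_branches h B R c \<rho> zs \<Lambda> \<longleftrightarrow>
     length zs = Suc (length \<rho>) \<and> (\<forall>z\<in>set zs. length z = h \<and> set z \<subseteq> {..<B}) \<and>
     (\<forall>x y. x < y \<and> y < R \<longrightarrow> \<Lambda> x < \<Lambda> y) \<and>
     (\<forall>t<length \<rho>. lvl (\<Lambda> (\<rho> ! t)) (zs ! t) (zs ! Suc t)) \<and>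
     (\<forall>ys ys' r r'. subseq ys zs \<and> subseq ys' zs \<and> length ys = Suc (length r) \<and>
       length ys' = Suc (length r') \<and>
        set r \<subseteq> {..<R} \<and> set r' \<subseteq> {..<R} \<and>
        (\<forall>t<length r. lvl (\<Lambda> (r ! t)) (ys ! t) (ys ! Suc t)) \<and>
        (\<forall>t<length r'. lvl (\<Lambda> (r' ! t)) (ys' ! t) (ys' ! Suc t)) \<and>
        same_order r r' \<longrightarrow> c ys = c ys')"

lemma homogeneous_branchesD:
  assumes "homogeneous_branches h B R c \<rho> zs \<Lambda>"
  shows "length zs = Suc (length \<rho>)" "\<And>z. z \<in> set zs \<Longrightarrow> length z = h \<and> set z \<subseteq> {..<B}"
    "\<And>x y. x < y \<Longrightarrow> y < R \<Longrightarrow> \<Lambda> x < \<Lambda> y"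
    "\<And>t. t < length \<rho> \<Longrightarrow> lvl (\<Lambda> (\<rho> ! t)) (zs ! t) (zs ! Suc t)"
    "\<And>ys ys' r r'. subseq ys zs \<Longrightarrow> subseq ys' zs \<Longrightarrow> length ys = Suc (length r) \<Longrightarrow>
      length ys' = Suc (length r') \<Longrightarrow> set r \<subseteq> {..<R} \<Longrightarrow> set r' \<subseteq> {..<R} \<Longrightarrow>
      \<forall>t<length r. lvl (\<Lambda> (r ! t)) (ys ! t) (ys ! Suc t) \<Longrightarrow>
      \<forall>t<length r'. lvl (\<Lambda> (r' ! t)) (ys' ! t) (ys' ! Suc t) \<Longrightarrow>
      same_order r r' \<Longrightarrow> c ys = c ys'"
proof -
  note hb = assms[unfolded homogeneous_branches_def]
  note hom = hb[THEN conjunct2, THEN conjunct2, THEN conjunct2, THEN conjunct2, rule_format]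
  show "length zs = Suc (length \<rho>)" "\<And>z. z \<in> set zs \<Longrightarrow> length z = h \<and> set z \<subseteq> {..<B}"
    "\<And>x y. x < y \<Longrightarrow> y < R \<Longrightarrow> \<Lambda> x < \<Lambda> y"
    "\<And>t. t < length \<rho> \<Longrightarrow> lvl (\<Lambda> (\<rho> ! t)) (zs ! t) (zs ! Suc t)" using hb by simp_all
  show "c ys = c ys'" if "subseq ys zs" "subseq ys' zs" "length ys = Suc (length r)"
    "length ys' = Suc (length r')" "set r \<subseteq> {..<R}" "set r' \<subseteq> {..<R}"
    "\<forall>t<length r. lvl (\<Lambda> (r ! t)) (ys ! t) (ys ! Suc t)"
    "\<forall>t<length r'. lvl (\<Lambda> (r' ! t)) (ys' ! t) (ys' ! Suc t)" "same_order r r'" for ys ys' r r'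
    by (rule hom[where r = r and r' = r']) (intro conjI that)
qed

text \<open>Ramsey's theorem is used twice, and the bounds are fixed in the reverse order of use:
  the height must leave room for thinning out the levels, and \<open>B\<close> room for thinning out
  the entries for all level sequences of that height. The bounds are independent of
  \<open>c\<close>, because the branches are copied into a universal antichain before a colouring of
  them is available.\<close>

lemma ramsey_branches:
  fixes Cs :: "'c set"
  assumes fin: "finite Cs"
  obtains h B where "\<And>(c :: nat list list \<Rightarrow> 'c) \<rho>. (\<And>ys. c ys \<in> Cs) \<Longrightarrow> length \<rho> \<le> m \<Longrightarrow>
    set \<rho> \<subseteq> {..<R} \<Longrightarrow> \<exists>zs \<Lambda>. homogeneous_branches h B R c \<rho> zs \<Lambda>"
proof -
  define P where "P = {r. set r \<subseteq> {..<R} \<and> length r \<le> m}"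
  have "finite P" unfolding P_def by (rule finite_lists_length_le) simp
  then have finP: "finite (P \<rightarrow>\<^sub>E Cs)" using fin by (intro finite_PiE)
  obtain h0 where h0: "\<And>\<chi> :: nat list \<Rightarrow> nat list \<Rightarrow> 'c.
    (\<And>xs. length xs = R \<Longrightarrow> set xs \<subseteq> {..<h0} \<Longrightarrow> \<chi> xs \<in> P \<rightarrow>\<^sub>E Cs) \<Longrightarrow>
    \<exists>zs k. sorted_wrt (<) zs \<and> length zs = R \<and> set zs \<subseteq> {..<h0} \<and> k \<in> P \<rightarrow>\<^sub>E Cs \<and>
      (\<forall>xs. sorted_wrt (<) xs \<and> set xs \<subseteq> set zs \<and> length xs \<le> R \<longrightarrow> (\<exists>ys. \<chi> (xs @ ys) = k))"
    using ramsey_sorted_lists[OF finP, of R R] by blast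
  \<comment> \<open>The successor ensures that level \<open>0\<close>, where the first branch
    starts, lies below \<open>h\<close> even if \<open>h0 = 0\<close>.\<close>
  define h where "h = Suc h0"
  define Q where "Q = {ls. set ls \<subseteq> {..<h} \<and> length ls \<le> Suc m}"
  have "finite Q" unfolding Q_def by (rule finite_lists_length_le) simp
  then have finQ: "finite (Q \<rightarrow>\<^sub>E Cs)" using fin by (intro finite_PiE)
  \<comment> \<open>At most \<open>Suc m\<close> branches occur, each consuming at most
    \<open>h\<close> entries.\<close>
  define K where "K = h * Suc m"
  obtain B where B: "\<And>\<chi> :: nat list \<Rightarrow> nat list \<Rightarrow> 'c.
    (\<And>xs. length xs = K \<Longrightarrow> set xs \<subseteq> {..<B} \<Longrightarrow> \<chi> xs \<in> Q \<rightarrow>\<^sub>E Cs) \<Longrightarrow>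
    \<exists>zs k. sorted_wrt (<) zs \<and> length zs = K \<and> set zs \<subseteq> {..<B} \<and> k \<in> Q \<rightarrow>\<^sub>E Cs \<and>
      (\<forall>xs. sorted_wrt (<) xs \<and> set xs \<subseteq> set zs \<and> length xs \<le> K \<longrightarrow> (\<exists>ys. \<chi> (xs @ ys) = k))"
    using ramsey_sorted_lists[OF finQ, of K K] by blast
  show ?thesis
  proof (rule that[of h B])
    fix c :: "nat list list \<Rightarrow> 'c" and \<rho> :: "nat list"
    assume c: "\<And>ys. c ys \<in> Cs" and \<rho>: "length \<rho> \<le> m" "set \<rho> \<subseteq> {..<R}"
    \<comment> \<open>The colour of a supply lists the colours of all families generated from it,
      one for each level sequence.\<close>
    define \<chi>1 where "\<chi>1 xs = (\<lambda>ls\<in>Q. c (gen h [] ls xs))" for xs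
    have "\<exists>zs k. sorted_wrt (<) zs \<and> length zs = K \<and> set zs \<subseteq> {..<B} \<and> k \<in> Q \<rightarrow>\<^sub>E Cs \<and>
      (\<forall>xs. sorted_wrt (<) xs \<and> set xs \<subseteq> set zs \<and> length xs \<le> K \<longrightarrow> (\<exists>ys. \<chi>1 (xs @ ys) = k))"
      by (rule B) (auto simp: \<chi>1_def c)
    then obtain s1 k1 where s1: "sorted_wrt (<) s1" "length s1 = K" "set s1 \<subseteq> {..<B}"
      "k1 \<in> Q \<rightarrow>\<^sub>E Cs"
      "\<And>xs. sorted_wrt (<) xs \<Longrightarrow> set xs \<subseteq> set s1 \<Longrightarrow> length xs \<le> K \<Longrightarrow> \<exists>ys. \<chi>1 (xs @ ys) = k1" by blast
    \<comment> \<open>Now \<open>k1\<close> colours level sequences. The leading \<open>0\<close>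
      belongs to the first branch, which comes entirely from the supply.\<close>
    define \<chi>2 where "\<chi>2 as = (\<lambda>r\<in>P. k1 (0 # map ((!) as) r))" for as
    have "\<exists>zs k. sorted_wrt (<) zs \<and> length zs = R \<and> set zs \<subseteq> {..<h0} \<and> k \<in> P \<rightarrow>\<^sub>E Cs \<and>
      (\<forall>xs. sorted_wrt (<) xs \<and> set xs \<subseteq> set zs \<and> length xs \<le> R \<longrightarrow> (\<exists>ys. \<chi>2 (xs @ ys) = k))"
    proof (rule h0)
      fix as :: "nat list" assume as: "length as = R" "set as \<subseteq> {..<h0}"
      have "k1 (0 # map ((!) as) r) \<in> Cs" if "r \<in> P" for r
      proof -
        have "as ! x < h" if "x \<in> set r" for x
          using as \<open>r \<in> P\<close> that unfolding P_def h_def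
          by (metis (no_types, lifting) lessThan_iff less_SucI mem_Collect_eq nth_mem subsetD)
        then have "0 # map ((!) as) r \<in> Q" using that unfolding Q_def P_def by (auto simp: h_def)
        then show ?thesis using s1(4) by blast
      qed
      then show "\<chi>2 as \<in> P \<rightarrow>\<^sub>E Cs" unfolding \<chi>2_def by simp
    qed
    then obtain s2 k2 where s2: "sorted_wrt (<) s2" "length s2 = R" "set s2 \<subseteq> {..<h0}"
      "\<And>xs. sorted_wrt (<) xs \<Longrightarrow> set xs \<subseteq> set s2 \<Longrightarrow> length xs \<le> R \<Longrightarrow> \<exists>ys. \<chi>2 (xs @ ys) = k2" by blast
    define \<Lambda> where "\<Lambda> x = s2 ! x" for x
    have \<Lambda>_mono: "\<Lambda> x < \<Lambda> y" if "x < y" "y < R" for x y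
      unfolding \<Lambda>_def using sorted_wrt_nth_less[OF s2(1) that(1)] that(2) s2(2) by simp
    have \<Lambda>_in: "\<Lambda> x \<in> set s2" "\<Lambda> x < h" if "x < R" for x
    proof -
      show "\<Lambda> x \<in> set s2" unfolding \<Lambda>_def using that s2(2) by simp
      then have "\<Lambda> x < h0" using s2(3) by blast
      then show "\<Lambda> x < h" unfolding h_def by simp
    qed
    define zs where "zs = gen h [] (0 # map \<Lambda> \<rho>) s1"
    have ls: "set (0 # map \<Lambda> \<rho>) \<subseteq> {..<h}" using \<rho>(2) \<Lambda>_in(2) by (auto simp: h_def)
    have nd: "need h ls \<le> K" if "length ls \<le> Suc m" for ls
      using need_le[of h ls] mult_le_mono2[OF that, of h] unfolding K_def by linarith
    have nd1: "need h (0 # map \<Lambda> \<rho>) \<le> length s1" unfolding s1(2) using \<rho>(1) by (intro nd) simp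
    note levels = gen_levels[OF s1(1) nd1 ls, of "[]", folded zs_def, simplified]
    \<comment> \<open>A subfamily is generated from part of the supply by some level sequence. As
      splitting levels are unique, this sequence can only be \<open>0\<close> followed by the levels
      at which its neighbours split.\<close>
    have col: "c ys = k1 (0 # map \<Lambda> r)"
      if ys: "subseq ys zs" "length ys = Suc (length r)"
        "\<And>t. t < length r \<Longrightarrow> lvl (\<Lambda> (r ! t)) (ys ! t) (ys ! Suc t)" for ys r
    proof -
      obtain ls' xs' where g: "ys = gen h [] ls' xs'" "subseq xs' s1" "length xs' = need h ls'"
        "set ls' \<subseteq> set (0 # map \<Lambda> \<rho>)" "ls' \<noteq> [] \<Longrightarrow> hd ls' \<le> hd (0 # map \<Lambda> \<rho>)"
        using gen_subseq[OF ys(1)[unfolded zs_def] nd1 ls] by auto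
      have sorted: "sorted_wrt (<) xs'" using g(2) s1(1) sorted_wrt_subseq by blast
      have len: "length ls' = Suc (length r)" using g(1) ys(2) by simp
      have ls': "set ls' \<subseteq> {..<h}" using g(4) ls by blast
      have hd0: "hd ls' = 0" using g(5) len by force
      have "ls' = 0 # map \<Lambda> r"
      proof (rule nth_equalityI)
        fix t assume t: "t < length ls'"
        show "ls' ! t = (0 # map \<Lambda> r) ! t"
        proof (cases t)
          case 0
          then show ?thesis
            using hd0 len
            by (simp add: hd_conv_nth[symmetric] length_0_conv[symmetric] del: length_0_conv)
        next
          case (Suc t')
          have "lvl (ls' ! Suc t') (ys ! t') (ys ! Suc t')"
            unfolding g(1)
            using gen_levels(1)[OF sorted eq_imp_le[OF g(3)[symmetric]] ls', of "[]" t'] hd0 t Suc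
            by simp
          moreover have "lvl (\<Lambda> (r ! t')) (ys ! t') (ys ! Suc t')" using ys(3) t len Suc by simp
          ultimately show ?thesis using lvl_unique t len Suc by simp
        qed
      qed (use len in simp)
      moreover have "c ys = k1 ls'"
      proof -
        have "length ys \<le> length zs" using ys(1) list_emb_length by blast
        then have lm: "length ls' \<le> Suc m" using g(1) \<rho>(1) unfolding zs_def by simp
        then have "length xs' \<le> K" using g(3) nd by simp
        moreover have "set xs' \<subseteq> set s1" using g(2) subseq_set_subset by blast
        ultimately obtain e where e: "\<chi>1 (xs' @ e) = k1" using s1(5)[OF sorted] by blast
        have "ls' \<in> Q" unfolding Q_def using ls' lm by blast
        then have "k1 ls' = c (gen h [] ls' (xs' @ e))"
          using e unfolding \<chi>1_def by (metis restrict_apply')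
        then show ?thesis unfolding g(1) using gen_append[of h ls' xs'] g(3) by simp
      qed
      ultimately show ?thesis by simp
    qed
    \<comment> \<open>After thinning out the levels, the colour depends on the positions
      \<open>k\<close> and no longer on the increasing list \<open>S\<close> of ranks.\<close>
    have pat: "k1 (0 # map \<Lambda> (map ((!) S) k)) = k2 k"
      if "set k \<subseteq> {..<length S}" "sorted_wrt (<) S" "set S \<subseteq> {..<R}" "length k \<le> m" for S k
    proof -
      have "distinct S" using that(2) strict_sorted_iff by blast
      then have lenS: "length S \<le> R" using card_mono[OF _ that(3)] distinct_card[of S] by simp
      have "sorted_wrt (\<lambda>x y. \<Lambda> x < \<Lambda> y) S"
        by (rule sorted_wrt_mono_rel[OF _ that(2)]) (use \<Lambda>_mono that(3) in auto)
      then have "sorted_wrt (<) (map \<Lambda> S)" by (simp add: sorted_wrt_map)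
      moreover have "set (map \<Lambda> S) \<subseteq> set s2" using that(3) \<Lambda>_in(1) by auto
      ultimately obtain e where e: "\<chi>2 (map \<Lambda> S @ e) = k2" using s2(4) lenS by fastforce
      have "k \<in> P" unfolding P_def using that(1,4) lenS by auto
      then have "k2 k = k1 (0 # map ((!) (map \<Lambda> S @ e)) k)"
        using e unfolding \<chi>2_def by (metis restrict_apply')
      moreover have "map ((!) (map \<Lambda> S @ e)) k = map \<Lambda> (map ((!) S) k)"
        using that(1) by (auto simp: nth_append subset_iff)
      ultimately show ?thesis by simp
    qed
    have hom: "c ys = c ys'"
      if "subseq ys zs" "subseq ys' zs" "length ys = Suc (length r)" "length ys' = Suc (length r')"
        "set r \<subseteq> {..<R}" "set r' \<subseteq> {..<R}" "\<forall>t<length r. lvl (\<Lambda> (r ! t)) (ys ! t) (ys ! Suc t)"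
        "\<forall>t<length r'. lvl (\<Lambda> (r' ! t)) (ys' ! t) (ys' ! Suc t)" "same_order r r'" for ys ys' r r'
    proof -
      obtain k S S' where k: "r = map ((!) S) k" "r' = map ((!) S') k" "length S = length S'"
        "set k \<subseteq> {..<length S}" "sorted_wrt (<) S" "sorted_wrt (<) S'" "set S = set r"
          "set S' = set r'"
        by (rule same_order_common_pattern[OF \<open>same_order r r'\<close>]) (rule that)
      have "length ys \<le> length zs" using that(1) list_emb_length by blast
      then have "length k \<le> m" using that(3) k(1) \<rho>(1) unfolding zs_def by simp
      then have "k1 (0 # map \<Lambda> r) = k2 k" "k1 (0 # map \<Lambda> r') = k2 k"
        using pat[of k S] pat[of k S'] k that(5,6) by simp_all
      then show ?thesis using col[of ys r] col[of ys' r'] that by simp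
    qed
    show "\<exists>zs \<Lambda>. homogeneous_branches h B R c \<rho> zs \<Lambda>"
      unfolding homogeneous_branches_def
    proof (rule exI[of _ zs], rule exI[of _ \<Lambda>], intro conjI allI impI; (elim conjE)?)
      show "length zs = Suc (length \<rho>)" unfolding zs_def by simp
      show "\<forall>z\<in>set zs. length z = h \<and> set z \<subseteq> {..<B}" using levels(2) s1(3) by blast
      show "lvl (\<Lambda> (\<rho> ! t)) (zs ! t) (zs ! Suc t)" if "t < length \<rho>" for t
        using levels(1) that by simp
    qed (rule \<Lambda>_mono hom; assumption)+
  qed
qed

section \<open>Finite sequences as nodes of the tree\<close>

locale card_tree =
  fixes \<kappa> :: "'k rel"
  assumes card: "Card_order \<kappa>" and inf: "\<not> finite (Field \<kappa>)"
begin

sublocale node_tree \<kappa>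
  using card by unfold_locales (rule card_order_on_well_order_on)

definition ordinal :: "nat \<Rightarrow> 'k" where
  "ordinal = (SOME f. embed natLeq \<kappa> f)"

lemma embed_ordinal: "embed natLeq \<kappa> ordinal"
proof -
  have "natLeq \<le>o |Field \<kappa>|" using inf infinite_iff_natLeq_ordLeq by blast
  then have "natLeq \<le>o \<kappa>" using card_of_Field_ordIso[OF card] ordLeq_ordIso_trans by blast
  then show ?thesis unfolding ordinal_def ordLeq_def by (auto intro: someI[of "embed natLeq \<kappa>"])
qed

lemma underS_ordinal: "underS \<kappa> (ordinal n) = ordinal ` {..<n}"
  using embed_underS[OF natLeq_Well_order embed_ordinal, of n] unfolding bij_betw_def
  by (simp add: Field_natLeq natLeq_underS_less lessThan_def)

lemma ordinal_Field: "ordinal n \<in> Field \<kappa>"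
  using embed_Field[OF embed_ordinal] by (auto simp: Field_natLeq)

lemma inj_ordinal: "inj ordinal"
  using embed_inj_on[OF natLeq_Well_order embed_ordinal] by (simp add: Field_natLeq)

definition node :: "nat list \<Rightarrow> 'k node" where
  "node z \<gamma> = (if \<gamma> \<in> ordinal ` {..<length z} then Some (z ! inv ordinal \<gamma>) else None)"

lemma node_ordinal: "node z (ordinal i) = (if i < length z then Some (z ! i) else None)"
  unfolding node_def using inj_ordinal by (auto simp: inj_def image_iff)

lemma node_tree: "node z \<in> T"
proof -
  have "dom (node z) = underS \<kappa> (ordinal (length z))"
    unfolding underS_ordinal node_def by (auto split: if_splits)
  then show ?thesis unfolding tree_def using ordinal_Field by blast
qed

lemma lt_at_node:
  assumes "lvl p u v"
  shows "lt_at (ordinal p) (node u) (node v)"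
proof -
  have p: "p < length u" "p < length v" "take p u = take p v" "u ! p < v ! p"
    using assms unfolding lvl_def by blast+
  have "node u (ordinal i) = node v (ordinal i)" if "i < p" for i
    using take_eq_nth[OF p(3) that] p(1,2) that unfolding node_ordinal by simp
  then have "\<forall>\<beta>\<in>underS \<kappa> (ordinal p). node u \<beta> = node v \<beta>" unfolding underS_ordinal by auto
  moreover have "node u (ordinal p) = Some (u ! p)" "node v (ordinal p) = Some (v ! p)"
    unfolding node_ordinal using p by auto
  ultimately show ?thesis using p(4) ordinal_Field unfolding lt_at_def by blast
qed

lemma lvl_cases:
  assumes "length u = length v" "u \<noteq> v"
  obtains p where "lvl p u v \<or> lvl p v u"
proof -
  define P where "P p \<longleftrightarrow> p < length u \<and> u ! p \<noteq> v ! p" for p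
  define p where "p = (LEAST p. P p)"
  have "\<exists>p. P p" using assms nth_equalityI[of u v] unfolding P_def by blast
  then have p: "P p" unfolding p_def by (rule LeastI_ex)
  have "\<not> P q" if "q < p" for q using that not_less_Least unfolding p_def by blast
  then have "take p u = take p v" using p assms(1) unfolding P_def by (intro nth_take_lemma) auto
  then have "lvl p u v \<or> lvl p v u" using p assms(1) unfolding lvl_def P_def by (simp add: neq_iff)
  then show ?thesis using that by blast
qed

lemma antichain_le_iff: "antichain \<kappa> Y \<Longrightarrow> u \<in> Y \<Longrightarrow> v \<in> Y \<Longrightarrow> u \<subseteq>\<^sub>m v \<longleftrightarrow> u = v"
  unfolding antichain_def perp_def by auto

lemma antichain_lex_le_iff:
  assumes "antichain \<kappa> Y" "u \<in> Y" "v \<in> Y"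
  shows "lex_le \<kappa> u v \<longleftrightarrow> u = v \<or> lt u v"
  using assms antichain_le_iff[OF assms] lex_le_iff[of u v] unfolding antichain_def by blast

lemma antichain_lt_cases:
  assumes "antichain \<kappa> Y" "u \<in> Y" "v \<in> Y" "u \<noteq> v"
  shows "lt u v \<or> lt v u"
  using assms perp_lt_cases[of u v] unfolding antichain_def by blast

lemma ex_lt_sorted_list:
  assumes "finite Y" "antichain \<kappa> Y"
  shows "\<exists>ys. sorted_wrt lt ys \<and> set ys = Y"
  using assms
proof (induction Y rule: finite_induct)
  case (insert x Y)
  then have "antichain \<kappa> Y" unfolding antichain_def by blast
  then obtain ys where ys: "sorted_wrt lt ys" "set ys = Y" using insert.IH by blast
  have cases: "lt x y \<or> lt y x" if "y \<in> Y" for y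
    using antichain_lt_cases[OF insert.prems, of x y] that insert.hyps(2) by blast
  define zs where "zs = filter (\<lambda>y. lt y x) ys @ x # filter (\<lambda>y. lt x y) ys"
  have "sorted_wrt lt zs"
    unfolding zs_def using ys(1) lt_trans by (auto simp: sorted_wrt_append sorted_wrt_filter)
  moreover have "set zs = insert x Y" unfolding zs_def using cases ys(2) by auto
  ultimately show ?case by blast
qed simp

lemma sorted_wrt_lt_nth_iff:
  assumes "sorted_wrt lt ys" "i < length ys" "j < length ys"
  shows "lt (ys ! i) (ys ! j) \<longleftrightarrow> i < j"
proof
  assume l: "lt (ys ! i) (ys ! j)"
  show "i < j"
  proof (rule ccontr)
    assume "\<not> i < j"
    then have "i = j \<or> lt (ys ! j) (ys ! i)"
      using sorted_wrt_nth_less[OF assms(1), of j i] assms(2) by fastforce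
    then show False using l lt_irrefl lt_trans by blast
  qed
qed (use sorted_wrt_nth_less[OF assms(1)] assms in blast)

text \<open>For the set \<open>W\<close> of meets of an antichain these positions in the
  lexicographic enumeration are the ranks fed to \<open>ramsey_branches\<close>, with
  \<open>R = card W\<close>.\<close>

definition lex_rank :: "'k node set \<Rightarrow> 'k node \<Rightarrow> nat" where
  "lex_rank W u = card {v \<in> W. v \<noteq> u \<and> lex_le \<kappa> v u}"

lemma lex_rank_less:
  assumes "finite W" "W \<subseteq> T" "u \<in> W"
  shows "lex_rank W u < card W"
  unfolding lex_rank_def using assms by (intro psubset_card_mono) auto

lemma lex_rank_strict_mono:
  assumes "finite W" "W \<subseteq> T" "u \<in> W" "v \<in> W" "lex_le \<kappa> u v" "u \<noteq> v"
  shows "lex_rank W u < lex_rank W v"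
  unfolding lex_rank_def
proof (rule psubset_card_mono)
  have T: "u \<in> T" "v \<in> T" using assms by auto
  have "w \<noteq> v \<and> lex_le \<kappa> w v" if "w \<in> W" "w \<noteq> u" "lex_le \<kappa> w u" for w
    using that assms(2,5) T lex_le_trans[of w u v] lex_le_antisym[of u w] by blast
  moreover have "u \<in> {w \<in> W. w \<noteq> v \<and> lex_le \<kappa> w v}" using assms by blast
  ultimately show "{w \<in> W. w \<noteq> u \<and> lex_le \<kappa> w u} \<subset> {w \<in> W. w \<noteq> v \<and> lex_le \<kappa> w v}" by blast
qed (use assms in simp)

lemma lex_rank_less_iff:
  assumes "finite W" "W \<subseteq> T" "u \<in> W" "v \<in> W"
  shows "lex_rank W u < lex_rank W v \<longleftrightarrow> \<not> lex_le \<kappa> v u"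
proof -
  have T: "u \<in> T" "v \<in> T" using assms by auto
  consider "u = v" | "u \<noteq> v" "lex_le \<kappa> u v" | "u \<noteq> v" "lex_le \<kappa> v u"
    using lex_le_total[OF T] by blast
  then show ?thesis
  proof cases
    case 1
    then show ?thesis using lex_le_refl by simp
  next
    case 2
    then show ?thesis using lex_rank_strict_mono[OF assms 2(2,1)] lex_le_antisym[OF T] by blast
  next
    case 3
    then show ?thesis using lex_rank_strict_mono[OF assms(1,2,4,3) 3(2)] by fastforce
  qed
qed

lemma universal_antichain_copy:
  assumes "universal_antichain \<kappa> X" "finite Z" "antichain \<kappa> Z"
  obtains g where "g ` Z \<subseteq> X" "psim {(z, g z) | z. z \<in> Z}"
proof -
  obtain X0 g where g: "X0 \<subseteq> X" "bij_betw g Z X0" "sim0 \<kappa> Z id g"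
    using assms unfolding universal_antichain_def by blast
  have "g ` Z \<subseteq> X" using g unfolding bij_betw_def by blast
  moreover have "Z \<subseteq> T" "X \<subseteq> T"
    using assms unfolding antichain_def universal_antichain_def by blast+
  ultimately have "psim {(id z, g z) | z. z \<in> Z}"
    using g(3) sim0_iff_psim[of id Z g] by auto
  then show ?thesis using that \<open>g ` Z \<subseteq> X\<close> by simp
qed

text \<open>The lexicographic order is a linear order of the meets that extends \<open>\<unlhd>\<close>, and meets below a common
  node are \<open>\<unlhd>\<close>-comparable. So their inclusions can be read off their lexicographic positions, along
  which the levels may therefore be chosen.\<close>

lemma psim_by_levels:
  assumes Y: "finite Y" "antichain \<kappa> Y" and W: "W = (\<lambda>(u, v). meet \<kappa> u v) ` (Y \<times> Y)"
    and \<Lambda>: "\<And>x y. x < y \<Longrightarrow> y < card W \<Longrightarrow> \<Lambda> x < \<Lambda> y"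
    and E: "E ` Y \<subseteq> T"
    and lev: "\<And>u v. u \<in> Y \<Longrightarrow> v \<in> Y \<Longrightarrow> lt u v \<Longrightarrow> lt_at (ordinal (\<Lambda> (lex_rank W (meet \<kappa> u v)))) (E u)
      (E v)"
  shows "psim {(y, E y) | y. y \<in> Y}"
proof -
  have YT: "Y \<subseteq> T" using Y(2) unfolding antichain_def by blast
  have W': "finite W" "W \<subseteq> T" using Y(1) YT meet_tree unfolding W by auto
  have inW: "meet \<kappa> u v \<in> W" if "u \<in> Y" "v \<in> Y" for u v using that unfolding W by blast
  define lv where "lv u v = \<Lambda> (lex_rank W (meet \<kappa> u v))" for u v
  have E_meet: "meet \<kappa> (E u) (E v) = E u |` underS \<kappa> (ordinal (lv u v)) \<and>
    E u (ordinal (lv u v)) \<noteq> E v (ordinal (lv u v))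
      \<and> (\<forall>\<beta>\<in>underS \<kappa> (ordinal (lv u v)). E u \<beta> = E v \<beta>)
      \<and> dom (meet \<kappa> (E u) (E v)) = underS \<kappa> (ordinal (lv u v))"
    if uv: "u \<in> Y" "v \<in> Y" "u \<noteq> v" for u v
  proof -
    have T: "E u \<in> T" "E v \<in> T" using E uv by auto
    consider "lt u v" | "lt v u" using antichain_lt_cases[OF Y(2) uv] by blast
    then show ?thesis
    proof cases
      case 1
      then have l: "lt_at (ordinal (lv u v)) (E u) (E v)"
        using lev[OF uv(1,2)] unfolding lv_def by blast
      show ?thesis using lt_at_meet(1,3)[OF l T] l unfolding lt_at_def by force
    next
      case 2
      have "lv v u = lv u v" unfolding lv_def using meet_commute YT uv by (metis subsetD)
      then have l: "lt_at (ordinal (lv u v)) (E v) (E u)"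
        using lev[OF uv(2,1)] 2 unfolding lv_def by simp
      have eq: "E v \<beta> = E u \<beta>" if "\<beta> \<in> underS \<kappa> (ordinal (lv u v))" for \<beta>
        using l that unfolding lt_at_def by blast
      have "E v |` underS \<kappa> (ordinal (lv u v)) = E u |` underS \<kappa> (ordinal (lv u v))"
        using eq by (auto simp: restrict_map_def)
      then show ?thesis using lt_at_meet(2,4)[OF l T(2,1)] l eq unfolding lt_at_def by force
    qed
  qed
  have E_inj: "E u \<subseteq>\<^sub>m E v \<longleftrightarrow> u = v" if "u \<in> Y" "v \<in> Y" for u v
  proof
    assume "E u \<subseteq>\<^sub>m E v"
    then show "u = v"
      using antichain_lt_cases[OF Y(2) that] lev[OF that] lev[OF that(2,1)] lt_at_perp
      unfolding perp_def by blast
  qed simp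
  \<comment> \<open>Two meets of the same node \<open>u\<close> are initial segments of it, so
    inclusion and lexicographic order agree on them.\<close>
  have lv_le: "lv u v \<le> lv u w \<longleftrightarrow> meet \<kappa> u v \<subseteq>\<^sub>m meet \<kappa> u w" if "u \<in> Y" "v \<in> Y" "w \<in> Y" for u v w
  proof -
    have T: "u \<in> T" "v \<in> T" "w \<in> T" "meet \<kappa> u v \<in> T" "meet \<kappa> u w \<in> T"
      using that YT meet_tree by auto
    have c: "meet \<kappa> u v \<subseteq>\<^sub>m meet \<kappa> u w \<or> meet \<kappa> u w \<subseteq>\<^sub>m meet \<kappa> u v"
      using comparable[OF T(4,5)] meet_le1 T by blast
    have less: "lex_rank W (meet \<kappa> u v') < card W" if "v' \<in> Y" for v'
      using lex_rank_less[OF W' inW[OF \<open>u \<in> Y\<close> that]] .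
    have mono: "lex_rank W (meet \<kappa> u v') < lex_rank W (meet \<kappa> u w') \<Longrightarrow> lv u v' < lv u w'"
      if "v' \<in> Y" "w' \<in> Y" for v' w' using \<Lambda> less that unfolding lv_def by blast
    show ?thesis
    proof (cases "meet \<kappa> u v = meet \<kappa> u w")
      case False
      show ?thesis
      proof (cases "meet \<kappa> u v \<subseteq>\<^sub>m meet \<kappa> u w")
        case True
        then have "lex_rank W (meet \<kappa> u v) < lex_rank W (meet \<kappa> u w)"
          using lex_rank_strict_mono[OF W' inW inW] that False lex_le_iff[OF T(4,5)] by blast
        then show ?thesis using True mono[OF that(2,3)] by simp
      next
        case nle: False
        then have "lex_rank W (meet \<kappa> u w) < lex_rank W (meet \<kappa> u v)"
          using lex_rank_strict_mono[OF W' inW inW] that False lex_le_iff[OF T(5,4)] c by metis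
        then show ?thesis using nle mono[OF that(3,2)] by simp
      qed
    qed (simp add: lv_def)
  qed
  \<comment> \<open>When \<open>u\<close> differs from \<open>v\<close> and \<open>w\<close>, the
    meet of \<open>u\<close> and \<open>v\<close> lies below \<open>w\<close> iff \<open>u\<close>
    splits from \<open>v\<close> no later than from \<open>w\<close>.\<close>
  have ternary: "meet \<kappa> u v \<subseteq>\<^sub>m w \<longleftrightarrow> meet \<kappa> (E u) (E v) \<subseteq>\<^sub>m E w" if "u \<in> Y" "v \<in> Y" "w \<in> Y" for u v w
  proof -
    have T: "u \<in> T" "v \<in> T" "w \<in> T" "E u \<in> T" "E v \<in> T" "E w \<in> T" using that YT E by auto
    show ?thesis
    proof (cases "u = v \<or> u = w")
      case True
      then show ?thesis
        using meet_idem T meet_le1 antichain_le_iff[OF Y(2)] E_inj that by metis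
    next
      case False
      note uv = E_meet[OF that(1,2)] and uw = E_meet[OF that(1,3)]
      have "meet \<kappa> (E u) (E v) \<subseteq>\<^sub>m E w \<longleftrightarrow> lv u v \<le> lv u w"
      proof
        assume s: "meet \<kappa> (E u) (E v) \<subseteq>\<^sub>m E w"
        show "lv u v \<le> lv u w"
        proof (rule ccontr)
          assume "\<not> ?thesis"
          then have in_u: "ordinal (lv u w) \<in> underS \<kappa> (ordinal (lv u v))"
            unfolding underS_ordinal by simp
          then have "meet \<kappa> (E u) (E v) (ordinal (lv u w)) = E w (ordinal (lv u w))"
            using s uv False unfolding map_le_def by blast
          moreover have "meet \<kappa> (E u) (E v) (ordinal (lv u w)) = E u (ordinal (lv u w))"
            using uv False in_u by simp
          ultimately show False using uw False by simp
        qed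
      next
        assume "lv u v \<le> lv u w"
        then have "underS \<kappa> (ordinal (lv u v)) \<subseteq> underS \<kappa> (ordinal (lv u w))"
          unfolding underS_ordinal by auto
        then show "meet \<kappa> (E u) (E v) \<subseteq>\<^sub>m E w"
          using uv uw False unfolding map_le_def by (metis restrict_in subsetD)
      qed
      then show ?thesis
        using lv_le[OF that] meet_le_meet_iff[OF T(1,2,1,3)] meet_le1[OF T(1,2)] by blast
    qed
  qed
  have lex: "lex_le \<kappa> u v \<longleftrightarrow> lex_le \<kappa> (E u) (E v)" if "u \<in> Y" "v \<in> Y" for u v
  proof -
    have T: "E u \<in> T" "E v \<in> T" using that E by auto
    have "lt u v \<Longrightarrow> lt (E u) (E v)" "lt v u \<Longrightarrow> lt (E v) (E u)"
      using lev that unfolding lt_def by blast+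
    then show ?thesis
      using antichain_lex_le_iff[OF Y(2) that] antichain_lt_cases[OF Y(2) that] lex_le_iff[OF T]
        E_inj[OF that]
        lt_trans lt_irrefl by metis
  qed
  show ?thesis by (rule psimI) (use YT E ternary lex in auto)
qed

text \<open>Take branches whose neighbours split at levels ranked like the meets of neighbours in
  \<open>Y\<close>, and pull \<open>c\<close> back along a copy of the branches in \<open>X\<close>.
  For sorted tuples the order of the ranks is part of the \<delta>-type, and by homogeneity it
  decides the colour.\<close>

lemma ramsey_antichain:
  fixes c :: "'k node list \<Rightarrow> 'c"
  assumes X: "universal_antichain \<kappa> X" and Y: "finite Y" "antichain \<kappa> Y"
    and c: "finite Cs" "\<And>ys. c ys \<in> Cs"
  obtains f where "f ` Y \<subseteq> X" "psim {(y, f y) | y. y \<in> Y}"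
    "\<And>ys ys'. sorted_wrt lt ys \<Longrightarrow> sorted_wrt lt ys' \<Longrightarrow> set ys \<subseteq> Y \<Longrightarrow> set ys' \<subseteq> Y \<Longrightarrow>
      length ys = length ys' \<Longrightarrow> psim (set (zip ys ys')) \<Longrightarrow> c (map f ys) = c (map f ys')"
proof (cases "Y = {}")
  case True
  show ?thesis by (rule that[of id]) (use True in \<open>auto simp: psim_def\<close>)
next
  case False
  have YT: "Y \<subseteq> T" using Y(2) unfolding antichain_def by blast
  define W where "W = (\<lambda>(u, v). meet \<kappa> u v) ` (Y \<times> Y)"
  have W: "finite W" "W \<subseteq> T" using Y(1) YT meet_tree unfolding W_def by auto
  have inW: "meet \<kappa> u v \<in> W" if "u \<in> Y" "v \<in> Y" for u v using that unfolding W_def by blast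
  obtain yl where yl: "sorted_wrt lt yl" "set yl = Y" using ex_lt_sorted_list[OF Y] by blast
  define n where "n = length yl - 1"
  have len_yl: "length yl = Suc n" using False yl(2) unfolding n_def by (cases yl) auto
  have ylY: "yl ! i \<in> Y" if "i \<le> n" for i using that len_yl yl(2) nth_mem[of i yl] by simp
  define rk where "rk ys t = lex_rank W (meet \<kappa> (ys ! t) (ys ! Suc t))" for ys t
  define rks where "rks ys = map (rk ys) [0..<length ys - 1]" for ys
  have rks: "length (rks ys) = length ys - 1" "\<And>t. t < length ys - 1 \<Longrightarrow> rks ys ! t = rk ys t" for ys
    unfolding rks_def by auto
  have rks_less: "set (rks ys) \<subseteq> {..<card W}" if "set ys \<subseteq> Y" for ys
  proof -
    have "rk ys t < card W" if "t < length ys - 1" for t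
      unfolding rk_def using \<open>set ys \<subseteq> Y\<close> that nth_mem[of t ys] nth_mem[of "Suc t" ys]
      by (intro lex_rank_less[OF W] inW) auto
    then show ?thesis unfolding rks_def by auto
  qed
  obtain h B where hB: "\<And>(c :: nat list list \<Rightarrow> 'c) \<rho>. (\<And>ys. c ys \<in> Cs) \<Longrightarrow> length \<rho> \<le> n \<Longrightarrow>
      set \<rho> \<subseteq> {..<card W} \<Longrightarrow> \<exists>zs \<Lambda>. homogeneous_branches h B (card W) c \<rho> zs \<Lambda>"
    using ramsey_branches[OF c(1), of n "card W"] by metis
  \<comment> \<open>All branches that can occur are copied into \<open>X\<close> together; the
    colouring of branches is defined through this copy.\<close>
  define Z where "Z = node ` {z. set z \<subseteq> {..<B} \<and> length z = h}"
  have "finite Z" unfolding Z_def by (intro finite_imageI finite_lists_length_eq) simp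
  moreover have "antichain \<kappa> Z"
    unfolding antichain_def
  proof (intro conjI ballI impI)
    show "Z \<subseteq> T" unfolding Z_def using node_tree by blast
    fix a b assume ab: "a \<in> Z" "b \<in> Z" "a \<noteq> b"
    then obtain u v where uv: "a = node u" "b = node v" "length u = length v"
      unfolding Z_def by auto
    then have uv: "a = node u" "b = node v" "length u = length v" "u \<noteq> v" using ab(3) by auto
    then show "perp a b" using lvl_cases[OF uv(3,4)] lt_at_node lt_at_perp perp_commute by metis
  qed
  ultimately obtain g where g: "g ` Z \<subseteq> X" "psim {(z, g z) | z. z \<in> Z}"
    using universal_antichain_copy[OF X] by blast
  have "\<exists>zs \<Lambda>. homogeneous_branches h B (card W) (\<lambda>ys. c (map (\<lambda>z. g (node z)) ys)) (rks yl) zs \<Lambda>"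
    by (rule hB) (use c(2) rks rks_less[of yl] yl(2) len_yl in auto)
  then obtain zs \<Lambda> where
    branches: "homogeneous_branches h B (card W) (\<lambda>ys. c (map (\<lambda>z. g (node z)) ys)) (rks yl) zs \<Lambda>"
      by blast
  note zs = homogeneous_branchesD(1-4)[OF branches] and hom = homogeneous_branchesD(5)[OF branches]
  have len_rks: "length (rks yl) = n" using rks(1)[of yl] len_yl by simp
  have zs4: "lvl (\<Lambda> (rk yl t)) (zs ! t) (zs ! Suc t)" if "t < n" for t
    using zs(4)[of t] rks(2)[of t yl] that len_rks len_yl by simp
  \<comment> \<open>The levels are prescribed for neighbours. For other pairs
    \<open>lvl_trans\<close> gives the minimum of two levels and \<open>meet_between\<close> the
    shorter of two meets; these match, since ranks and \<open>\<Lambda>\<close> are monotone along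
    inclusion.\<close>
  have lvl_pair: "lvl (\<Lambda> (lex_rank W (meet \<kappa> (yl ! s) (yl ! t)))) (zs ! s) (zs ! t)"
    if "s < t" "t \<le> n" for s t
    using that
  proof (induction t)
    case (Suc t)
    show ?case
    proof (cases "s = t")
      case True
      then show ?thesis using zs4[of t] Suc.prems unfolding rk_def by simp
    next
      case False
      then have st: "s < t" using Suc.prems by simp
      then have IH: "lvl (\<Lambda> (lex_rank W (meet \<kappa> (yl ! s) (yl ! t)))) (zs ! s) (zs ! t)"
        using Suc by simp
      have next_: "lvl (\<Lambda> (lex_rank W (meet \<kappa> (yl ! t) (yl ! Suc t)))) (zs ! t) (zs ! Suc t)"
        using zs4[of t] Suc.prems unfolding rk_def by simp
      have inY: "yl ! s \<in> Y" "yl ! t \<in> Y" "yl ! Suc t \<in> Y" using ylY Suc.prems st by auto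
      then have T: "yl ! s \<in> T" "yl ! t \<in> T" "yl ! Suc t \<in> T" using YT by auto
      define a b where "a = meet \<kappa> (yl ! s) (yl ! t)" and "b = meet \<kappa> (yl ! t) (yl ! Suc t)"
      have ab: "a \<in> W" "b \<in> W" "a \<in> T" "b \<in> T" "a \<subseteq>\<^sub>m yl ! t" "b \<subseteq>\<^sub>m yl ! t"
        unfolding a_def b_def using inW inY meet_tree meet_le1 meet_le2 T by auto
      have lts: "lt (yl ! s) (yl ! t)" "lt (yl ! t) (yl ! Suc t)"
        using sorted_wrt_nth_less[OF yl(1)] st Suc.prems len_yl by auto
      have m: "meet \<kappa> (yl ! s) (yl ! Suc t) = (if a \<subseteq>\<^sub>m b then a else b)"
        unfolding a_def b_def using meet_between[OF lts T] .
      have card_W: "lex_rank W a < card W" "lex_rank W b < card W"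
        using lex_rank_less[OF W] ab by auto
      have "min (\<Lambda> (lex_rank W a)) (\<Lambda> (lex_rank W b)) = \<Lambda> (lex_rank W (if a \<subseteq>\<^sub>m b then a else b))"
      proof (cases "a = b")
        case ne: False
        show ?thesis
        proof (cases "a \<subseteq>\<^sub>m b")
          case True
          then have "lex_rank W a < lex_rank W b"
            using lex_rank_strict_mono[OF W ab(1,2)] lex_le_iff[OF ab(3,4)] ne by blast
          then show ?thesis using True zs(3) card_W by (simp add: min_def less_imp_le)
        next
          case False
          then have "b \<subseteq>\<^sub>m a" using comparable[OF ab(3-6)] by blast
          then have "lex_rank W b < lex_rank W a"
            using lex_rank_strict_mono[OF W ab(2,1)] lex_le_iff[OF ab(4,3)] ne by blast
          then show ?thesis
            using False zs(3)[of "lex_rank W b" "lex_rank W a"] card_W by (simp add: min_def)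
        qed
      qed simp
      then show ?thesis
        using lvl_trans[OF IH next_] unfolding m a_def[symmetric] b_def[symmetric] by simp
    qed
  qed simp
  have dist: "distinct yl"
    unfolding distinct_conv_nth using yl(1) sorted_wrt_nth_less lt_irrefl by (metis nat_neq_iff)
  define idx where "idx y = (THE i. i < length yl \<and> yl ! i = y)" for y
  have idx_nth: "idx (yl ! i) = i" if "i \<le> n" for i
    unfolding idx_def using that len_yl nth_eq_iff_index_eq[OF dist] by (intro the_equality) auto
  have idx: "idx y \<le> n \<and> yl ! idx y = y" if "y \<in> Y" for y
  proof -
    have "y \<in> set yl" using \<open>y \<in> Y\<close> yl(2) by simp
    then obtain i where "i < length yl" "yl ! i = y" unfolding in_set_conv_nth by blast
    then show ?thesis using idx_nth[of i] len_yl by auto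
  qed
  have idx_less: "idx u < idx v" if "u \<in> Y" "v \<in> Y" "lt u v" for u v
    using sorted_wrt_lt_nth_iff[OF yl(1), of "idx u"
      "idx v"] idx[OF that(1)] idx[OF that(2)] that(3) len_yl
    by (simp add: less_Suc_eq_le)
  define e where "e y = zs ! idx y" for y
  have lvl_e: "lvl (\<Lambda> (lex_rank W (meet \<kappa> u v))) (e u) (e v)" if "u \<in> Y" "v \<in> Y" "lt u v" for u v
    using lvl_pair[OF idx_less[OF that]] idx[OF that(1)] idx[OF that(2)] unfolding e_def by simp
  have eZ: "node (e y) \<in> Z" if "y \<in> Y" for y
  proof -
    have "e y \<in> set zs" using idx[OF that] zs(1) len_rks unfolding e_def by simp
    then show ?thesis using zs(2) unfolding Z_def by blast
  qed
  have psim_e: "psim {(y, node (e y)) | y. y \<in> Y}"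
    by (rule psim_by_levels[OF Y W_def, of \<Lambda> "\<lambda>y. node (e y)"]) (use zs(3)
      node_tree lvl_e lt_at_node in auto)
  define f where "f y = g (node (e y))" for y
  show ?thesis
  proof (rule that[of f])
    show "f ` Y \<subseteq> X" using g(1) eZ unfolding f_def by blast
    have "{(y, f y) | y. y \<in> Y} \<subseteq> {(y, node (e y)) | y. y \<in> Y} O {(z, g z) | z. z \<in> Z}"
      using eZ unfolding f_def by blast
    then show "psim {(y, f y) | y. y \<in> Y}" using psim_mono[OF psim_relcomp[OF psim_e g(2)]] by blast
    fix ys ys' assume ys: "sorted_wrt lt ys" "sorted_wrt lt ys'" "set ys \<subseteq> Y" "set ys' \<subseteq> Y"
      "length ys = length ys'" "psim (set (zip ys ys'))"
    show "c (map f ys) = c (map f ys')"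
    proof (cases "ys = []")
      case True
      then show ?thesis using ys(5) by simp
    next
      case False
      have e_sub: "subseq (map e ws) zs" if "sorted_wrt lt ws" "set ws \<subseteq> Y" for ws
      proof -
        have "sorted_wrt (\<lambda>x y. idx x < idx y) ws"
          by (rule sorted_wrt_mono_rel[OF _ that(1)]) (use idx_less that(2) in auto)
        then have "sorted_wrt (<) (map idx ws)" by (simp add: sorted_wrt_map)
        moreover have "set (map idx ws) \<subseteq> set [0..<Suc n]"
        proof -
          have "idx y < Suc n" if "y \<in> set ws" for y using idx[of y] that \<open>set ws \<subseteq> Y\<close> by auto
          then show ?thesis by (force simp del: upt_Suc)
        qed
        ultimately have "subseq (map idx ws) [0..<Suc n]"
          by (intro sorted_subset_imp_subseq sorted_upt)
        then have "subseq (map ((!) zs) (map idx ws)) (map ((!) zs) [0..<Suc n])"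
          by (rule subseq_map)
        moreover have "map ((!) zs) (map idx ws) = map e ws" unfolding e_def by simp
        moreover have "map ((!) zs) [0..<Suc n] = zs" using zs(1) len_rks map_nth[of zs] by simp
        ultimately show ?thesis by (simp only:)
      qed
      have e_lvl: "\<forall>t<length (rks ws). lvl (\<Lambda> (rks ws ! t)) (map e ws ! t) (map e ws ! Suc t)"
        if "sorted_wrt lt ws" "set ws \<subseteq> Y" for ws
      proof (intro allI impI)
        fix t assume "t < length (rks ws)"
        then have t: "t < length ws - 1" using rks(1) by simp
        then have "ws ! t \<in> Y" "ws ! Suc t \<in> Y" "lt (ws ! t) (ws ! Suc t)"
          using that sorted_wrt_nth_less[OF that(1), of t "Suc t"] nth_mem[of t ws]
            nth_mem[of "Suc t" ws] by auto
        from lvl_e[OF this] show "lvl (\<Lambda> (rks ws ! t)) (map e ws ! t) (map e ws ! Suc t)"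
          unfolding rks(2)[OF t] rk_def using t by simp
      qed
      have zip: "(ys ! i, ys' ! i) \<in> set (zip ys ys')" if "i < length ys" for i
        using that ys(5) by (auto simp: in_set_zip)
      \<comment> \<open>Ranks are compared through \<open>lex_le\<close> between meets, which
        \<open>lex_le_meet_iff\<close> reduces to conditions that \<open>psim\<close>
        preserves.\<close>
      have "same_order (rks ys) (rks ys')"
        unfolding same_order_def
      proof (intro conjI allI impI)
        show "length (rks ys) = length (rks ys')" using rks(1) ys(5) by simp
        fix i j assume "i < length (rks ys)" "j < length (rks ys)"
        then have ij: "i < length ys - 1" "j < length ys - 1" "i < length ys' - 1"
          "j < length ys' - 1"
          using rks(1) ys(5) by auto
        have inY: "ys ! t \<in> Y" "ys' ! t \<in> Y" if "t < length ys" for t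
          using that ys(3-5) nth_mem[of t ys] nth_mem[of t ys'] by auto
        have inYs: "ys ! i \<in> Y" "ys ! Suc i \<in> Y" "ys ! j \<in> Y" "ys ! Suc j \<in> Y"
          "ys' ! i \<in> Y" "ys' ! Suc i \<in> Y" "ys' ! j \<in> Y" "ys' ! Suc j \<in> Y" using inY ij by auto
        then have T: "ys ! i \<in> T" "ys ! Suc i \<in> T" "ys ! j \<in> T" "ys ! Suc j \<in> T"
          "ys' ! i \<in> T" "ys' ! Suc i \<in> T" "ys' ! j \<in> T" "ys' ! Suc j \<in> T" using YT by auto
        have z: "(ys ! i, ys' ! i) \<in> set (zip ys ys')"
          "(ys ! Suc i, ys' ! Suc i) \<in> set (zip ys ys')"
          "(ys ! j, ys' ! j) \<in> set (zip ys ys')" "(ys ! Suc j, ys' ! Suc j) \<in> set (zip ys ys')"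
          using ij by (auto intro!: zip)
        have "lex_le \<kappa> (meet \<kappa> (ys ! j) (ys ! Suc j)) (meet \<kappa> (ys ! i) (ys ! Suc i)) \<longleftrightarrow>
          lex_le \<kappa> (meet \<kappa> (ys' ! j) (ys' ! Suc j)) (meet \<kappa> (ys' ! i) (ys' ! Suc i))"
          unfolding lex_le_meet_iff[OF T(3,4,1,2)] lex_le_meet_iff[OF T(7,8,5,6)]
            psim_meet_le_meet[OF ys(6) z(3,4,1,2)] psim_meet_le_meet[OF ys(6) z(1-4)]
              psimD(4)[OF ys(6) z(3,1)] ..
        then show "rks ys ! i < rks ys ! j \<longleftrightarrow> rks ys' ! i < rks ys' ! j"
          unfolding rks(2)[OF ij(1)] rks(2)[OF ij(2)] rks(2)[OF ij(3)] rks(2)[OF ij(4)] rk_def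
            lex_rank_less_iff[OF W inW[OF inYs(1,2)] inW[OF inYs(3,4)]]
            lex_rank_less_iff[OF W inW[OF inYs(5,6)] inW[OF inYs(7,8)]] by simp
      qed
      moreover have "length ys' = Suc (length ys' - 1)" using False ys(5) by (cases ys') auto
      ultimately have "c (map (\<lambda>z. g (node z)) (map e ys)) = c (map (\<lambda>z. g (node z)) (map e ys'))"
        using ys rks(1)
        by (intro hom[OF e_sub e_sub _ _ rks_less rks_less e_lvl e_lvl]) auto
      then show ?thesis unfolding f_def by (simp add: o_def)
    qed
  qed
qed

text \<open>An assignment amounts to the sorted list of its nodes together with a map
  \<open>k\<close> of variables to positions. So finitely many predicates of assignments are encoded
  in one colour of lists, the set of those \<open>((V, P), k)\<close> for which \<open>P\<close>
  holds.\<close>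

lemma ramsey_antichain_assignments:
  fixes \<Theta> :: "('v set \<times> (('v \<Rightarrow> 'k node) \<Rightarrow> bool)) set"
  assumes X: "universal_antichain \<kappa> X" and Y: "finite Y" "antichain \<kappa> Y"
    and \<Theta>: "finite \<Theta>" "\<And>V P. (V, P) \<in> \<Theta> \<Longrightarrow> finite V"
    and dep: "\<And>V P u u'. (V, P) \<in> \<Theta> \<Longrightarrow> (\<And>v. v \<in> V \<Longrightarrow> u v = u' v) \<Longrightarrow> P u = P u'"
  obtains f where "f ` Y \<subseteq> X" "psim {(y, f y) | y. y \<in> Y}"
    "\<And>V P u u'. (V, P) \<in> \<Theta> \<Longrightarrow> u ` V \<subseteq> Y \<Longrightarrow> u' ` V \<subseteq> Y \<Longrightarrow> psim {(u v, u' v) | v. v \<in> V} \<Longrightarrow>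
      P (\<lambda>v. f (u v)) = P (\<lambda>v. f (u' v))"
proof -
  define D where "D = Sigma \<Theta> (\<lambda>(V, P). V \<rightarrow>\<^sub>E {..<card Y})"
  have "finite D" unfolding D_def using \<Theta> by (intro finite_SigmaI) (auto intro!: finite_PiE)
  define c where "c ys = {((V, P), k) \<in> D. P (\<lambda>v. ys ! k v)}" for ys
  obtain f where f: "f ` Y \<subseteq> X" "psim {(y, f y) | y. y \<in> Y}"
    and hom: "\<And>ys ys'. sorted_wrt lt ys \<Longrightarrow> sorted_wrt lt ys' \<Longrightarrow> set ys \<subseteq> Y \<Longrightarrow> set ys' \<subseteq> Y \<Longrightarrow>
      length ys = length ys' \<Longrightarrow> psim (set (zip ys ys')) \<Longrightarrow> c (map f ys) = c (map f ys')"
    by (rule ramsey_antichain[OF X Y, of "Pow D" c]) (use \<open>finite D\<close> in \<open>auto simp: c_def\<close>)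
  show ?thesis
  proof (rule that[OF f])
    fix V P u u' assume VP: "(V, P) \<in> \<Theta>" and u: "u ` V \<subseteq> Y"
      "u' ` V \<subseteq> Y" and ps: "psim {(u v, u' v) | v. v \<in> V}"
    have "antichain \<kappa> (u ` V)" using u(1) Y(2) unfolding antichain_def by blast
    moreover have "finite (u ` V)" using \<Theta>(2)[OF VP] by simp
    ultimately obtain ys where ys: "sorted_wrt lt ys" "set ys = u ` V"
      using ex_lt_sorted_list by blast
    have dist: "distinct ys"
      unfolding distinct_conv_nth using ys(1) sorted_wrt_nth_less lt_irrefl by (metis nat_neq_iff)
    have "length ys \<le> card Y" using distinct_card[OF dist] ys(2) u(1) card_mono[OF Y(1)] by metis
    \<comment> \<open>The matching of nodes induced by \<open>u\<close> and \<open>u'\<close>. It is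
      well defined because a similarity is the graph of a function.\<close>
    define G where "G y = u' (SOME v. v \<in> V \<and> u v = y)" for y
    have G: "G (u v) = u' v" if "v \<in> V" for v
    proof -
      define w where "w = (SOME w. w \<in> V \<and> u w = u v)"
      have w: "w \<in> V \<and> u w = u v" unfolding w_def by (rule someI[of _ v]) (use that in simp)
      have "(u w, u' w) \<in> {(u v, u' v) | v. v \<in> V}" "(u v, u' v) \<in> {(u v, u' v) | v. v \<in> V}"
        using w that by blast+
      then have "u' w = u' v" using psim_functional[OF ps] w by blast
      then show ?thesis unfolding G_def w_def .
    qed
    have zip: "set (zip ys (map G ys)) = {(u v, u' v) | v. v \<in> V}"
    proof -
      have "set (zip ys (map G ys)) = (\<lambda>y. (y, G y)) ` set ys" by (induction ys) auto
      then show ?thesis unfolding ys(2) using G by auto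
    qed
    have "sorted_wrt (\<lambda>x y. lt (G x) (G y)) ys"
    proof (rule sorted_wrt_mono_rel[OF _ ys(1)])
      fix x y assume "x \<in> set ys" "y \<in> set ys" and l: "lt x y"
      then obtain v w where vw: "v \<in> V" "w \<in> V" "x = u v" "y = u w" using ys(2) by auto
      have in_S: "(u v, u' v) \<in> {(u v, u' v) | v. v \<in> V}" "(u w, u' w) \<in> {(u v, u' v) | v. v \<in> V}"
        using vw by blast+
      have inY: "u v \<in> Y" "u w \<in> Y" "u' v \<in> Y" "u' w \<in> Y" using u vw by auto
      have "u v \<noteq> u w" "lex_le \<kappa> (u v) (u w)"
        using l vw lt_irrefl antichain_lex_le_iff[OF Y(2) inY(1,2)] by auto
      then have "u' v \<noteq> u' w" "lex_le \<kappa> (u' v) (u' w)"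
        using psim_functional[OF ps in_S] psimD(4)[OF ps in_S] by auto
      then have "lt (u' v) (u' w)" using antichain_lex_le_iff[OF Y(2) inY(3,4)] by blast
      then show "lt (G x) (G y)" using vw G by simp
    qed
    then have sorted': "sorted_wrt lt (map G ys)" by (simp add: sorted_wrt_map)
    have "set (map G ys) \<subseteq> Y" using G u(2) ys(2) by auto
    then have ceq: "c (map f ys) = c (map f (map G ys))"
      using ys u(1) zip ps by (intro hom[OF ys(1) sorted']) auto
    have "\<exists>i<length ys. ys ! i = u v" if "v \<in> V" for v
      using that ys(2) by (metis imageI in_set_conv_nth)
    then obtain k0 where k0: "\<And>v. v \<in> V \<Longrightarrow> k0 v < length ys \<and> ys ! k0 v = u v" by metis
    define k where "k = restrict k0 V"
    have k: "k v < length ys" "ys ! k v = u v" if "v \<in> V" for v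
      using k0 that unfolding k_def by auto
    have "((V, P), k) \<in> D"
      using VP k0 \<open>length ys \<le> card Y\<close>
      unfolding D_def k_def by (auto simp: PiE_iff) (metis less_le_trans)
    then have "P (\<lambda>v. map f ys ! k v) \<longleftrightarrow> P (\<lambda>v. map f (map G ys) ! k v)"
      using ceq unfolding c_def by blast
    moreover have "P (\<lambda>v. map f ys ! k v) = P (\<lambda>v. f (u v))" by (rule dep[OF VP]) (use k in auto)
    moreover have "P (\<lambda>v. map f (map G ys) ! k v) = P (\<lambda>v. f (u' v))"
      by (rule dep[OF VP]) (use k G in auto)
    ultimately show "P (\<lambda>v. f (u v)) = P (\<lambda>v. f (u' v))" by blast
  qed
qed

section \<open>Concatenation\<close>

text \<open>A node is shorter than the infinite cardinal \<kappa>, so the tail still has cardinality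
  \<kappa> and order type at least \<kappa>. A larger order type would embed \<kappa> into a proper
  initial segment of itself, which has smaller cardinality.\<close>

lemma tail_iso:
  assumes "\<nu> \<in> T"
  shows "\<exists>g. iso (Restr \<kappa> (Field \<kappa> - dom \<nu>)) \<kappa> g"
proof -
  let ?A = "Field \<kappa> - dom \<nu>" and ?R = "Restr \<kappa> (Field \<kappa> - dom \<nu>)"
  have WR: "Well_order ?R" using wo by (rule Well_order_Restr)
  have FR: "Field ?R = ?A" using REFL by (intro Refl_Field_Restr2) auto
  obtain \<alpha> where \<alpha>: "\<alpha> \<in> Field \<kappa>" "dom \<nu> = underS \<kappa> \<alpha>" using assms unfolding tree_def by blast
  have small: "|dom \<nu>| <o \<kappa>" unfolding \<alpha>(2) using card_of_underS[OF card \<alpha>(1)] .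
  have FK: "|Field \<kappa>| =o \<kappa>" using card by (rule card_of_Field_ordIso)
  have "\<kappa> \<le>o |?A|"
  proof (rule ccontr)
    assume "\<not> \<kappa> \<le>o |?A|"
    then have "|?A| <o \<kappa>" using not_ordLeq_iff_ordLess[OF card_of_Well_order wo] by blast
    then have "|?A \<union> dom \<nu>| <o \<kappa>"
      using card_of_Un_ordLess_infinite_Field[OF inf card _ small] by blast
    moreover have "?A \<union> dom \<nu> = Field \<kappa>" using tree_Field[OF assms] by blast
    ultimately show False using FK not_ordLess_ordIso by fastforce
  qed
  moreover have "|?A| \<le>o ?R" using well_order_on_Restr[OF wo] by (intro card_of_least) blast
  ultimately have "\<kappa> \<le>o ?R" using ordLeq_transitive by blast
  moreover have "?R \<le>o \<kappa>"
  proof (rule ccontr)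
    assume "\<not> ?R \<le>o \<kappa>"
    then have "\<kappa> <o ?R" using not_ordLeq_iff_ordLess[OF wo WR] by blast
    then obtain \<gamma> where \<gamma>: "\<gamma> \<in> Field ?R" "\<kappa> =o Restr ?R (underS ?R \<gamma>)"
      using ordLess_iff_ordIso_Restr[OF WR wo] by blast
    have "|Field \<kappa>| =o |Field (Restr ?R (underS ?R \<gamma>))|"
      using \<gamma>(2) by (intro card_of_cong)
    moreover have "Field (Restr ?R (underS ?R \<gamma>)) \<subseteq> underS \<kappa> \<gamma>"
      unfolding underS_def Field_def by blast
    then have "|Field (Restr ?R (underS ?R \<gamma>))| \<le>o |underS \<kappa> \<gamma>|" by (rule card_of_mono1)
    moreover have "|underS \<kappa> \<gamma>| <o \<kappa>" using \<gamma>(1) FR by (intro card_of_underS[OF card]) blast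
    ultimately have "|Field \<kappa>| <o \<kappa>" using ordIso_ordLeq_trans ordLeq_ordLess_trans by blast
    then show False using FK not_ordLess_ordIso by blast
  qed
  ultimately have "?R =o \<kappa>" using ordIso_iff_ordLeq by blast
  then show ?thesis unfolding ordIso_def by blast
qed

text \<open>\<open>shift\<close> is defined pointwise through order types. It coincides with the
  isomorphism \<open>g\<close> from \<open>tail_iso\<close>: this maps the tail below \<gamma> onto
  the ordinals below \<open>g \<gamma>\<close>, and distinct proper initial segments are not
  isomorphic.\<close>

lemma shift_iso:
  assumes "\<nu> \<in> T"
  shows "bij_betw (shift \<kappa> \<nu>) (Field \<kappa> - dom \<nu>) (Field \<kappa>)"
    "\<And>\<beta> \<gamma>. \<beta> \<in> Field \<kappa> - dom \<nu> \<Longrightarrow> \<gamma> \<in> Field \<kappa> - dom \<nu> \<Longrightarrow>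
      (\<beta>, \<gamma>) \<in> \<kappa> \<longleftrightarrow> (shift \<kappa> \<nu> \<beta>, shift \<kappa> \<nu> \<gamma>) \<in> \<kappa>"
proof -
  let ?A = "Field \<kappa> - dom \<nu>" and ?R = "Restr \<kappa> (Field \<kappa> - dom \<nu>)"
  have FR: "Field ?R = ?A" using REFL by (intro Refl_Field_Restr2) auto
  obtain g where "iso ?R \<kappa> g" using tail_iso[OF assms] by blast
  then have g: "bij_betw g ?A (Field \<kappa>)" "\<And>\<beta> \<gamma>. \<beta> \<in> ?A \<Longrightarrow> \<gamma> \<in> ?A \<Longrightarrow> (\<beta>, \<gamma>) \<in> \<kappa> \<longleftrightarrow> (g \<beta>, g \<gamma>) \<in> \<kappa>"
    unfolding iso_iff2 FR by auto
  have shift: "shift \<kappa> \<nu> \<gamma> = g \<gamma>" if \<gamma>: "\<gamma> \<in> ?A" for \<gamma>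
  proof -
    have g\<gamma>: "g \<gamma> \<in> Field \<kappa>" using g(1) \<gamma> unfolding bij_betw_def by blast
    let ?B = "underS \<kappa> \<gamma> - dom \<nu>"
    have BA: "?B \<subseteq> ?A" using underS_Field by blast
    have bij: "bij_betw g ?B (underS \<kappa> (g \<gamma>))"
    proof -
      have "g ` ?B = underS \<kappa> (g \<gamma>)"
      proof
        show "g ` ?B \<subseteq> underS \<kappa> (g \<gamma>)"
        proof
          fix x assume "x \<in> g ` ?B"
          then obtain \<beta> where \<beta>: "\<beta> \<in> ?B" "x = g \<beta>" by blast
          then have "\<beta> \<in> ?A" "(\<beta>, \<gamma>) \<in> \<kappa>" "\<beta> \<noteq> \<gamma>" using BA unfolding underS_def by auto
          then show "x \<in> underS \<kappa> (g \<gamma>)"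
            using g \<gamma> \<beta>(2) unfolding underS_def bij_betw_def inj_on_def by auto
        qed
        show "underS \<kappa> (g \<gamma>) \<subseteq> g ` ?B"
        proof
          fix x assume x: "x \<in> underS \<kappa> (g \<gamma>)"
          then obtain \<beta> where \<beta>: "\<beta> \<in> ?A" "x = g \<beta>"
            using underS_Field g(1) unfolding bij_betw_def by blast
          then have "(\<beta>, \<gamma>) \<in> \<kappa>" "\<beta> \<noteq> \<gamma>" using x g(2) \<gamma> unfolding underS_def by auto
          then show "x \<in> g ` ?B" using \<beta> unfolding underS_def by blast
        qed
      qed
      moreover have "inj_on g ?B"
        using g(1) BA unfolding bij_betw_def by (blast intro: inj_on_subset)
      ultimately show ?thesis unfolding bij_betw_def by blast
    qed
    have "Field (Restr \<kappa> ?B) = ?B" "Field (Restr \<kappa> (underS \<kappa> (g \<gamma>))) = underS \<kappa> (g \<gamma>)"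
      by (rule Refl_Field_Restr2[OF REFL]; use underS_Field in blast)+
    moreover have "(a, b) \<in> Restr \<kappa> ?B \<longleftrightarrow> (g a, g b) \<in> Restr \<kappa> (underS \<kappa> (g \<gamma>))"
      if "a \<in> ?B" "b \<in> ?B" for a b
    proof -
      have "a \<in> ?A" "b \<in> ?A" using that BA by blast+
      moreover have "g a \<in> underS \<kappa> (g \<gamma>)" "g b \<in> underS \<kappa> (g \<gamma>)"
        using bij that unfolding bij_betw_def by blast+
      ultimately show ?thesis using g(2)[of a b] that by blast
    qed
    ultimately have "iso (Restr \<kappa> ?B) (Restr \<kappa> (underS \<kappa> (g \<gamma>))) g"
      unfolding iso_iff2 using bij by simp
    then have "Restr \<kappa> ?B =o Restr \<kappa> (underS \<kappa> (g \<gamma>))"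
      unfolding ordIso_def using Well_order_Restr[OF wo] by blast
    then have iso: "Restr \<kappa> (underS \<kappa> (g \<gamma>)) =o Restr \<kappa> ?B" by (rule ordIso_symmetric)
    show ?thesis
      unfolding shift_def
    proof (rule the_equality)
      show "g \<gamma> \<in> Field \<kappa> \<and> Restr \<kappa> (underS \<kappa> (g \<gamma>)) =o Restr \<kappa> ?B" using iso g\<gamma> by blast
      fix \<delta> assume \<delta>: "\<delta> \<in> Field \<kappa> \<and> Restr \<kappa> (underS \<kappa> \<delta>) =o Restr \<kappa> ?B"
      then have eq: "Restr \<kappa> (underS \<kappa> \<delta>) =o Restr \<kappa> (underS \<kappa> (g \<gamma>))"
        using ordIso_transitive ordIso_symmetric iso by blast
      have less: "Restr \<kappa> (underS \<kappa> a) <o Restr \<kappa> (underS \<kappa> b)" if "a \<in> underS \<kappa> b" for a b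
      proof -
        have "underS \<kappa> a \<subset> underS \<kappa> b"
          using that underS_le[of _ a b] underS_irrefl unfolding underS_def by blast
        then show ?thesis
          using ofilter_subset_ordLess[OF wo wo_rel.underS_ofilter[OF wo_rel]
            wo_rel.underS_ofilter[OF wo_rel]]
          by blast
      qed
      show "\<delta> = g \<gamma>"
      proof (rule ccontr)
        assume "\<delta> \<noteq> g \<gamma>"
        then have "\<delta> \<in> underS \<kappa> (g \<gamma>) \<or> g \<gamma> \<in> underS \<kappa> \<delta>"
          using le_total[of \<delta> "g \<gamma>"] \<delta> g\<gamma> unfolding underS_def by blast
        then show False using less eq not_ordLess_ordIso ordIso_symmetric by blast
      qed
    qed
  qed
  have "bij_betw (shift \<kappa> \<nu>) ?A (Field \<kappa>) \<longleftrightarrow> bij_betw g ?A (Field \<kappa>)"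
    by (rule bij_betw_cong) (rule shift)
  then show "bij_betw (shift \<kappa> \<nu>) ?A (Field \<kappa>)" using g(1) by simp
  show "(\<beta>, \<gamma>) \<in> \<kappa> \<longleftrightarrow> (shift \<kappa> \<nu> \<beta>, shift \<kappa> \<nu> \<gamma>) \<in> \<kappa>" if "\<beta> \<in> ?A" "\<gamma> \<in> ?A" for \<beta> \<gamma>
    using g(2) shift that by simp
qed

lemma conc_simps:
  "\<gamma> \<in> dom \<nu> \<Longrightarrow> conc \<kappa> \<nu> u \<gamma> = \<nu> \<gamma>"
  "\<gamma> \<in> Field \<kappa> - dom \<nu> \<Longrightarrow> conc \<kappa> \<nu> u \<gamma> = u (shift \<kappa> \<nu> \<gamma>)"
  "\<gamma> \<notin> Field \<kappa> \<Longrightarrow> \<gamma> \<notin> dom \<nu> \<Longrightarrow> conc \<kappa> \<nu> u \<gamma> = None"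
  by (simp_all add: conc_def)

lemma shift_surj:
  assumes "\<nu> \<in> T" "\<beta> \<in> Field \<kappa>"
  obtains \<gamma> where "\<gamma> \<in> Field \<kappa> - dom \<nu>" "shift \<kappa> \<nu> \<gamma> = \<beta>"
proof -
  have "\<beta> \<in> shift \<kappa> \<nu> ` (Field \<kappa> - dom \<nu>)"
    using bij_betw_imp_surj_on[OF shift_iso(1)[OF assms(1)]] assms(2) by simp
  then show ?thesis using that by (elim imageE) simp
qed

lemma shift_underS:
  assumes "\<nu> \<in> T" "\<beta> \<in> Field \<kappa> - dom \<nu>" "\<gamma> \<in> Field \<kappa> - dom \<nu>"
  shows "shift \<kappa> \<nu> \<beta> \<in> underS \<kappa> (shift \<kappa> \<nu> \<gamma>) \<longleftrightarrow> \<beta> \<in> underS \<kappa> \<gamma>"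
  using shift_iso(2)[OF assms] bij_betw_imp_inj_on[OF shift_iso(1)[OF assms(1)]] assms(2,3)
  unfolding underS_def by (auto dest: inj_onD)

lemma conc_extends: "\<nu> \<subseteq>\<^sub>m conc \<kappa> \<nu> u"
  unfolding map_le_def by (simp add: conc_simps(1))

lemma dom_underS_tail:
  assumes "\<nu> \<in> T" "\<beta> \<in> dom \<nu>" "\<gamma> \<in> Field \<kappa> - dom \<nu>"
  shows "\<beta> \<in> underS \<kappa> \<gamma>"
  using le_total[of \<gamma> \<beta>] tree_down[OF assms(1,2), of \<gamma>] tree_Field[OF assms(1,2)] assms(3) by blast

lemma conc_tree:
  assumes "\<nu> \<in> T" "u \<in> T"
  shows "conc \<kappa> \<nu> u \<in> T"
proof -
  obtain \<beta> where \<beta>: "\<beta> \<in> Field \<kappa>" "dom u = underS \<kappa> \<beta>" using assms(2) unfolding tree_def by blast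
  \<comment> \<open>The length of the concatenation is the point whose shift is the length of
    \<open>u\<close>, that is, the ordinal sum of the two lengths.\<close>
  obtain \<gamma> where \<gamma>: "\<gamma> \<in> Field \<kappa> - dom \<nu>" "shift \<kappa> \<nu> \<gamma> = \<beta>"
    using shift_surj[OF assms(1) \<beta>(1)] by blast
  have "x \<in> dom (conc \<kappa> \<nu> u) \<longleftrightarrow> x \<in> underS \<kappa> \<gamma>" for x
  proof -
    consider "x \<in> dom \<nu>" | "x \<in> Field \<kappa> - dom \<nu>" | "x \<notin> Field \<kappa>" "x \<notin> dom \<nu>" by blast
    then show ?thesis
    proof cases
      case 1
      then show ?thesis using dom_underS_tail[OF assms(1) 1 \<gamma>(1)] conc_simps(1)[OF 1] by auto
    next
      case 2
      have "x \<in> dom (conc \<kappa> \<nu> u) \<longleftrightarrow> shift \<kappa> \<nu> x \<in> dom u"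
        using conc_simps(2)[OF 2] by (simp add: domIff)
      then show ?thesis using shift_underS[OF assms(1) 2 \<gamma>(1)] \<beta>(2) \<gamma>(2) by simp
    next
      case 3
      then show ?thesis using conc_simps(3)[OF 3] underS_Field by (auto simp: domIff)
    qed
  qed
  then have "dom (conc \<kappa> \<nu> u) = underS \<kappa> \<gamma>" by blast
  then show ?thesis using \<gamma>(1) unfolding tree_def by blast
qed

lemma conc_le_iff:
  assumes "\<nu> \<in> T" "u \<in> T" "v \<in> T"
  shows "conc \<kappa> \<nu> u \<subseteq>\<^sub>m conc \<kappa> \<nu> v \<longleftrightarrow> u \<subseteq>\<^sub>m v"
proof
  assume le: "conc \<kappa> \<nu> u \<subseteq>\<^sub>m conc \<kappa> \<nu> v"
  show "u \<subseteq>\<^sub>m v"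
    unfolding map_le_def
  proof
    fix \<beta> assume \<beta>: "\<beta> \<in> dom u"
    obtain \<gamma> where \<gamma>: "\<gamma> \<in> Field \<kappa> - dom \<nu>" "shift \<kappa> \<nu> \<gamma> = \<beta>"
      using shift_surj[OF assms(1) tree_Field[OF assms(2) \<beta>]] by blast
    note c = conc_simps(2)[OF \<gamma>(1), unfolded \<gamma>(2)]
    have "\<gamma> \<in> dom (conc \<kappa> \<nu> u)" using \<beta> c[of u] by (simp add: domIff)
    then have "conc \<kappa> \<nu> u \<gamma> = conc \<kappa> \<nu> v \<gamma>" using le unfolding map_le_def by blast
    then show "u \<beta> = v \<beta>" unfolding c .
  qed
next
  assume le: "u \<subseteq>\<^sub>m v"
  show "conc \<kappa> \<nu> u \<subseteq>\<^sub>m conc \<kappa> \<nu> v"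
    using le unfolding map_le_def conc_def by (auto split: if_splits)
qed

lemma conc_inj:
  assumes "\<nu> \<in> T" "u \<in> T" "v \<in> T"
  shows "conc \<kappa> \<nu> u = conc \<kappa> \<nu> v \<longleftrightarrow> u = v"
  using conc_le_iff[OF assms] conc_le_iff[OF assms(1,3,2)] map_le_antisym map_le_refl by metis

lemma conc_meet:
  assumes "\<nu> \<in> T" "u \<in> T" "v \<in> T"
  shows "meet \<kappa> (conc \<kappa> \<nu> u) (conc \<kappa> \<nu> v) = conc \<kappa> \<nu> (meet \<kappa> u v)"
proof
  fix \<gamma>
  consider "\<gamma> \<in> dom \<nu>" | "\<gamma> \<in> Field \<kappa> - dom \<nu>" | "\<gamma> \<notin> Field \<kappa>" "\<gamma> \<notin> dom \<nu>" by blast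
  then show "meet \<kappa> (conc \<kappa> \<nu> u) (conc \<kappa> \<nu> v) \<gamma> = conc \<kappa> \<nu> (meet \<kappa> u v) \<gamma>"
  proof cases
    case 1
    have "conc \<kappa> \<nu> u \<beta> = conc \<kappa> \<nu> v \<beta>" if "(\<beta>, \<gamma>) \<in> \<kappa>" for \<beta>
      using conc_simps(1) tree_down[OF assms(1) 1 that] by simp
    then show ?thesis unfolding meet_apply by (simp add: conc_simps(1)[OF 1])
  next
    case 2
    \<comment> \<open>Agreement on \<open>dom \<nu>\<close> is automatic, and beyond it the
      positions up to \<gamma> correspond to those up to its shift.\<close>
    have "(\<forall>\<beta>. (\<beta>, \<gamma>) \<in> \<kappa> \<longrightarrow> conc \<kappa> \<nu> u \<beta> = conc \<kappa> \<nu> v \<beta>) \<longleftrightarrow>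
      (\<forall>\<beta>. (\<beta>, shift \<kappa> \<nu> \<gamma>) \<in> \<kappa> \<longrightarrow> u \<beta> = v \<beta>)" (is "?l \<longleftrightarrow> ?r")
    proof
      assume l: ?l
      show ?r
      proof (intro allI impI)
        fix \<beta> assume \<beta>: "(\<beta>, shift \<kappa> \<nu> \<gamma>) \<in> \<kappa>"
        then have "\<beta> \<in> Field \<kappa>" by (auto simp: Field_def)
        then obtain \<delta> where \<delta>: "\<delta> \<in> Field \<kappa> - dom \<nu>" "shift \<kappa> \<nu> \<delta> = \<beta>"
          using shift_surj[OF assms(1)] by blast
        then have "(\<delta>, \<gamma>) \<in> \<kappa>" using shift_iso(2)[OF assms(1) \<delta>(1) 2] \<beta> by simp
        then show "u \<beta> = v \<beta>" using l conc_simps(2)[OF \<delta>(1)] \<delta>(2) by metis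
      qed
    next
      assume r: ?r
      show ?l
      proof (intro allI impI)
        fix \<beta> assume \<beta>: "(\<beta>, \<gamma>) \<in> \<kappa>"
        show "conc \<kappa> \<nu> u \<beta> = conc \<kappa> \<nu> v \<beta>"
        proof (cases "\<beta> \<in> dom \<nu>")
          case True
          then show ?thesis by (simp add: conc_simps(1))
        next
          case False
          then have \<beta>': "\<beta> \<in> Field \<kappa> - dom \<nu>" using \<beta> by (auto simp: Field_def)
          then show ?thesis using r \<beta> shift_iso(2)[OF assms(1) \<beta>' 2] conc_simps(2)[OF \<beta>'] by simp
        qed
      qed
    qed
    then show ?thesis
      unfolding meet_apply[of "conc \<kappa> \<nu> u"] conc_simps(2)[OF 2] meet_apply[of u] by simp
  next
    case 3
    then show ?thesis unfolding meet_apply conc_simps(3)[OF 3] by simp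
  qed
qed

lemma conc_lt:
  assumes "\<nu> \<in> T" "u \<in> T" "v \<in> T" "lt u v"
  shows "lt (conc \<kappa> \<nu> u) (conc \<kappa> \<nu> v)"
proof -
  obtain l x y where l: "l \<in> Field \<kappa>" "\<forall>\<beta>\<in>underS \<kappa> l. u \<beta> = v \<beta>" "u l = Some x" "v l = Some y"
    "x < y"
    using assms(4) unfolding lt_def lt_at_def by blast
  obtain \<gamma> where \<gamma>: "\<gamma> \<in> Field \<kappa> - dom \<nu>" "shift \<kappa> \<nu> \<gamma> = l"
    using shift_surj[OF assms(1) l(1)] by blast
  have "conc \<kappa> \<nu> u \<beta> = conc \<kappa> \<nu> v \<beta>" if "\<beta> \<in> underS \<kappa> \<gamma>" for \<beta>
  proof (cases "\<beta> \<in> dom \<nu>")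
    case True
    then show ?thesis by (simp add: conc_simps(1))
  next
    case False
    then have \<beta>: "\<beta> \<in> Field \<kappa> - dom \<nu>" using that underS_Field by blast
    then show ?thesis
      using shift_underS[OF assms(1) \<beta> \<gamma>(1)] that l(2) \<gamma>(2) conc_simps(2)[OF \<beta>] by simp
  qed
  moreover have "conc \<kappa> \<nu> u \<gamma> = Some x" "conc \<kappa> \<nu> v \<gamma> = Some y"
    using conc_simps(2)[OF \<gamma>(1)] \<gamma>(2) l(3,4) by auto
  ultimately show ?thesis using \<gamma>(1) l(5) unfolding lt_def lt_at_def by blast
qed

lemma conc_lex_le_iff:
  assumes "\<nu> \<in> T" "u \<in> T" "v \<in> T"
  shows "lex_le \<kappa> (conc \<kappa> \<nu> u) (conc \<kappa> \<nu> v) \<longleftrightarrow> lex_le \<kappa> u v"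
proof
  assume "lex_le \<kappa> u v"
  then show "lex_le \<kappa> (conc \<kappa> \<nu> u) (conc \<kappa> \<nu> v)"
    using lex_le_iff conc_tree conc_lt conc_le_iff assms by metis
next
  assume l: "lex_le \<kappa> (conc \<kappa> \<nu> u) (conc \<kappa> \<nu> v)"
  show "lex_le \<kappa> u v"
  proof (rule ccontr)
    assume n: "\<not> lex_le \<kappa> u v"
    then have "lex_le \<kappa> v u" using lex_le_total assms by blast
    then have "lex_le \<kappa> (conc \<kappa> \<nu> v) (conc \<kappa> \<nu> u)"
      using lex_le_iff conc_tree conc_lt conc_le_iff assms by metis
    then have "conc \<kappa> \<nu> u = conc \<kappa> \<nu> v" using l lex_le_antisym conc_tree assms by blast
    then show False using conc_inj assms n lex_le_refl by metis
  qed
qed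

section \<open>Nodes above two incomparable roots\<close>

lemma perp_no_common_extension:
  assumes "perp \<nu> \<xi>" "\<nu> \<in> T" "\<xi> \<in> T" "\<nu> \<subseteq>\<^sub>m w"
  shows "\<not> \<xi> \<subseteq>\<^sub>m w"
  using comparable[OF assms(2,3,4)] assms(1) unfolding perp_def by blast

text \<open>The meet and \<nu> are initial segments of one node, hence comparable. The meet cannot
  extend \<nu>, as \<nu> and \<xi> have no common extension. The same holds for \<xi>.\<close>

lemma conc_cross_meet:
  assumes "perp \<nu> \<xi>" "\<nu> \<in> T" "\<xi> \<in> T" "u \<in> T" "v \<in> T"
  shows "meet \<kappa> (conc \<kappa> \<nu> u) (conc \<kappa> \<xi> v) \<subseteq>\<^sub>m \<nu>" "meet \<kappa> (conc \<kappa> \<nu> u) (conc \<kappa> \<xi> v) \<subseteq>\<^sub>m \<xi>"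
proof -
  let ?m = "meet \<kappa> (conc \<kappa> \<nu> u) (conc \<kappa> \<xi> v)"
  have T: "conc \<kappa> \<nu> u \<in> T" "conc \<kappa> \<xi> v \<in> T" using conc_tree assms by auto
  then have m: "?m \<in> T" "?m \<subseteq>\<^sub>m conc \<kappa> \<nu> u" "?m \<subseteq>\<^sub>m conc \<kappa> \<xi> v"
    using meet_tree meet_le1 meet_le2 by auto
  have "\<not> \<nu> \<subseteq>\<^sub>m ?m"
    using perp_no_common_extension[OF assms(1-3)] map_le_trans[OF _ m(3)] conc_extends by blast
  then show "?m \<subseteq>\<^sub>m \<nu>" using comparable[OF m(1) assms(2) m(2) conc_extends] by blast
  have "\<not> \<xi> \<subseteq>\<^sub>m ?m"
    using perp_no_common_extension[OF _ assms(3,2)] assms(1) map_le_trans[OF _ m(2)]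
      conc_extends perp_commute by blast
  then show "?m \<subseteq>\<^sub>m \<xi>" using comparable[OF m(1) assms(3) m(3) conc_extends] by blast
qed

definition conc_rel :: "'k node \<Rightarrow> ('k node \<times> 'k node) set \<Rightarrow> ('k node \<times> 'k node) set" where
  "conc_rel \<nu> S = {(conc \<kappa> \<nu> u, conc \<kappa> \<nu> v) | u v. (u, v) \<in> S}"

text \<open>The roots decide everything that involves both sides: the lexicographic order is that of
  the roots, and a meet across the roots lies below both of them, hence below every node considered.
  Above a single root, translation preserves and reflects both clauses of
  \<open>psim\<close>.\<close>

lemma psim_conc_Un:
  assumes S: "psim S" "psim S'" and \<nu>: "perp \<nu> \<xi>" "\<nu> \<in> T" "\<xi> \<in> T"
  shows "psim (conc_rel \<nu> S \<union> conc_rel \<xi> S')"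
proof -
  define F where "F \<rho> = (if \<rho> = \<nu> then S else S')" for \<rho>
  have ne: "\<nu> \<noteq> \<xi>" using \<nu>(1) unfolding perp_def by auto
  have F: "psim (F \<rho>)" for \<rho> using S unfolding F_def by simp
  have roots: "\<exists>\<rho>\<in>{\<nu>, \<xi>}. \<exists>u u'. x = conc \<kappa> \<rho> u \<and> x' = conc \<kappa> \<rho> u' \<and> (u, u') \<in> F \<rho>"
    if "(x, x') \<in> conc_rel \<nu> S \<union> conc_rel \<xi> S'" for x x'
    using that ne unfolding conc_rel_def F_def by auto
  have rT: "\<rho> \<in> T" if "\<rho> \<in> {\<nu>, \<xi>}" for \<rho> using that \<nu> by blast
  have perp: "perp \<rho> \<rho>'" if "\<rho> \<in> {\<nu>, \<xi>}" "\<rho>' \<in> {\<nu>, \<xi>}" "\<rho> \<noteq> \<rho>'" for \<rho> \<rho>'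
    using that \<nu>(1) perp_commute by auto
  have ternary: "meet \<kappa> (conc \<kappa> \<rho>1 u) (conc \<kappa> \<rho>2 v) \<subseteq>\<^sub>m conc \<kappa> \<rho>3 w \<longleftrightarrow>
      (if \<rho>1 = \<rho>2 then \<rho>3 = \<rho>1 \<and> meet \<kappa> u v \<subseteq>\<^sub>m w else True)"
    if r: "\<rho>1 \<in> {\<nu>, \<xi>}" "\<rho>2 \<in> {\<nu>, \<xi>}" "\<rho>3 \<in> {\<nu>, \<xi>}" and u: "u \<in> T" "v \<in> T" "w \<in> T"
      for \<rho>1 \<rho>2 \<rho>3 u v w
  proof (cases "\<rho>1 = \<rho>2")
    case True
    have m: "meet \<kappa> (conc \<kappa> \<rho>1 u) (conc \<kappa> \<rho>2 v) = conc \<kappa> \<rho>1 (meet \<kappa> u v)"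
      using True conc_meet[OF rT[OF r(1)] u(1,2)] by simp
    show ?thesis
    proof (cases "\<rho>3 = \<rho>1")
      case 3: True
      show ?thesis unfolding m 3
        using True conc_le_iff[OF rT[OF r(1)] meet_tree[OF u(1,2)] u(3)] by simp
    next
      case False
      have "\<not> conc \<kappa> \<rho>1 (meet \<kappa> u v) \<subseteq>\<^sub>m conc \<kappa> \<rho>3 w"
        using perp_no_common_extension[OF perp[OF r(3,1) False] rT[OF r(3)] rT[OF r(1)]
          conc_extends[of \<rho>3 w]]
          map_le_trans[OF conc_extends[of \<rho>1 "meet \<kappa> u v"]] by blast
      then show ?thesis unfolding m using True False by simp
    qed
  next
    case False
    then have "\<rho>3 = \<rho>1 \<or> \<rho>3 = \<rho>2" using r by blast
    then show ?thesis
      using conc_cross_meet[OF perp[OF r(1,2) False] rT[OF r(1)] rT[OF r(2)] u(1,2)] False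
        map_le_trans[OF _ conc_extends[of \<rho>3 w]] by auto
  qed
  have lex: "lex_le \<kappa> (conc \<kappa> \<rho>1 u) (conc \<kappa> \<rho>2 v) \<longleftrightarrow> (if \<rho>1 = \<rho>2 then lex_le \<kappa> u v else lt \<rho>1 \<rho>2)"
    if r: "\<rho>1 \<in> {\<nu>, \<xi>}" "\<rho>2 \<in> {\<nu>, \<xi>}" and u: "u \<in> T" "v \<in> T" for \<rho>1 \<rho>2 u v
  proof (cases "\<rho>1 = \<rho>2")
    case True
    then show ?thesis using conc_lex_le_iff[OF rT[OF r(1)] u] by simp
  next
    case False
    have T: "conc \<kappa> \<rho>1 u \<in> T" "conc \<kappa> \<rho>2 v \<in> T" using conc_tree rT r u by auto
    note mono = lt_mono[OF _ conc_extends conc_extends]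
    have p: "perp \<rho>1 \<rho>2" using perp[OF r False] .
    have "lt \<rho>1 \<rho>2 \<or> lt \<rho>2 \<rho>1" using perp_lt_cases[OF rT[OF r(1)] rT[OF r(2)] p] .
    moreover have "lt \<rho>1 \<rho>2 \<Longrightarrow> lt (conc \<kappa> \<rho>1 u) (conc \<kappa> \<rho>2 v)" "lt \<rho>2 \<rho>1 \<Longrightarrow>
      lt (conc \<kappa> \<rho>2 v) (conc \<kappa> \<rho>1 u)"
      using mono rT r by blast+
    moreover have "lt x y \<Longrightarrow> \<not> lt y x" for x y using lt_trans lt_irrefl by blast
    moreover have "lt (conc \<kappa> \<rho>1 u) (conc \<kappa> \<rho>2 v) \<or> lt (conc \<kappa> \<rho>2 v) (conc \<kappa> \<rho>1 u) \<Longrightarrow>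
        \<not> conc \<kappa> \<rho>1 u \<subseteq>\<^sub>m conc \<kappa> \<rho>2 v" using lt_perp unfolding perp_def by blast
    ultimately show ?thesis using False lex_le_iff[OF T] by metis
  qed
  note FT = psimD(1,2)[OF F]
  show ?thesis
  proof (rule psimI)
    fix x x' assume in1: "(x, x') \<in> conc_rel \<nu> S \<union> conc_rel \<xi> S'"
    obtain \<rho> u u' where u: "\<rho> \<in> {\<nu>, \<xi>}" "x = conc \<kappa> \<rho> u" "x' = conc \<kappa> \<rho> u'" "(u, u') \<in> F \<rho>"
      using roots[OF in1] by blast
    show "x \<in> T \<and> x' \<in> T" using u(2,3) conc_tree[OF rT[OF u(1)]] FT[OF u(4)] by simp
    fix y y' assume in2: "(y, y') \<in> conc_rel \<nu> S \<union> conc_rel \<xi> S'"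
    obtain \<sigma> v v' where v: "\<sigma> \<in> {\<nu>, \<xi>}" "y = conc \<kappa> \<sigma> v" "y' = conc \<kappa> \<sigma> v'" "(v, v') \<in> F \<sigma>"
      using roots[OF in2] by blast
    show "lex_le \<kappa> x y \<longleftrightarrow> lex_le \<kappa> x' y'"
      unfolding u(2,3) v(2,3) lex[OF u(1) v(1) FT(1)[OF u(4)] FT(1)[OF v(4)]]
        lex[OF u(1) v(1) FT(2)[OF u(4)] FT(2)[OF v(4)]]
      using psimD(4)[OF F u(4), of v v'] v(4) by auto
    fix z z' assume in3: "(z, z') \<in> conc_rel \<nu> S \<union> conc_rel \<xi> S'"
    obtain \<tau> w w' where w: "\<tau> \<in> {\<nu>, \<xi>}" "z = conc \<kappa> \<tau> w" "z' = conc \<kappa> \<tau> w'" "(w, w') \<in> F \<tau>"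
      using roots[OF in3] by blast
    show "meet \<kappa> x y \<subseteq>\<^sub>m z \<longleftrightarrow> meet \<kappa> x' y' \<subseteq>\<^sub>m z'"
      unfolding u(2,3) v(2,3) w(2,3)
        ternary[OF u(1) v(1) w(1) FT(1)[OF u(4)] FT(1)[OF v(4)] FT(1)[OF w(4)]]
        ternary[OF u(1) v(1) w(1) FT(2)[OF u(4)] FT(2)[OF v(4)] FT(2)[OF w(4)]]
      using psimD(3)[OF F u(4), of v v' w w'] v(4) w(4) by auto
  qed
qed

lemma psim_translate:
  assumes "X \<subseteq> T" "\<nu> \<in> T"
  shows "psim {(u, conc \<kappa> \<nu> u) | u. u \<in> X}"
proof (rule psimI)
  fix x x' assume "(x, x') \<in> {(u, conc \<kappa> \<nu> u) | u. u \<in> X}"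
  then have x: "x \<in> T" "x' = conc \<kappa> \<nu> x" using assms(1) by auto
  then show "x \<in> T \<and> x' \<in> T" using conc_tree assms(2) by blast
  fix y y' assume "(y, y') \<in> {(u, conc \<kappa> \<nu> u) | u. u \<in> X}"
  then have y: "y \<in> T" "y' = conc \<kappa> \<nu> y" using assms(1) by auto
  show "lex_le \<kappa> x y \<longleftrightarrow> lex_le \<kappa> x' y'" unfolding x(2) y(2) conc_lex_le_iff[OF assms(2) x(1) y(1)] ..
  fix z z' assume "(z, z') \<in> {(u, conc \<kappa> \<nu> u) | u. u \<in> X}"
  then have z: "z \<in> T" "z' = conc \<kappa> \<nu> z" using assms(1) by auto
  show "meet \<kappa> x y \<subseteq>\<^sub>m z \<longleftrightarrow> meet \<kappa> x' y' \<subseteq>\<^sub>m z'"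
    unfolding x(2) y(2) z(2) conc_meet[OF assms(2) x(1) y(1)]
      conc_le_iff[OF assms(2) meet_tree[OF x(1) y(1)] z(1)] ..
qed

section \<open>Making a realisation see an indiscernible antichain\<close>

definition pts :: "nat \<Rightarrow> ('k node \<Rightarrow> nat \<Rightarrow> 'm) \<Rightarrow> 'k node set \<Rightarrow> 'm set" where
  "pts m a Z = {a u q | u q. u \<in> Z \<and> q < m}"

lemma pull_Id_on: "pull m a (Id_on Z) = Id_on (pts m a Z)"
  unfolding pull_def pts_def by blast

lemma pts_mono: "Y \<subseteq> Z \<Longrightarrow> pts m a Y \<subseteq> pts m a Z"
  unfolding pts_def by blast

text \<open>The formulas that a realisation \<open>y\<close> has to satisfy: \<open>type_formulas\<close> says that \<open>y\<close> corresponds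
  to \<open>b\<close> under \<open>R\<close>, and \<open>indisc_formulas\<close> says that the family is indiscernible over \<open>y\<close> and \<open>D\<close>.\<close>

definition type_formulas ::
  "('f, 'p) lang \<Rightarrow> ('f, 'p, 'm) struct \<Rightarrow> 'm \<Rightarrow> ('m \<times> 'm) set \<Rightarrow> ('f, 'p, unit, 'm) pfm set" where
  "type_formulas L M b R = {(\<phi>, \<tau>). wf_fm L \<phi> \<and>
     (\<exists>e. sat M e \<phi> \<and> (\<forall>v\<in>FV \<phi>. case \<tau> v of Inl _ \<Rightarrow> e v = b | Inr t \<Rightarrow> (e v, t) \<in> R))}"

definition indisc_formulas ::
  "('f, 'p) lang \<Rightarrow> nat \<Rightarrow> ('k node \<Rightarrow> nat \<Rightarrow> 'm) \<Rightarrow> 'm set \<Rightarrow> 'k node set \<Rightarrow> ('f, 'p, unit, 'm)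
    pfm set" where
  "indisc_formulas L m a D Y = {pfm_iff (\<phi>, \<tau>) (\<phi>, \<tau>') | \<phi> \<tau> \<tau>'. wf_fm L \<phi> \<and>
     (\<exists>S. S \<subseteq> Y \<times> Y \<and> psim S \<and> (\<forall>v\<in>FV \<phi>.
        (\<tau> v = Inl () \<and> \<tau>' v = Inl ()) \<or>
        (\<exists>s t. \<tau> v = Inr s \<and> \<tau>' v = Inr t \<and> (s, t) \<in> pull m a S \<union> Id_on D)))}"

lemma type_formulas_mono:
  assumes "R \<subseteq> R'"
  shows "type_formulas L M b R \<subseteq> type_formulas L M b R'"
proof
  fix g assume "g \<in> type_formulas L M b R"
  then obtain \<phi> \<tau> e where g: "g = (\<phi>, \<tau>)" "wf_fm L \<phi>" "sat M e \<phi>"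
    "\<And>v. v \<in> FV \<phi> \<Longrightarrow> case \<tau> v of Inl _ \<Rightarrow> e v = b | Inr t \<Rightarrow> (e v, t) \<in> R"
    unfolding type_formulas_def by blast
  have "case \<tau> v of Inl _ \<Rightarrow> e v = b | Inr t \<Rightarrow> (e v, t) \<in> R'" if "v \<in> FV \<phi>" for v
    using g(4)[OF that] assms by (auto split: sum.splits)
  then show "g \<in> type_formulas L M b R'" unfolding g(1) type_formulas_def using g(2,3) by blast
qed

lemma indisc_formulas_mono:
  assumes "Y \<subseteq> Y'"
  shows "indisc_formulas L m a D Y \<subseteq> indisc_formulas L m a D Y'"
proof -
  have "S \<subseteq> Y' \<times> Y'" if "S \<subseteq> Y \<times> Y" for S using that assms by blast
  then show ?thesis
    unfolding indisc_formulas_def by (intro Collect_mono ex_mono impI conj_mono) auto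
qed

lemma type_formulas_realised:
  fixes M :: "('f, 'p, 'm) struct"
  assumes "\<And>g. g \<in> type_formulas L M b R \<Longrightarrow> holds M (\<lambda>_. d) g"
  shows "elem L M (insert (b, d) R)"
  unfolding elem_def
proof (intro allI impI)
  fix \<phi> e e' assume w: "wf_fm L \<phi>" and e: "\<forall>v\<in>FV \<phi>. (e v, e' v) \<in> insert (b, d) R" and s:
    "sat M e \<phi>"
  \<comment> \<open>The pair \<open>(b, d)\<close> becomes the object variable; any other pair
    contributes its right entry as a parameter.\<close>
  define \<tau> :: "nat \<Rightarrow> unit + 'm" where "\<tau> v = (if (e v, e' v) = (b, d) then Inl () else Inr (e' v))"
    for v
  have "\<forall>v\<in>FV \<phi>. case \<tau> v of Inl _ \<Rightarrow> e v = b | Inr t \<Rightarrow> (e v, t) \<in> R"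
    using e unfolding \<tau>_def by auto
  then have "(\<phi>, \<tau>) \<in> type_formulas L M b R" unfolding type_formulas_def using w s by blast
  then have "sat M (\<lambda>v. case_sum (\<lambda>_. d) id (\<tau> v)) \<phi>" using assms unfolding holds_def by fastforce
  moreover have "(\<lambda>v. case_sum (\<lambda>_. d) id (\<tau> v)) = e'" unfolding \<tau>_def by auto
  ultimately show "sat M e' \<phi>" by simp
qed

lemma indisc_formulas_realised:
  fixes M :: "('f, 'p, 'm) struct"
  assumes "\<And>g. g \<in> indisc_formulas L m a D X \<Longrightarrow> holds M (\<lambda>_. d) g" "S \<subseteq> X \<times> X" "psim S"
  shows "elem L M (pull m a S \<union> Id_on (insert d D))"
  unfolding elem_def
proof (intro allI impI)
  fix \<phi> e e' assume w: "wf_fm L \<phi>" and e: "\<forall>v\<in>FV \<phi>. (e v, e' v) \<in> pull m a S \<union> Id_on (insert d D)"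
    and s: "sat M e \<phi>"
  \<comment> \<open>The pair \<open>(d, d)\<close> becomes the object variable; for the others
    \<open>f\<close> selects the left or the right entry.\<close>
  define \<tau> :: "('m \<Rightarrow> 'm \<Rightarrow> 'm) \<Rightarrow> nat \<Rightarrow> unit + 'm"
    where "\<tau> f v = (if e v = d \<and> e' v = d then Inl () else Inr (f (e v) (e' v)))" for f v
  have "\<forall>v\<in>FV \<phi>. (\<tau> (\<lambda>x y. x) v = Inl () \<and> \<tau> (\<lambda>x y. y) v = Inl ()) \<or>
      (\<exists>s t. \<tau> (\<lambda>x y. x) v = Inr s \<and> \<tau> (\<lambda>x y. y) v = Inr t \<and> (s, t) \<in> pull m a S \<union> Id_on D)"
    using e unfolding \<tau>_def by auto
  then have "pfm_iff (\<phi>, \<tau> (\<lambda>x y. x)) (\<phi>, \<tau> (\<lambda>x y. y)) \<in> indisc_formulas L m a D X"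
    unfolding indisc_formulas_def using w assms(2,3) by blast
  from assms(1)[OF this]
  have "sat M (\<lambda>v. case_sum (\<lambda>_. d) id (\<tau> (\<lambda>x y. x) v)) \<phi> \<longleftrightarrow>
    sat M (\<lambda>v. case_sum (\<lambda>_. d) id (\<tau> (\<lambda>x y. y) v)) \<phi>"
    unfolding holds_pfm_iff unfolding holds_def by simp
  moreover have "(\<lambda>v. case_sum (\<lambda>_. d) id (\<tau> (\<lambda>x y. x) v)) = e"
    "(\<lambda>v. case_sum (\<lambda>_. d) id (\<tau> (\<lambda>x y. y) v)) = e'"
    unfolding \<tau>_def by auto
  ultimately show "sat M e' \<phi>" using s by simp
qed

lemma type_formulas_finitary:
  assumes "g \<in> type_formulas L M b (Q \<union> Id_on (pts m a X))"
  obtains Y where "finite Y" "Y \<subseteq> X" "g \<in> type_formulas L M b (Q \<union> Id_on (pts m a Y))"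
proof -
  obtain \<phi> \<tau> e where g: "g = (\<phi>, \<tau>)" "wf_fm L \<phi>" "sat M e \<phi>"
    "\<And>v. v \<in> FV \<phi> \<Longrightarrow> case \<tau> v of Inl _ \<Rightarrow> e v = b | Inr t \<Rightarrow> (e v, t) \<in> Q \<union> Id_on (pts m a X)"
    using assms unfolding type_formulas_def by blast
  have "\<exists>Y. finite Y \<and> Y \<subseteq> X \<and> (case \<tau> v of Inl _ \<Rightarrow> e v = b | Inr t \<Rightarrow> (e v, t) \<in> Q
    \<union> Id_on (pts m a Y))"
    if v: "v \<in> FV \<phi>" for v
  proof (cases "\<exists>t. \<tau> v = Inr t \<and> (e v, t) \<notin> Q")
    case True
    then obtain t where t: "\<tau> v = Inr t" "(e v, t) \<in> Id_on (pts m a X)" using g(4)[OF v] by auto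
    then obtain u q where u: "u \<in> X" "q < m" "e v = a u q" "t = a u q" unfolding pts_def by auto
    then have "(e v, t) \<in> Id_on (pts m a {u})" unfolding pts_def by auto
    then show ?thesis using u(1) t(1) by (intro exI[of _ "{u}"]) simp
  next
    case False
    then show ?thesis using g(4)[OF v] by (intro exI[of _ "{}"]) (auto split: sum.splits)
  qed
  then obtain F where F: "\<And>v. v \<in> FV \<phi> \<Longrightarrow> finite (F v) \<and> F v \<subseteq> X \<and>
      (case \<tau> v of Inl _ \<Rightarrow> e v = b | Inr t \<Rightarrow> (e v, t) \<in> Q \<union> Id_on (pts m a (F v)))" by metis
  define Y where "Y = (\<Union>v\<in>FV \<phi>. F v)"
  have "case \<tau> v of Inl _ \<Rightarrow> e v = b | Inr t \<Rightarrow> (e v, t) \<in> Q \<union> Id_on (pts m a Y)" if v: "v \<in> FV \<phi>"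
    for v
  proof -
    have "pts m a (F v) \<subseteq> pts m a Y" unfolding Y_def using v by (intro pts_mono) blast
    then show ?thesis using F[OF v] by (auto split: sum.splits)
  qed
  then have "g \<in> type_formulas L M b (Q \<union> Id_on (pts m a Y))"
    unfolding g(1) type_formulas_def using g(2,3) by blast
  moreover have "finite Y" "Y \<subseteq> X" unfolding Y_def using F finite_FV by blast+
  ultimately show ?thesis using that by blast
qed

lemma indisc_formulas_finitary:
  assumes "g \<in> indisc_formulas L m a D X"
  obtains Y where "finite Y" "Y \<subseteq> X" "g \<in> indisc_formulas L m a D Y"
proof -
  obtain \<phi> \<tau> \<tau>' S where g: "g = pfm_iff (\<phi>, \<tau>) (\<phi>, \<tau>')" "wf_fm L \<phi>" "S \<subseteq> X \<times> X" "psim S"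
    "\<And>v. v \<in> FV \<phi> \<Longrightarrow> (\<tau> v = Inl () \<and> \<tau>' v = Inl ()) \<or>
        (\<exists>s t. \<tau> v = Inr s \<and> \<tau>' v = Inr t \<and> (s, t) \<in> pull m a S \<union> Id_on D)"
    using assms unfolding indisc_formulas_def by blast
  have "\<exists>S0. finite S0 \<and> S0 \<subseteq> S \<and> ((\<tau> v = Inl () \<and> \<tau>' v = Inl ()) \<or>
        (\<exists>s t. \<tau> v = Inr s \<and> \<tau>' v = Inr t \<and> (s, t) \<in> pull m a S0 \<union> Id_on D))"
    if v: "v \<in> FV \<phi>" for v
  proof (cases "\<exists>s t. \<tau> v = Inr s \<and> \<tau>' v = Inr t \<and> (s, t) \<in> pull m a S")
    case True
    then obtain u u' q where u: "(u, u') \<in> S" "q < m" "\<tau> v = Inr (a u q)" "\<tau>' v = Inr (a u' q)"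
      unfolding pull_def by auto
    then have "(a u q, a u' q) \<in> pull m a {(u, u')}" unfolding pull_def by blast
    then show ?thesis using u by (intro exI[of _ "{(u, u')}"]) auto
  next
    case False
    then show ?thesis using g(5)[OF v] by (intro exI[of _ "{}"]) auto
  qed
  then obtain F where F: "\<And>v. v \<in> FV \<phi> \<Longrightarrow> finite (F v) \<and> F v \<subseteq> S \<and> ((\<tau> v = Inl () \<and> \<tau>' v = Inl ()) \<or>
        (\<exists>s t. \<tau> v = Inr s \<and> \<tau>' v = Inr t \<and> (s, t) \<in> pull m a (F v) \<union> Id_on D))" by metis
  define S0 where "S0 = (\<Union>v\<in>FV \<phi>. F v)"
  define Y where "Y = fst ` S0 \<union> snd ` S0"
  have S0: "finite S0" "S0 \<subseteq> S" unfolding S0_def using F finite_FV by blast+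
  have "(\<tau> v = Inl () \<and> \<tau>' v = Inl ()) \<or>
        (\<exists>s t. \<tau> v = Inr s \<and> \<tau>' v = Inr t \<and> (s, t) \<in> pull m a S0 \<union> Id_on D)" if v: "v \<in> FV \<phi>" for v
  proof -
    have "pull m a (F v) \<subseteq> pull m a S0" unfolding S0_def using v by (intro pull_mono) blast
    then show ?thesis using F[OF v] by blast
  qed
  moreover have "S0 \<subseteq> Y \<times> Y" unfolding Y_def by force
  ultimately have "g \<in> indisc_formulas L m a D Y"
    unfolding indisc_formulas_def using g(1,2) psim_mono[OF g(4) S0(2)] by blast
  moreover have "finite Y" "Y \<subseteq> X" unfolding Y_def using S0 g(3) by auto
  ultimately show ?thesis using that by blast
qed

text \<open>Whether a formula of \<open>indisc_formulas\<close> holds at the image of \<open>b'\<close> under a partial elementary map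
  that takes \<open>a (f u)\<close> to \<open>a u\<close> is a statement about the value of one colour \<open>P\<close>, read off at \<open>b'\<close>,
  on two similar assignments \<open>U\<close>, \<open>U'\<close> of nodes.\<close>

definition coloured ::
  "('f, 'p) lang \<Rightarrow> ('f, 'p, 'm) struct \<Rightarrow> nat \<Rightarrow> ('k node \<Rightarrow> nat \<Rightarrow> 'm) \<Rightarrow> 'm set \<Rightarrow> 'k node set \<Rightarrow> 'm \<Rightarrow>
   ('f, 'p, unit, 'm) pfm \<Rightarrow> nat set \<Rightarrow> ((nat \<Rightarrow> 'k node) \<Rightarrow> bool) \<Rightarrow> (nat \<Rightarrow> 'k node) \<Rightarrow> (nat \<Rightarrow> 'k node)
     \<Rightarrow> bool"
  where
  "coloured L M m a D Y b' g V P U U' \<longleftrightarrow> finite V \<and>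
     (\<forall>w w'. (\<forall>v\<in>V. w v = w' v) \<longrightarrow> P w = P w') \<and>
     U ` V \<subseteq> Y \<and> U' ` V \<subseteq> Y \<and> psim {(U v, U' v) | v. v \<in> V} \<and>
     (\<forall>f d. elem L M (insert (b', d) (pull m a {(f u, u) | u. u \<in> Y} \<union> Id_on D)) \<longrightarrow>
        P (\<lambda>v. f (U v)) = P (\<lambda>v. f (U' v)) \<longrightarrow> holds M (\<lambda>_. d) g)"

lemma colouredD:
  assumes "coloured L M m a D Y b' g V P U U'"
  shows "finite V" "\<And>w w'. (\<And>v. v \<in> V \<Longrightarrow> w v = w' v) \<Longrightarrow> P w = P w'"
    "U ` V \<subseteq> Y" "U' ` V \<subseteq> Y" "psim {(U v, U' v) | v. v \<in> V}"
    "\<And>f d. elem L M (insert (b', d) (pull m a {(f u, u) | u. u \<in> Y} \<union> Id_on D)) \<Longrightarrow>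
       P (\<lambda>v. f (U v)) = P (\<lambda>v. f (U' v)) \<Longrightarrow> holds M (\<lambda>_. d) g"
proof -
  note c = assms[unfolded coloured_def]
  show "finite V" "U ` V \<subseteq> Y" "U' ` V \<subseteq> Y" "psim {(U v, U' v) | v. v \<in> V}" using c by simp_all
  show "P w = P w'" if "\<And>v. v \<in> V \<Longrightarrow> w v = w' v" for w w'
    by (rule c[THEN conjunct2, THEN conjunct1, rule_format]) (rule that)
  show "holds M (\<lambda>_. d) g" if "elem L M (insert (b', d) (pull m a {(f u, u) | u. u \<in> Y} \<union> Id_on D))"
    "P (\<lambda>v. f (U v)) = P (\<lambda>v. f (U' v))" for f d
    by (rule c[THEN conjunct2, THEN conjunct2, THEN conjunct2, THEN conjunct2, THEN conjunct2,
      rule_format])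
      (rule that)+
qed

text \<open>The nodes are the only moving part: the parameters from \<open>D\<close> and the
  coordinates \<open>q\<close> are kept, and \<open>P\<close> evaluates \<phi> at \<open>b'\<close>
  with varying nodes at the variables in \<open>V\<close>. The elementary relation transports its
  two values to the two sides of the equivalence \<open>g\<close>.\<close>

lemma indisc_formula_coloured:
  assumes "g \<in> indisc_formulas L m a D Y"
  shows "\<exists>V P U U'. coloured L M m a D Y b' g V P U U'"
proof -
  obtain \<phi> \<tau> \<tau>' S where g: "g = pfm_iff (\<phi>, \<tau>) (\<phi>, \<tau>')" "wf_fm L \<phi>" "S \<subseteq> Y \<times> Y" "psim S"
    "\<And>v. v \<in> FV \<phi> \<Longrightarrow> (\<tau> v = Inl () \<and> \<tau>' v = Inl ()) \<or>
        (\<exists>s t. \<tau> v = Inr s \<and> \<tau>' v = Inr t \<and> (s, t) \<in> pull m a S \<union> Id_on D)"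
    using assms unfolding indisc_formulas_def by blast
  define V where "V = {v \<in> FV \<phi>. \<exists>s t. \<tau> v = Inr s \<and> \<tau>' v = Inr t \<and> (s, t) \<in> pull m a S}"
  have "\<exists>u u' q. (u, u') \<in> S \<and> q < m \<and> \<tau> v = Inr (a u q) \<and> \<tau>' v = Inr (a u' q)" if "v \<in> V" for v
    using that unfolding V_def pull_def by auto
  then obtain U U' q where U: "\<And>v. v \<in> V \<Longrightarrow> (U v, U' v) \<in> S \<and> q v < m \<and>
      \<tau> v = Inr (a (U v) (q v)) \<and> \<tau>' v = Inr (a (U' v) (q v))" by metis
  have notV: "(\<tau> v = Inl () \<and> \<tau>' v = Inl ()) \<or> (\<exists>c\<in>D. \<tau> v = Inr c \<and> \<tau>' v = Inr c)"
    if "v \<in> FV \<phi>" "v \<notin> V" for v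
    using g(5)[OF that(1)] that unfolding V_def by auto
  define env where "env w v = (if v \<in> V then a (w v) (q v) else case_sum (\<lambda>_. b') id (\<tau> v))" for w v
  define P where "P w \<longleftrightarrow> sat M (env w) \<phi>" for w
  have "coloured L M m a D Y b' g V P U U'"
    unfolding coloured_def
  proof (intro conjI allI impI)
    show "finite V" unfolding V_def using finite_FV by (auto intro: finite_subset)
    show "P w = P w'" if "\<forall>v\<in>V. w v = w' v" for w w'
      unfolding P_def by (rule sat_cong) (use that in \<open>simp add: env_def\<close>)
    show "U ` V \<subseteq> Y" "U' ` V \<subseteq> Y" using U g(3) by blast+
    show "psim {(U v, U' v) | v. v \<in> V}" by (rule psim_mono[OF g(4)]) (use U in blast)
    fix f d assume el: "elem L M (insert (b', d) (pull m a {(f u, u) | u. u \<in> Y} \<union> Id_on D))"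
      and P: "P (\<lambda>v. f (U v)) = P (\<lambda>v. f (U' v))"
    have inR: "(a (f u) k, a u k) \<in> pull m a {(f u, u) | u. u \<in> Y}" if "u \<in> Y" "k < m" for u k
      using that unfolding pull_def by blast
    \<comment> \<open>Used with \<open>\<tau>\<close> and with \<open>\<tau>'\<close> for
      \<open>\<sigma>\<close>, where \<open>Z\<close> gives the nodes; on free variables outside
      \<open>V\<close> the two agree.\<close>
    have key: "P (\<lambda>v. f (Z v)) \<longleftrightarrow> sat M (\<lambda>v. case_sum (\<lambda>_. d) id (\<sigma> v)) \<phi>"
      if \<sigma>: "\<And>v. v \<in> V \<Longrightarrow> Z v \<in> Y \<and> q v < m \<and> \<sigma> v = Inr (a (Z v) (q v))"
        "\<And>v. v \<in> FV \<phi> \<Longrightarrow> v \<notin> V \<Longrightarrow> \<sigma> v = \<tau> v" for Z \<sigma>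
      unfolding P_def
    proof (rule elem_sat_iff[OF el g(2)])
      fix v assume v: "v \<in> FV \<phi>"
      show "(env (\<lambda>v. f (Z v)) v, case_sum (\<lambda>_. d) id (\<sigma> v))
        \<in> insert (b', d) (pull m a {(f u, u) | u. u \<in> Y} \<union> Id_on D)"
      proof (cases "v \<in> V")
        case True
        then show ?thesis using \<sigma>(1)[OF True] inR[of "Z v" "q v"] unfolding env_def by auto
      next
        case False
        then show ?thesis using notV[OF v False] \<sigma>(2)[OF v False] unfolding env_def by auto
      qed
    qed
    have 1: "P (\<lambda>v. f (U v)) \<longleftrightarrow> sat M (\<lambda>v. case_sum (\<lambda>_. d) id (\<tau> v)) \<phi>"
      by (rule key) (use U g(3) in blast)+
    have "\<tau>' v = \<tau> v" if "v \<in> FV \<phi>" "v \<notin> V" for v using notV[OF that] by auto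
    then have 2: "P (\<lambda>v. f (U' v)) \<longleftrightarrow> sat M (\<lambda>v. case_sum (\<lambda>_. d) id (\<tau>' v)) \<phi>"
      by (intro key) (use U g(3) in blast)+
    show "holds M (\<lambda>_. d) g"
      using 1 2 P unfolding g(1) holds_pfm_iff unfolding holds_def by simp
  qed
  then show ?thesis by blast
qed

text \<open>\<open>Q i\<close> leads from the parameters \<open>E\<close> next to \<open>b\<close>
  to the parameters \<open>D\<close> next to \<open>b'\<close>. For a finite part of the formulas,
  \<open>d\<close> is the image of \<open>b'\<close> under an automorphism that fixes
  \<open>D\<close> and moves a Ramsey copy of \<open>Y\<close> back to \<open>Y\<close>; its type is
  right because over \<open>b\<close> and \<open>E\<close> the copy cannot be told from
  \<open>Y\<close>.\<close>

lemma indiscernible_realisation: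
  fixes Q :: "'i \<Rightarrow> ('m \<times> 'm) set" and a :: "'k node \<Rightarrow> nat \<Rightarrow> 'm"
  assumes M: "is_struct L M" "saturated L lam M" "strongly_homogeneous L lam M"
    and X: "universal_antichain \<kappa> X"
    and D: "D \<union> pts m a T \<subseteq> carrier M" "|D \<union> pts m a T| <o lam"
    and a: "strongly_indiscernible L M \<kappa> m a D"
    and Q: "\<And>i. i \<in> A \<Longrightarrow> Q i \<subseteq> E \<times> D"
    and delta: "\<And>S. S \<subseteq> X \<times> X \<Longrightarrow> psim S \<Longrightarrow> elem L M (pull m a S \<union> Id_on (insert b E))"
    and b': "b' \<in> carrier M" "\<And>i. i \<in> A \<Longrightarrow> elem L M (insert (b, b') (Q i \<union> Id_on (pts m a X)))"
  obtains d where "d \<in> carrier M" "\<And>i. i \<in> A \<Longrightarrow> elem L M (insert (b, d) (Q i \<union> Id_on (pts m a X)))"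
    "\<And>S. S \<subseteq> X \<times> X \<Longrightarrow> psim S \<Longrightarrow> elem L M (pull m a S \<union> Id_on (insert d D))"
proof -
  have XT: "X \<subseteq> T" and anti: "antichain \<kappa> X"
    using X unfolding universal_antichain_def antichain_def by blast+
  define \<Gamma> where "\<Gamma> Y = (\<Union>i\<in>A. type_formulas L M b (Q i \<union> Id_on (pts m a Y)))
    \<union> indisc_formulas L m a D Y" for Y
  have \<Gamma>_mono: "\<Gamma> Y \<subseteq> \<Gamma> Y'" if "Y \<subseteq> Y'" for Y Y'
  proof -
    have "type_formulas L M b (Q i \<union> Id_on (pts m a Y)) \<subseteq> type_formulas L M b (Q i
      \<union> Id_on (pts m a Y'))" for i
      using pts_mono[OF that, of m a] by (intro type_formulas_mono) auto
    then show ?thesis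
      unfolding \<Gamma>_def by (intro Un_mono UN_mono order_refl indisc_formulas_mono[OF that])
  qed
  have cons: "consistent M (\<Gamma> X)"
    unfolding consistent_def
  proof (intro allI impI)
    fix \<Gamma>0 assume \<Gamma>0: "finite \<Gamma>0 \<and> \<Gamma>0 \<subseteq> \<Gamma> X"
    have "\<exists>Y. finite Y \<and> Y \<subseteq> X \<and> g \<in> \<Gamma> Y" if "g \<in> \<Gamma>0" for g
    proof -
      have "g \<in> \<Gamma> X" using \<Gamma>0 that by blast
      then consider i where "i \<in> A" "g \<in> type_formulas L M b (Q i \<union> Id_on (pts m a X))"
        | "g \<in> indisc_formulas L m a D X" unfolding \<Gamma>_def by blast
      then show ?thesis
      proof cases
        case 1
        then show ?thesis using type_formulas_finitary[OF 1(2)] unfolding \<Gamma>_def by (metis UN_I UnI1)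
      next
        case 2
        then show ?thesis using indisc_formulas_finitary[OF 2] unfolding \<Gamma>_def by (metis UnI2)
      qed
    qed
    then obtain Yof where Yof: "\<And>g. g \<in> \<Gamma>0 \<Longrightarrow> finite (Yof g) \<and> Yof g \<subseteq> X \<and> g \<in> \<Gamma> (Yof g)" by metis
    define Y where "Y = (\<Union>g\<in>\<Gamma>0. Yof g)"
    have Y: "finite Y" "Y \<subseteq> X" unfolding Y_def using Yof \<Gamma>0 by blast+
    have in_\<Gamma>Y: "g \<in> \<Gamma> Y" if "g \<in> \<Gamma>0" for g
    proof -
      have "Yof g \<subseteq> Y" unfolding Y_def using that by blast
      then show ?thesis using Yof[OF that] \<Gamma>_mono by blast
    qed
    have antiY: "antichain \<kappa> Y" using anti Y(2) unfolding antichain_def by blast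
    define \<Gamma>1 where "\<Gamma>1 = \<Gamma>0 \<inter> indisc_formulas L m a D Y"
    have "\<exists>V P U U'. coloured L M m a D Y b' g V P U U'" if "g \<in> \<Gamma>1" for g
      by (rule indisc_formula_coloured) (use that in \<open>simp add: \<Gamma>1_def\<close>)
    then obtain V P U U' where VP: "\<And>g. g \<in> \<Gamma>1 \<Longrightarrow> coloured L M m a D Y b' g (V g) (P g) (U g) (U' g)"
      by metis
    define \<Theta> where "\<Theta> = (\<lambda>g. (V g, P g)) ` \<Gamma>1"
    have fin: "finite \<Theta>" unfolding \<Theta>_def \<Gamma>1_def using \<Gamma>0 by blast
    have finV: "finite W" if "(W, p) \<in> \<Theta>" for W p
      using that colouredD(1)[OF VP] unfolding \<Theta>_def by auto
    have dep: "p w = p w'" if "(W, p) \<in> \<Theta>" "\<And>v. v \<in> W \<Longrightarrow> w v = w' v" for W p w w'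
    proof -
      obtain g where "g \<in> \<Gamma>1" "W = V g" "p = P g" using \<open>(W, p) \<in> \<Theta>\<close> unfolding \<Theta>_def by blast
      then show ?thesis using colouredD(2)[OF VP, of g w w'] that(2) by simp
    qed
    obtain f where f: "f ` Y \<subseteq> X" "psim {(y, f y) | y. y \<in> Y}"
      and hom: "\<And>V P u u'. (V, P) \<in> \<Theta> \<Longrightarrow> u ` V \<subseteq> Y \<Longrightarrow> u' ` V \<subseteq> Y \<Longrightarrow> psim {(u v, u' v) | v. v \<in> V} \<Longrightarrow>
        P (\<lambda>v. f (u v)) = P (\<lambda>v. f (u' v))"
      by (rule ramsey_antichain_assignments[OF X Y(1) antiY fin finV dep]) (assumption | rule that)+
    have "{(y, f y) | y. y \<in> Y}\<inverse> = {(f y, y) | y. y \<in> Y}" by blast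
    then have ps: "psim {(f y, y) | y. y \<in> Y}" using psim_converse[OF f(2)] by simp
    define R where "R = pull m a {(f y, y) | y. y \<in> Y} \<union> Id_on D"
    have "elem L M R" using a ps unfolding strongly_indiscernible_iff R_def by blast
    moreover have R_sub: "R \<subseteq> (D \<union> pts m a T) \<times> (D \<union> pts m a T)"
      unfolding R_def pull_def pts_def using f(1) Y(2) XT by blast
    moreover have "|Domain R| <o lam"
      using R_sub by (intro ordLeq_ordLess_trans[OF card_of_mono1 D(2)]) blast
    ultimately obtain h where h: "automorphism L M h" "\<And>s t. (s, t) \<in> R \<Longrightarrow> h s = t"
      using D(1) by (rule_tac elem_extends_to_automorphism[OF M(3), of R]) blast+
    define d where "d = h b'"
    have elh: "elem L M {(s, h s) | s. s \<in> carrier M}" using elem_automorphism[OF M(1) h(1)] .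
    have "insert (b', d) R \<subseteq> {(s, h s) | s. s \<in> carrier M}"
      using h(2) R_sub D(1) b'(1) unfolding d_def by blast
    then have eld: "elem L M (insert (b', d) R)" using elem_mono[OF elh] by blast
    have type: "elem L M (insert (b, d) (Q i \<union> Id_on (pts m a Y)))" if i: "i \<in> A" for i
    proof -
      \<comment> \<open>From \<open>b\<close> to \<open>d\<close> in three moves: \<open>?R1\<close>
        replaces \<open>Y\<close> by its copy and fixes \<open>b\<close> and \<open>E\<close>;
        \<open>?R2\<close> goes from \<open>b\<close> to \<open>b'\<close> and along
        \<open>Q i\<close>, fixing the copy; \<open>?R3\<close> belongs to the automorphism, which
        fixes \<open>D\<close> and moves the copy back.\<close>
      let ?R1 = "pull m a {(y, f y) | y. y \<in> Y} \<union> Id_on (insert b E)"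
      let ?R2 = "insert (b, b') (Q i \<union> Id_on (pts m a X))"
      let ?R3 = "insert (b', d) R"
      have "elem L M ?R1" using f(1) Y(2) by (intro delta f(2)) blast
      then have el: "elem L M (?R1 O ?R2 O ?R3)"
        using elem_relcomp[OF _ elem_relcomp[OF b'(2)[OF i] eld]] by blast
      have "insert (b, d) (Q i \<union> Id_on (pts m a Y)) \<subseteq> ?R1 O ?R2 O ?R3"
      proof
        fix z assume "z \<in> insert (b, d) (Q i \<union> Id_on (pts m a Y))"
        then consider "z = (b, d)" | s t where "z = (s, t)" "(s, t) \<in> Q i"
          | x where "z = (x, x)" "x \<in> pts m a Y" by (cases z) auto
        then show "z \<in> ?R1 O ?R2 O ?R3"
        proof cases
          case 1
          have "(b, b) \<in> ?R1" "(b, b') \<in> ?R2" "(b', d) \<in> ?R3" by auto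
          then show ?thesis unfolding 1 by (intro relcompI)
        next
          case 2
          then have "s \<in> E" "t \<in> D" using Q[OF i] by blast+
          then have "(s, s) \<in> ?R1" "(s, t) \<in> ?R2" "(t, t) \<in> ?R3" using 2(2) unfolding R_def by auto
          then show ?thesis unfolding 2(1) by (intro relcompI)
        next
          case 3
          then obtain u q where u: "u \<in> Y" "q < m" "x = a u q" unfolding pts_def by blast
          then have "(a u q, a (f u) q) \<in> pull m a {(y, f y) | y. y \<in> Y}"
            "(a (f u) q, a u q) \<in> pull m a {(f y, y) | y. y \<in> Y}" unfolding pull_def by blast+
          then have "(x, a (f u) q) \<in> ?R1" "(a (f u) q, x) \<in> ?R3" unfolding R_def u(3) by auto
          moreover have "a (f u) q \<in> pts m a X" using u f(1) unfolding pts_def by blast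
          then have "(a (f u) q, a (f u) q) \<in> ?R2" by auto
          ultimately show ?thesis unfolding 3(1) by (intro relcompI)
        qed
      qed
      then show ?thesis using elem_mono[OF el] by blast
    qed
    have "holds M (\<lambda>_. d) g" if g: "g \<in> \<Gamma>0" for g
    proof (cases "g \<in> indisc_formulas L m a D Y")
      case True
      then have g1: "g \<in> \<Gamma>1" using g unfolding \<Gamma>1_def by blast
      then have "(V g, P g) \<in> \<Theta>" unfolding \<Theta>_def by blast
      from hom[OF this colouredD(3-5)[OF VP[OF g1]]] show ?thesis
        by (rule colouredD(6)[OF VP[OF g1] eld[unfolded R_def]])
    next
      case False
      then obtain i where i: "i \<in> A" "g \<in> type_formulas L M b (Q i \<union> Id_on (pts m a Y))"
        using in_\<Gamma>Y[OF g] unfolding \<Gamma>_def by blast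
      then obtain \<phi> \<tau> e where e: "g = (\<phi>, \<tau>)" "wf_fm L \<phi>" "sat M e \<phi>"
        "\<And>v. v \<in> FV \<phi> \<Longrightarrow> case \<tau> v of Inl _ \<Rightarrow> e v = b | Inr t \<Rightarrow> (e v, t) \<in> Q i \<union> Id_on (pts m a Y)"
        unfolding type_formulas_def by blast
      have "sat M e \<phi> \<longleftrightarrow> sat M (\<lambda>v. case_sum (\<lambda>_. d) id (\<tau> v)) \<phi>"
      proof (rule elem_sat_iff[OF type[OF i(1)] e(2)])
        fix v assume "v \<in> FV \<phi>"
        from e(4)[OF this] show "(e v, case_sum (\<lambda>_. d) id (\<tau> v)) \<in> insert (b, d) (Q i
          \<union> Id_on (pts m a Y))"
          by (auto split: sum.splits)
      qed
      then show ?thesis using e(1,3) unfolding holds_def by simp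
    qed
    moreover have "d \<in> carrier M"
      using h(1) b'(1) unfolding d_def automorphism_def bij_betw_def by blast
    ultimately show "\<exists>d\<in>carrier M. \<forall>g\<in>\<Gamma>0. holds M (\<lambda>_. d) g" by blast
  qed
  have sub: "\<Gamma> X \<subseteq> pfms L UNIV (D \<union> pts m a T)"
  proof
    fix g assume "g \<in> \<Gamma> X"
    then consider i where "i \<in> A" "g \<in> type_formulas L M b (Q i \<union> Id_on (pts m a X))"
      | "g \<in> indisc_formulas L m a D X" unfolding \<Gamma>_def by blast
    then show "g \<in> pfms L UNIV (D \<union> pts m a T)"
    proof cases
      case 1
      then obtain \<phi> \<tau> e where e: "g = (\<phi>, \<tau>)" "wf_fm L \<phi>"
        "\<And>v. v \<in> FV \<phi> \<Longrightarrow> case \<tau> v of Inl _ \<Rightarrow> e v = b | Inr t \<Rightarrow> (e v, t) \<in> Q i \<union> Id_on (pts m a X)"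
        unfolding type_formulas_def by blast
      have "\<tau> v \<in> UNIV <+> (D \<union> pts m a T)" if "v \<in> FV \<phi>" for v
        using e(3)[OF that] Q[OF 1(1)] pts_mono[OF XT, of m a] by (auto split: sum.splits)
      then show ?thesis using e(1,2) unfolding pfms_def by auto
    next
      case 2
      then obtain \<phi> \<tau> \<tau>' S where g: "g = pfm_iff (\<phi>, \<tau>) (\<phi>, \<tau>')" "wf_fm L \<phi>" "S \<subseteq> X \<times> X"
        "\<And>v. v \<in> FV \<phi> \<Longrightarrow> (\<tau> v = Inl () \<and> \<tau>' v = Inl ()) \<or>
            (\<exists>s t. \<tau> v = Inr s \<and> \<tau>' v = Inr t \<and> (s, t) \<in> pull m a S \<union> Id_on D)"
        unfolding indisc_formulas_def by blast
      have "pull m a S \<subseteq> pts m a T \<times> pts m a T" unfolding pull_def pts_def using g(3) XT by blast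
      then have "\<tau> v \<in> UNIV <+> (D \<union> pts m a T) \<and> \<tau>' v \<in> UNIV <+> (D \<union> pts m a T)"
        if "v \<in> FV \<phi>" for v
        using g(4)[OF that] by auto
      then have "(\<phi>, \<tau>) \<in> pfms L UNIV (D \<union> pts m a T)" "(\<phi>, \<tau>') \<in> pfms L UNIV (D \<union> pts m a T)"
        using g(2) unfolding pfms_def by auto
      then show ?thesis unfolding g(1) by (rule pfm_iff_pfms)
    qed
  qed
  from saturatedD[OF M(2) D sub cons] obtain d where
    d: "d \<in> carrier M" "\<And>g. g \<in> \<Gamma> X \<Longrightarrow> holds M (\<lambda>_. d) g" by blast
  show ?thesis
  proof (rule that[OF d(1)])
    show "elem L M (insert (b, d) (Q i \<union> Id_on (pts m a X)))" if "i \<in> A" for i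
      by (rule type_formulas_realised) (use d(2) that in \<open>auto simp: \<Gamma>_def\<close>)
    show "elem L M (pull m a S \<union> Id_on (insert d D))" if "S \<subseteq> X \<times> X" "psim S" for S
      by (rule indisc_formulas_realised[OF _ that]) (use d(2) in \<open>auto simp: \<Gamma>_def\<close>)
  qed
qed

section \<open>Pairs of translates\<close>

lemma pull_conc_rel: "pull m a (conc_rel \<nu> S) = pull m (\<lambda>u. a (conc \<kappa> \<nu> u)) S"
  unfolding pull_def conc_rel_def by blast

lemma conc_rel_subset: "S \<subseteq> Z \<times> Z \<Longrightarrow> conc_rel \<nu> S \<subseteq> conc \<kappa> \<nu> ` Z \<times> conc \<kappa> \<nu> ` Z"
  unfolding conc_rel_def by auto

text \<open>A similarity above \<nu>, completed by the identity above \<xi>, is again a similarity.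
  So the elements above \<xi> may join the parameters.\<close>

lemma strongly_indiscernible_translate:
  assumes "strongly_indiscernible L M \<kappa> m a C" "perp \<nu> \<xi>" "\<nu> \<in> T" "\<xi> \<in> T" "Z \<subseteq> T"
  shows "strongly_indiscernible L M \<kappa> m (\<lambda>u. a (conc \<kappa> \<nu> u)) (C \<union> pts m (\<lambda>u. a (conc \<kappa> \<xi> u)) Z)"
  unfolding strongly_indiscernible_iff
proof (intro allI impI)
  fix S assume "psim S"
  then have "psim (conc_rel \<nu> S \<union> conc_rel \<xi> (Id_on Z))"
    using psim_Id_on assms(2-5) by (intro psim_conc_Un)
  then have "elem L M (pull m a (conc_rel \<nu> S \<union> conc_rel \<xi> (Id_on Z)) \<union> Id_on C)"
    using assms(1) unfolding strongly_indiscernible_iff by blast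
  then show "elem L M (pull m (\<lambda>u. a (conc \<kappa> \<nu> u)) S \<union> Id_on (C \<union> pts m (\<lambda>u. a (conc \<kappa> \<xi> u)) Z))"
    unfolding pull_Un pull_conc_rel pull_Id_on by (rule elem_mono) auto
qed

lemma small_Un_pts:
  assumes "Card_order lam" "\<not> finite (Field lam)" "|T| <o lam" "|C| <o lam"
  shows "|C \<union> pts m a T| <o lam"
proof (induction m)
  case 0
  have "pts 0 a T = {}" unfolding pts_def by blast
  then show ?case using assms(4) by simp
next
  case (Suc m)
  have "C \<union> pts (Suc m) a T = (C \<union> pts m a T) \<union> (\<lambda>u. a u m) ` T"
    unfolding pts_def by (auto simp: less_Suc_eq)
  moreover have "|(\<lambda>u. a u m) ` T| <o lam" using ordLeq_ordLess_trans[OF card_of_image assms(3)] .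
  ultimately show ?case using card_of_Un_ordLess_infinite_Field[OF assms(2,1) Suc.IH] by simp
qed

text \<open>Translation is a similarity, so the part above \<nu> alone contains a copy of every
  finite antichain.\<close>

lemma universal_antichain_superset_translate:
  assumes "universal_antichain \<kappa> X" "antichain \<kappa> Z" "conc \<kappa> \<nu> ` X \<subseteq> Z" "\<nu> \<in> T"
  shows "universal_antichain \<kappa> Z"
  unfolding universal_antichain_def
proof (intro conjI allI impI)
  fix Y assume Y: "antichain \<kappa> Y \<and> finite Y"
  have XT: "X \<subseteq> T" using assms(1) unfolding universal_antichain_def antichain_def by blast
  have YT: "Y \<subseteq> T" using Y unfolding antichain_def by blast
  obtain g where g: "g ` Y \<subseteq> X" "psim {(y, g y) | y. y \<in> Y}"
    using universal_antichain_copy[OF assms(1)] Y by blast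
  have "psim ({(y, g y) | y. y \<in> Y} O {(u, conc \<kappa> \<nu> u) | u. u \<in> X})"
    using psim_relcomp[OF g(2) psim_translate[OF XT assms(4)]] .
  then have ps: "psim {(y, conc \<kappa> \<nu> (g y)) | y. y \<in> Y}" by (rule psim_mono) (use g(1) in blast)
  have "inj_on (\<lambda>y. conc \<kappa> \<nu> (g y)) Y"
  proof (rule inj_onI)
    fix x y assume "x \<in> Y" "y \<in> Y" and eq: "conc \<kappa> \<nu> (g x) = conc \<kappa> \<nu> (g y)"
    then have "(x, conc \<kappa> \<nu> (g x)) \<in> {(y, conc \<kappa> \<nu> (g y)) | y. y \<in> Y}"
      "(y, conc \<kappa> \<nu> (g y)) \<in> {(y, conc \<kappa> \<nu> (g y)) | y. y \<in> Y}" by blast+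
    from psim_functional[OF ps this] show "x = y" using eq by simp
  qed
  then have "bij_betw (\<lambda>y. conc \<kappa> \<nu> (g y)) Y ((\<lambda>y. conc \<kappa> \<nu> (g y)) ` Y)" by (simp add: bij_betw_def)
  moreover have "sim0 \<kappa> Y id (\<lambda>y. conc \<kappa> \<nu> (g y))"
  proof -
    have "(\<lambda>y. conc \<kappa> \<nu> (g y)) ` Y \<subseteq> T" using g(1) XT conc_tree[OF assms(4)] by blast
    then show ?thesis using sim0_iff_psim[of id Y "\<lambda>y. conc \<kappa> \<nu> (g y)"] YT ps by simp
  qed
  moreover have "(\<lambda>y. conc \<kappa> \<nu> (g y)) ` Y \<subseteq> Z" using g(1) assms(3) by blast
  ultimately show "\<exists>X\<^sub>0\<subseteq>Z. \<exists>f. bij_betw f Y X\<^sub>0 \<and> sim0 \<kappa> Y id f" by blast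
qed (rule assms(2))

lemma conc_cross_incomparable:
  assumes "perp \<nu> \<xi>" "\<nu> \<in> T" "\<xi> \<in> T"
  shows "\<not> conc \<kappa> \<nu> u \<subseteq>\<^sub>m conc \<kappa> \<xi> v"
  using perp_no_common_extension[OF assms, of "conc \<kappa> \<xi> v"] conc_extends[of \<xi> v]
    map_le_trans[OF conc_extends[of \<nu> u]] by blast

lemma antichain_translates:
  assumes "antichain \<kappa> X" "antichain \<kappa> X'" "perp \<nu> \<xi>" "\<nu> \<in> T" "\<xi> \<in> T"
  shows "antichain \<kappa> (conc \<kappa> \<nu> ` X \<union> conc \<kappa> \<xi> ` X')"
proof -
  have T: "X \<subseteq> T" "X' \<subseteq> T" using assms(1,2) unfolding antichain_def by blast+
  have same: "perp (conc \<kappa> \<rho> u) (conc \<kappa> \<rho> v)"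
    if "antichain \<kappa> Z" "\<rho> \<in> T" "u \<in> Z" "v \<in> Z" "conc \<kappa> \<rho> u \<noteq> conc \<kappa> \<rho> v" for Z \<rho> u v
  proof -
    have "u \<in> T" "v \<in> T" "perp u v" using that unfolding antichain_def by auto
    then show ?thesis using conc_le_iff[OF that(2)] unfolding perp_def by blast
  qed
  have cross: "perp (conc \<kappa> \<nu> u) (conc \<kappa> \<xi> v)" "perp (conc \<kappa> \<xi> v) (conc \<kappa> \<nu> u)" for u v
    using conc_cross_incomparable[OF assms(3-5)] conc_cross_incomparable[of \<xi> \<nu>]
      assms(3-5) perp_commute
    unfolding perp_def by blast+
  have "perp x y" if "x \<in> conc \<kappa> \<nu> ` X \<union> conc \<kappa> \<xi> ` X'" "y \<in> conc \<kappa> \<nu> ` X \<union> conc \<kappa> \<xi> ` X'" "x \<noteq> y"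
    for x y
    using that same[OF assms(1,4)] same[OF assms(2,5)] cross by (elim UnE imageE) simp_all
  moreover have "conc \<kappa> \<nu> ` X \<union> conc \<kappa> \<xi> ` X' \<subseteq> T" using conc_tree assms(4,5) T by blast
  ultimately show ?thesis unfolding antichain_def by blast
qed

text \<open>With ATP excluded the definition leaves consistency, and saturation replaces it by an
  actual element from which another collapse can start.\<close>

lemma collapsible_realised:
  assumes M: "saturated L lam M" "Card_order lam" "\<not> finite (Field lam)" "|T| <o lam"
    and coll: "collapsible L M lam \<kappa> A J X"
    and C: "C \<subseteq> carrier M" "|C| <o lam" and b: "b \<in> carrier M"
    and a: "\<And>u q. u \<in> T \<Longrightarrow> q < m \<Longrightarrow> a u q \<in> carrier M" "strongly_indiscernible L M \<kappa> m a C"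
    and i: "i \<in> A" "\<And>S. S \<subseteq> X i ` J \<times> X i ` J \<Longrightarrow> psim S \<Longrightarrow> elem L M (pull m a S \<union> Id_on (insert b C))"
    and no_ATP: "\<not> (\<exists>\<phi> y. witnesses_ATP L M \<phi> y)"
  obtains d where "d \<in> carrier M" "realises L M m a C A J X i b d"
proof -
  have XT: "X j ` J \<subseteq> T" if "j \<in> A" for j
    using coll that unfolding collapsible_def universal_antichain_def antichain_def by blast
  have delta: "delta_indiscernible L M \<kappa> (X i ` J) m a (insert b C)"
    unfolding delta_indiscernible_iff[OF XT[OF i(1)]] using i(2) by blast
  have cons: "consistent M (\<Union>j\<in>A. subst_z (\<lambda>(x, k). a (X j x) k) ` joint_type L M m a C J (X i) b)"
    using coll[unfolded collapsible_def, THEN conjunct2, THEN conjunct2, THEN conjunct2,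
      THEN conjunct2,
        rule_format, of C b m a i] C b a delta i(1) no_ATP by blast
  have sub: "C \<union> {a (X j x) q | j x q. j \<in> A \<and> x \<in> J \<and> q < m} \<subseteq> C \<union> pts m a T"
    using XT unfolding pts_def by blast
  have "pts m a T \<subseteq> carrier M" using a(1) unfolding pts_def by blast
  then have carr: "C \<union> {a (X j x) q | j x q. j \<in> A \<and> x \<in> J \<and> q < m} \<subseteq> carrier M"
    using sub C(1) by blast
  have "|C \<union> {a (X j x) q | j x q. j \<in> A \<and> x \<in> J \<and> q < m}| <o lam"
    by (rule ordLeq_ordLess_trans[OF card_of_mono1[OF sub] small_Un_pts[OF M(2-4) C(2)]])
  from realised_if_consistent[OF M(1) this carr cons] show ?thesis using that by blast
qed

lemma collapsible_translates:
  fixes M :: "('f, 'p, 'm) struct" and X :: "'i \<Rightarrow> 'j \<Rightarrow> 'k node"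
  assumes M: "monster_model L Th lam M" "|T| <o lam"
    and coll: "collapsible L M lam \<kappa> A J X" and \<nu>: "perp \<nu> \<xi>" "\<nu> \<in> T" "\<xi> \<in> T"
  shows "collapsible L M lam \<kappa> (A \<times> A) (J <+> J)
    (\<lambda>(i, j). case_sum (\<lambda>x. conc \<kappa> \<nu> (X i x))
      (\<lambda>x. conc \<kappa> \<xi> (X j x)))" (is "collapsible L M lam \<kappa> _ _ ?W")
proof -
  have mon: "is_struct L M" "saturated L lam M" "strongly_homogeneous L lam M" "Card_order lam"
    "\<not> finite (Field lam)"
    using M(1) unfolding monster_model_def models_def by blast+
  note perp' = \<nu>(1)[unfolded perp_commute[of \<nu>]]
  have A: "finite A" "A \<noteq> {}" and inj: "\<And>i. i \<in> A \<Longrightarrow> inj_on (X i) J"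
    and univ: "\<And>i. i \<in> A \<Longrightarrow> universal_antichain \<kappa> (X i ` J)"
    and sim: "\<And>i j. i \<in> A \<Longrightarrow> j \<in> A \<Longrightarrow> sim0 \<kappa> J (X i) (X j)"
    using coll unfolding collapsible_def by blast+
  have anti: "antichain \<kappa> (X i ` J)" if "i \<in> A" for i
    using univ[OF that] unfolding universal_antichain_def by blast
  then have XT: "X i ` J \<subseteq> T" if "i \<in> A" for i using that unfolding antichain_def by blast
  define PX where "PX i k = {(X i x, X k x) | x. x \<in> J}" for i k
  have psPX: "psim (PX i k)" if "i \<in> A" "k \<in> A" for i k
    using sim[OF that] sim0_iff_psim[OF XT XT] that unfolding PX_def by blast
  have rel: "{(?W (i, j) z, ?W (k, l) z) | z. z \<in> J <+> J} = conc_rel \<nu> (PX i k)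
    \<union> conc_rel \<xi> (PX j l)" for i j k l
  proof -
    have "{(?W (i, j) z, ?W (k, l) z) | z. z \<in> J <+> J} = (\<lambda>z. (?W (i, j) z, ?W (k, l) z))
      ` (Inl ` J \<union> Inr ` J)"
      unfolding Plus_def by blast
    also have "\<dots> = (\<lambda>x. (conc \<kappa> \<nu> (X i x), conc \<kappa> \<nu> (X k x))) ` J
      \<union> (\<lambda>x. (conc \<kappa> \<xi> (X j x), conc \<kappa> \<xi> (X l x))) ` J"
      by (simp add: image_Un image_image)
    also have "\<dots> = conc_rel \<nu> (PX i k) \<union> conc_rel \<xi> (PX j l)" unfolding conc_rel_def PX_def by blast
    finally show ?thesis .
  qed
  have img: "?W (i, j) ` (J <+> J) = conc \<kappa> \<nu> ` X i ` J \<union> conc \<kappa> \<xi> ` X j ` J" for i j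
    by (auto simp: Plus_def image_Un image_image)
  have univW: "universal_antichain \<kappa> (?W (i, j) ` (J <+> J))" if "i \<in> A" "j \<in> A" for i j
    unfolding img
    by (rule universal_antichain_superset_translate[OF univ[OF that(1)]
      antichain_translates[OF anti[OF that(1)] anti[OF that(2)] \<nu>] _ \<nu>(2)])
      blast
  have injW: "inj_on (?W (i, j)) (J <+> J)" if "i \<in> A" "j \<in> A" for i j
  proof (rule inj_onI)
    fix y z assume yz: "y \<in> J <+> J" "z \<in> J <+> J" "?W (i, j) y = ?W (i, j) z"
    have cross: "conc \<kappa> \<nu> u \<noteq> conc \<kappa> \<xi> v" for u v
      using conc_cross_incomparable[OF \<nu>, of u v] by (metis map_le_refl)
    have same: "x = x'" if "conc \<kappa> \<rho> (X k x) = conc \<kappa> \<rho> (X k x')" "k \<in> A" "\<rho> \<in> T" "x \<in> J" "x' \<in> J"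
      for \<rho> k x x'
      using that conc_inj[OF that(3), of "X k x"
        "X k x'"] XT[OF that(2)] inj_onD[OF inj[OF that(2)]] by blast
    show "y = z"
      using yz cross[symmetric] cross same[OF _ that(1) \<nu>(2)] same[OF _ that(2) \<nu>(3)]
      by (auto simp: Plus_def)
  qed
  have simW: "sim0 \<kappa> (J <+> J) (?W (i, j)) (?W (k, l))"
    if "i \<in> A" "j \<in> A" "k \<in> A" "l \<in> A" for i j k l
  proof -
    have T: "?W (i, j) ` (J <+> J) \<subseteq> T" if "i \<in> A" "j \<in> A" for i j
      using univW[OF that] unfolding universal_antichain_def antichain_def by blast
    show ?thesis
      unfolding sim0_iff_psim[OF T[OF that(1,2)] T[OF that(3,4)]] rel
      using psim_conc_Un[OF psPX[OF that(1,3)] psPX[OF that(2,4)] \<nu>] .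
  qed
  have main: "consistent M (\<Union>kl\<in>A \<times> A. subst_z (\<lambda>(x, q). a (?W kl x) q)
    ` joint_type L M m a C (J <+> J) (?W (i, j)) b)"
    if C: "C \<subseteq> carrier M" "|C| <o lam" and b: "b \<in> carrier M"
      and a: "\<forall>\<eta>\<in>T. \<forall>k<m. a \<eta> k \<in> carrier M" "strongly_indiscernible L M \<kappa> m a C"
      and ij: "i \<in> A" "j \<in> A"
      and delta: "delta_indiscernible L M \<kappa> (?W (i, j) ` (J <+> J)) m a (insert b C)"
      and no_ATP: "\<not> (\<exists>\<phi> y. witnesses_ATP L M \<phi> y)"
    for C b m i j and a :: "'k node \<Rightarrow> nat \<Rightarrow> 'm"
  proof -
    \<comment> \<open>The subtrees above \<nu> and \<xi>, reindexed by the whole tree, so that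
      collapsibility of \<open>X\<close> applies to each.\<close>
    define a1 a2 where "a1 u = a (conc \<kappa> \<nu> u)" and "a2 u = a (conc \<kappa> \<xi> u)" for u
    have pull: "pull m a (conc_rel \<nu> S) = pull m a1 S" "pull m a (conc_rel \<xi> S) = pull m a2 S" for S
      unfolding pull_conc_rel a1_def a2_def by simp_all
    have ptsT: "pts m a1 Z \<subseteq> pts m a T" "pts m a2 Z \<subseteq> pts m a T" if "Z \<subseteq> T" for Z
      using conc_tree[OF \<nu>(2)] conc_tree[OF \<nu>(3)] that unfolding pts_def a1_def a2_def by blast+
    have ptsM: "pts m a T \<subseteq> carrier M" using a(1) unfolding pts_def by blast
    have aM: "a1 u q \<in> carrier M" "a2 u q \<in> carrier M" if "u \<in> T" "q < m" for u q
      using a(1) conc_tree \<nu> that unfolding a1_def a2_def by blast+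
    note small = small_Un_pts[OF mon(4,5) M(2) C(2), of m a]
    \<comment> \<open>The similarities on the two sides can be chosen independently. Taking an
      identity on one side turns that side into parameters.\<close>
    have deltaW: "elem L M (pull m a1 S \<union> pull m a2 S' \<union> Id_on (insert b C))"
      if S: "S \<subseteq> X i ` J \<times> X i ` J" "psim S" "S' \<subseteq> X j ` J \<times> X j ` J" "psim S'" for S S'
    proof -
      have sub: "conc_rel \<nu> S \<union> conc_rel \<xi> S' \<subseteq> ?W (i, j) ` (J <+> J) \<times> ?W (i, j) ` (J <+> J)"
        using conc_rel_subset[OF S(1), of \<nu>] conc_rel_subset[OF S(3), of \<xi>] unfolding img by auto
      have WT: "?W (i, j) ` (J <+> J) \<subseteq> T"
        using univW[OF ij] unfolding universal_antichain_def antichain_def by blast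
      have "elem L M (pull m a (conc_rel \<nu> S \<union> conc_rel \<xi> S') \<union> Id_on (insert b C))"
        using delta[unfolded delta_indiscernible_iff[OF WT], rule_format,
          OF sub psim_conc_Un[OF S(2,4) \<nu>]] .
      then show ?thesis unfolding pull_Un pull .
    qed
    define C1 where "C1 = C \<union> pts m a2 (X j ` J)"
    have C1: "C1 \<subseteq> C \<union> pts m a T" unfolding C1_def using ptsT(2)[OF XT[OF ij(2)]] by blast
    have "C1 \<subseteq> carrier M" using C1 C(1) ptsM by blast
    moreover have "|C1| <o lam" by (rule ordLeq_ordLess_trans[OF card_of_mono1[OF C1] small])
    moreover have "strongly_indiscernible L M \<kappa> m a1 C1"
      unfolding C1_def a1_def a2_def
      by (rule strongly_indiscernible_translate[OF a(2) \<nu> XT[OF ij(2)]])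
    moreover have "elem L M (pull m a1 S \<union> Id_on (insert b C1))"
      if "S \<subseteq> X i ` J \<times> X i ` J" "psim S" for S
    proof -
      have "Id_on (X j ` J) \<subseteq> X j ` J \<times> X j ` J" by blast
      from deltaW[OF that this psim_Id_on[OF XT[OF ij(2)]]] show ?thesis
        unfolding pull_Id_on C1_def by (rule elem_mono) blast
    qed
    ultimately obtain b' where b': "b' \<in> carrier M" "realises L M m a1 C1 A J X i b b'"
      using collapsible_realised[OF mon(2,4,5) M(2) coll, of C1 b m a1 i] b aM(1) ij(1) no_ATP
      by blast
    \<comment> \<open>Indiscernibility over \<open>b\<close> is known relative to \<open>E\<close>,
      whereas the collapse above \<xi> has \<open>D\<close> as its parameters; \<open>Q k\<close>
      leads from one to the other.\<close>
    define E where "E = C \<union> pts m a1 (X i ` J)"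
    define D where "D = C \<union> pts m a1 (\<Union>k\<in>A. X k ` J)"
    have UT: "(\<Union>k\<in>A. X k ` J) \<subseteq> T" using XT by blast
    define Q where "Q k = pull m a1 (PX i k) \<union> Id_on C" for k
    have Dsub: "D \<union> pts m a2 T \<subseteq> C \<union> pts m a T" unfolding D_def
      using ptsT(1)[OF UT] ptsT(2)[OF order_refl] by blast
    have DM: "D \<union> pts m a2 T \<subseteq> carrier M" using Dsub C(1) ptsM by blast
    have Dsmall: "|D \<union> pts m a2 T| <o lam"
      by (rule ordLeq_ordLess_trans[OF card_of_mono1[OF Dsub] small])
    have Dind: "strongly_indiscernible L M \<kappa> m a2 D"
      unfolding D_def a1_def a2_def
      by (rule strongly_indiscernible_translate[OF a(2) perp' \<nu>(3,2) UT])
    have QED: "Q k \<subseteq> E \<times> D" if "k \<in> A" for k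
    proof -
      have "pull m a1 (PX i k) \<subseteq> pts m a1 (X i ` J) \<times> pts m a1 (\<Union>k\<in>A. X k ` J)"
        unfolding pull_def PX_def pts_def using that by blast
      then show ?thesis unfolding Q_def E_def D_def by blast
    qed
    have Edelta: "elem L M (pull m a2 S \<union> Id_on (insert b E))"
      if "S \<subseteq> X j ` J \<times> X j ` J" "psim S" for S
    proof -
      have "Id_on (X i ` J) \<subseteq> X i ` J \<times> X i ` J" by blast
      from deltaW[OF this psim_Id_on[OF XT[OF ij(1)]] that] show ?thesis
        unfolding pull_Id_on E_def by (rule elem_mono) blast
    qed
    have b'Q: "elem L M (insert (b, b') (Q k \<union> Id_on (pts m a2 (X j ` J))))" if "k \<in> A" for k
    proof -
      have "elem L M (insert (b, b') (pull m a1 (PX i k) \<union> Id_on C1))"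
        using b'(2) that unfolding realises_def PX_def by blast
      then show ?thesis unfolding Q_def C1_def by (rule elem_mono) blast
    qed
    obtain d where d: "d \<in> carrier M"
      "\<And>k. k \<in> A \<Longrightarrow> elem L M (insert (b, d) (Q k \<union> Id_on (pts m a2 (X j ` J))))"
      "\<And>S. S \<subseteq> X j ` J \<times> X j ` J \<Longrightarrow> psim S \<Longrightarrow> elem L M (pull m a2 S \<union> Id_on (insert d D))"
      by (rule indiscernible_realisation[OF mon(1-3) univ[OF ij(2)]
        DM Dsmall Dind QED Edelta b'(1) b'Q])
        (assumption | rule that)+
    have "D \<subseteq> carrier M" "|D| <o lam"
      using DM ordLeq_ordLess_trans[OF card_of_mono1 Dsmall, of D] by blast+
    then obtain e where e: "e \<in> carrier M" "realises L M m a2 D A J X j d e"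
      using collapsible_realised[OF mon(2,4,5) M(2) coll, of D d m a2 j]
        d(1,3) aM(2) Dind ij(2) no_ATP by blast
    have "realises L M m a C (A \<times> A) (J <+> J) ?W (i, j) b e"
      unfolding realises_def
    proof
      fix kl assume "kl \<in> A \<times> A"
      then obtain k l where kl: "kl = (k, l)" "k \<in> A" "l \<in> A" by blast
      \<comment> \<open>\<open>?R1\<close> moves \<open>X i\<close> to \<open>X k\<close> above
        \<nu> and fixes \<open>X j\<close> above \<xi>; \<open>?R2\<close> fixes the antichains
        above \<nu> and moves \<open>X j\<close> to \<open>X l\<close> above \<xi>. The composition
        handles the pair \<open>(k, l)\<close>.\<close>
      let ?R1 = "insert (b, d) (Q k \<union> Id_on (pts m a2 (X j ` J)))"
      let ?R2 = "insert (d, e) (pull m a2 (PX j l) \<union> Id_on D)"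
      have "elem L M ?R2" using e(2) kl(3) unfolding realises_def PX_def by blast
      from elem_relcomp[OF d(2)[OF kl(2)] this] have "elem L M (?R1 O ?R2)" .
      moreover have "insert (b, e) (pull m a1 (PX i k) \<union> pull m a2 (PX j l) \<union> Id_on C) \<subseteq> ?R1 O ?R2"
      proof
        fix z assume "z \<in> insert (b, e) (pull m a1 (PX i k) \<union> pull m a2 (PX j l) \<union> Id_on C)"
        then consider "z = (b, e)" | s t where "z = (s, t)" "(s, t) \<in> Q k"
          | s t where "z = (s, t)" "(s, t) \<in> pull m a2 (PX j l)" by (cases z) (auto simp: Q_def)
        then show "z \<in> ?R1 O ?R2"
        proof cases
          case 1
          have "(b, d) \<in> ?R1" "(d, e) \<in> ?R2" by auto
          then show ?thesis unfolding 1 by (intro relcompI)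
        next
          case 2
          then have "t \<in> D" using QED[OF kl(2)] by blast
          then have "(s, t) \<in> ?R1" "(t, t) \<in> ?R2" using 2(2) by auto
          then show ?thesis unfolding 2(1) by (intro relcompI)
        next
          case 3
          then have "s \<in> pts m a2 (X j ` J)" unfolding pull_def PX_def pts_def by blast
          then have "(s, s) \<in> ?R1" "(s, t) \<in> ?R2" using 3(2) by auto
          then show ?thesis unfolding 3(1) by (intro relcompI)
        qed
      qed
      ultimately have "elem L M (insert (b, e) (pull m a1 (PX i k) \<union> pull m a2 (PX j l) \<union> Id_on C))"
        by (rule elem_mono)
      then show "elem L M (insert (b, e) (pull m a {(?W (i, j) x, ?W kl x) | x. x \<in> J <+> J}
        \<union> Id_on C))"
        unfolding kl(1) rel pull_Un pull .
    qed
    then show ?thesis by (rule consistent_if_realised[OF e(1)])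
  qed
  show ?thesis
    unfolding collapsible_def
  proof (intro conjI)
    show "finite (A \<times> A)" "A \<times> A \<noteq> {}" using A by auto
    show "\<forall>ij\<in>A \<times> A. inj_on (?W ij) (J <+> J) \<and> universal_antichain \<kappa> (?W ij ` (J <+> J))"
      using injW univW by blast
    show "\<forall>ij\<in>A \<times> A. \<forall>kl\<in>A \<times> A. sim0 \<kappa> (J <+> J) (?W ij) (?W kl)" using simW by blast
    show "\<forall>C b m a. C \<subseteq> carrier M \<and> |C| <o lam \<and> b \<in> carrier M \<and>
        (\<forall>\<eta>\<in>T. \<forall>k<m. a \<eta> k \<in> carrier M) \<and> strongly_indiscernible L M \<kappa> m a C \<longrightarrow>
        (\<forall>ij\<in>A \<times> A. delta_indiscernible L M \<kappa> (?W ij ` (J <+> J)) m a (insert b C) \<longrightarrow>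
          consistent M (\<Union>kl\<in>A \<times> A. subst_z (\<lambda>(x, k). a (?W kl x) k) ` joint_type L M m a C (J <+> J)
            (?W ij) b) \<or>
          (\<exists>\<phi> y. witnesses_ATP L M \<phi> y))"
    proof (intro allI impI ballI; elim conjE)
      fix C b m ij and a :: "'k node \<Rightarrow> nat \<Rightarrow> 'm"
      assume asm: "ij \<in> A \<times> A" "delta_indiscernible L M \<kappa> (?W ij ` (J <+> J)) m a (insert b C)"
        "C \<subseteq> carrier M" "|C| <o lam" "b \<in> carrier M" "\<forall>\<eta>\<in>T. \<forall>k<m. a \<eta> k \<in> carrier M"
        "strongly_indiscernible L M \<kappa> m a C"
      obtain i j where ij: "ij = (i, j)" "i \<in> A" "j \<in> A" using asm(1) by blast
      show "consistent M (\<Union>kl\<in>A \<times> A. subst_z (\<lambda>(x, k). a (?W kl x) k)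
        ` joint_type L M m a C (J <+> J) (?W ij) b) \<or>
          (\<exists>\<phi> y. witnesses_ATP L M \<phi> y)"
        using main[OF asm(3-7) ij(2,3) asm(2)[unfolded ij(1)]] unfolding ij(1) by blast
    qed
  qed
qed

end

theorem lemma3p14:
  fixes L :: "('f, 'p) lang" and T :: "('f, 'p) fm set"
  assumes "complete_theory L T"
  shows "\<exists>\<kappa>\<^sub>0 :: ('f, 'p) fm set rel. Card_order \<kappa>\<^sub>0 \<and>
    (\<forall>\<kappa> :: 'k rel. Card_order \<kappa> \<and> \<kappa>\<^sub>0 \<le>o \<kappa> \<longrightarrow>
      (\<forall>(M :: ('f, 'p, 'm) struct) (lam :: 'l rel).
         monster_model L T lam M \<and> |tree \<kappa>| <o lam \<longrightarrow>
         (\<forall>(n :: nat) (J :: 'j set) (X :: nat \<Rightarrow> 'j \<Rightarrow> 'k node) \<nu> \<xi>.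
            collapsible L M lam \<kappa> {..n} J X \<and>
            \<nu> \<in> tree \<kappa> \<and> \<xi> \<in> tree \<kappa> \<and> perp \<nu> \<xi> \<and> lex_le \<kappa> \<nu> \<xi> \<longrightarrow>
            collapsible L M lam \<kappa> ({..n} \<times> {..n}) (J <+> J)
              (\<lambda>(i, j). case_sum (\<lambda>x. conc \<kappa> \<nu> (X i x)) (\<lambda>x. conc \<kappa> \<xi> (X j x))))))"
proof -
  let ?\<kappa>\<^sub>0 = "|UNIV :: ('f, 'p) fm set set|"
  \<comment> \<open>The cardinal has to force \<kappa> to be infinite, which yields the finite
    ordinals and the tails isomorphic to \<kappa>. Singletons of trivial equations show that it is
    infinite.\<close>
  have "inj (\<lambda>n. {Eq (Var n) (Var n) :: ('f, 'p) fm})" by (auto simp: inj_def)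
  then have inf: "infinite (UNIV :: ('f, 'p) fm set set)"
    by (meson finite_subset infinite_UNIV_nat range_inj_infinite subset_UNIV)
  show ?thesis
  proof (intro exI[of _ ?\<kappa>\<^sub>0] conjI allI impI; (elim conjE)?)
    show "Card_order ?\<kappa>\<^sub>0" by (rule card_of_Card_order)
    fix \<kappa> :: "'k rel" and M :: "('f, 'p, 'm) struct" and lam :: "'l rel"
      and n J \<nu> \<xi> and X :: "nat \<Rightarrow> 'j \<Rightarrow> 'k node"
    assume \<kappa>: "Card_order \<kappa>" "?\<kappa>\<^sub>0 \<le>o \<kappa>" and M: "monster_model L T lam M" "|tree \<kappa>| <o lam"
      and X: "collapsible L M lam \<kappa> {..n} J X" and \<nu>: "\<nu> \<in> tree \<kappa>" "\<xi> \<in> tree \<kappa>" "perp \<nu> \<xi>"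
    have "?\<kappa>\<^sub>0 \<le>o |Field \<kappa>|" using card_of_mono2[OF \<kappa>(2)] by (simp add: Field_card_of)
    then have "infinite (Field \<kappa>)" using card_of_ordLeq_infinite inf by blast
    then interpret card_tree \<kappa> using \<kappa>(1) by unfold_locales
    show "collapsible L M lam \<kappa> ({..n} \<times> {..n}) (J <+> J)
        (\<lambda>(i, j). case_sum (\<lambda>x. conc \<kappa> \<nu> (X i x)) (\<lambda>x. conc \<kappa> \<xi> (X j x)))"
      by (rule collapsible_translates[OF M X \<nu>(3,1,2)])
  qed
qed

end
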